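(* Let $\Sigma$ be a compact surface with an Oxtoby-Ulam probability measure $\mu$, and let $F\colon\Sigma\to\Sigma$ be a measurable pseudo-Anosov map. Then the set of periodic points of $F$ is dense in $\Sigma$.
   Context: Setting. $\Sigma$ is a compact surface and $\mu$ is an Oxtoby-Ulam (OU) measure on $\Sigma$: a Borel measure which is non-atomic, positive on non-empty open sets, and satisfies $\mu(\partial\Sigma)=0$; moreover $\mu(\Sigma)=1$. Measured turbulations. An immersed line is a continuous injective image of $\mathbb{R}$ in $\Sigma$ (with the topology of $\mathbb{R}$). A measured turbulation $(\mathcal{T},\nu)$ on $\Sigma$ is a partition of a full $\mu$-measure Borel subset of $\Sigma$ into immersed lines called streamlines, together with, on each streamline $\ell$, an OU measure $\nu_\ell$ (the stream measure: Borel, non-atomic, positive on non-empty open subsets of $\ell$) which is finite on closed arcs of $\ell$. It has dense streamlines if every streamline is dense in $\Sigma$. For distinct points $x,y$ of a streamline $\ell$, $[x,y]$ denotes the closed arc of $\ell$ with endpoints $x,y$; closed, half-open and open such arcs are called stream arcs, and the measure of a stream arc is its stream measure. $(\mathcal{T},\nu)$ is tame if, for a metric $d$ compatible with the topology of $\Sigma$ (the choice is irrelevant), for every $\epsilon>0$ there is $\delta>0$ such that every stream arc $[x,y]$ with $\nu([x,y])<\delta$ has $d(x,y)<\epsilon$. Two measured turbulations are transverse if there is a full $\mu$-measure subset of $\Sigma$ every point $x$ of which lies in streamlines $\ell,\ell'$ of the two turbulations which intersect (topologically) transversely at $x$. Tartans. Let $(\mathcal{T}^s,\nu^s)$, $(\mathcal{T}^u,\nu^u)$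 be a transverse pair of measured turbulations, called stable and unstable. A tartan $R=(R^s,R^u)$ consists of Borel subsets $R^s,R^u$ of $\Sigma$ which are disjoint unions of stable and unstable stream arcs respectively (called the stable and unstable fibers of $R$), such that: (a) every arc of $R^s$ intersects every arc of $R^u$ exactly once, either transversely or at an endpoint of one or both arcs; (b) the arcs can be oriented so that every arc of $R^s$ (respectively $R^u$) crosses the arcs of $R^u$ (respectively $R^s$) in the same order; (c) the measures of the arcs of $R^s$ and $R^u$ are bounded above; (d) some open topological disk in $\Sigma$ contains $R^s\cup R^u$. Write $R^\pitchfork=R^s\cap R^u$; $R$ is a positive measure tartan if $\mu(R^\pitchfork)>0$. For $x\in R^\pitchfork$, $\mathfrak{s}(x)$ and $\mathfrak{u}(x)$ are the stable and unstable fibers of $R$ containing $x$; for a stable fiber $\mathfrak{s}$ and unstable fiber $\mathfrak{u}$, $\mathfrak{s}\pitchfork\mathfrak{u}=\mathfrak{u}\pitchfork\mathfrak{s}$ is their unique intersection point, $E^{\mathfrak{s}}=\mathfrak{s}\cap R^\pitchfork$, $E^{\mathfrak{u}}=\mathfrak{u}\cap R^\pitchfork$, and $\nu_{\mathfrak{s}},\nu_{\mathfrak{u}}$ are the restrictions of the stream measures to $E^{\mathfrak{s}},E^{\mathfrak{u}}$. $R$ is compatible if, for all stable and unstable fibers $\mathfrak{s},\mathfrak{u}$ of $R$, the bijection $\psi^{\mathfrak{s},\mathfrak{u}}\colon E^{\mathfrak{s}}\times E^{\mathfrak{u}}\to R^\pitchfork$, $(x,y)\mapsto\mathfrak{u}(x)\pitchfork\mathfrak{s}(y)$,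 is bi-measurable and $\psi^{\mathfrak{s},\mathfrak{u}}_*(\nu_{\mathfrak{s}}\times\nu_{\mathfrak{u}})=\mu|_{R^\pitchfork}$. Fullness. The transverse pair is full if (a) there is a countable collection $R_i$ of positive measure compatible tartans with $\mu(\bigcup_i R_i^\pitchfork)=1$; and (b) for every non-empty open $U\subset\Sigma$ there is a positive measure compatible tartan $R$ with $R^s\cup R^u\subset U$. Measurable pseudo-Anosov maps. A pair $(\mathcal{T}^s,\nu^s),(\mathcal{T}^u,\nu^u)$ are measurable pseudo-Anosov turbulations if they are transverse, tame, full, and have dense streamlines. For a $\mu$-preserving homeomorphism $F\colon\Sigma\to\Sigma$, $F(\mathcal{T},\nu)$ is the measured turbulation with streamlines $F(\ell)$, $\ell\in\mathcal{T}$, and measure $F_*(\nu_\ell)$ on $F(\ell)$. $F$ is measurable pseudo-Anosov if there are measurable pseudo-Anosov turbulations $(\mathcal{T}^s,\nu^s),(\mathcal{T}^u,\nu^u)$ and a number $\lambda>1$ (the dilatation) such that $F(\mathcal{T}^s,\nu^s)=(\mathcal{T}^s,\lambda\nu^s)$ and $F(\mathcal{T}^u,\nu^u)=(\mathcal{T}^u,\lambda^{-1}\nu^u)$. (So $F$ contracts stable stream measure and expands unstable stream measure by the factor $\lambda$.) *)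

theory Defs
  imports "HOL-Analysis.Analysis"
begin

text \<open>A surface is a subset \<open>S\<close> of an arbitrary metric space type, carrying the subspace topology;
  \<^term>\<open>dist\<close> plays the role of the compatible metric.\<close>

definition compact_surface :: "'a::metric_space set \<Rightarrow> bool" where
  "compact_surface S \<longleftrightarrow> compact S \<and>
     (\<forall>x\<in>S. \<exists>U V. openin (top_of_set S) U \<and> x \<in> U \<and>
        openin (top_of_set {z::complex. 0 \<le> Im z}) V \<and> U homeomorphic V)"

definition surface_boundary :: "'a::metric_space set \<Rightarrow> 'a set" where
  "surface_boundary S = {x\<in>S. \<not> (\<exists>U (V::complex set).
     openin (top_of_set S) U \<and> x \<in> U \<and> open V \<and> U homeomorphic V)}"

definition borel_of :: "'a topology \<Rightarrow> 'a measure" where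
  "borel_of X = sigma (topspace X) {U. openin X U}"

definition nonatomic :: "'a measure \<Rightarrow> bool" where
  "nonatomic M \<longleftrightarrow> (\<forall>A\<in>sets M. emeasure M A > 0 \<longrightarrow>
     (\<exists>B\<in>sets M. B \<subseteq> A \<and> 0 < emeasure M B \<and> emeasure M B < emeasure M A))"

text \<open>Oxtoby-Ulam measures on a space \<open>X\<close> whose manifold boundary is \<open>B\<close>: for the surface, \<open>B\<close> is
  its boundary, for a streamline \<open>B = {}\<close>.\<close>

definition ou_measure :: "'a topology \<Rightarrow> 'a set \<Rightarrow> 'a measure \<Rightarrow> bool" where
  "ou_measure X B M \<longleftrightarrow> sets M = sets (borel_of X) \<and> nonatomic M \<and>
     (\<forall>U. openin X U \<and> U \<noteq> {} \<longrightarrow> emeasure M U > 0) \<and> emeasure M B = 0"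

text \<open>An immersed line is represented by its intrinsic topology (that of the real line), which is
  in general finer than the subspace topology and not determined by the underlying point set.\<close>

definition immersed_line :: "'a::metric_space set \<Rightarrow> 'a topology \<Rightarrow> bool" where
  "immersed_line S L \<longleftrightarrow> L homeomorphic_space euclideanreal \<and>
     continuous_map L (top_of_set S) (\<lambda>x. x)"

abbreviation line_param :: "'a topology \<Rightarrow> (real \<Rightarrow> 'a) \<Rightarrow> bool" where
  "line_param L h \<equiv> homeomorphic_map euclideanreal L h"

definition open_arc :: "'a topology \<Rightarrow> 'a set \<Rightarrow> bool" where
  "open_arc L A \<longleftrightarrow> (\<exists>h a b. line_param L h \<and> a < b \<and> A = h ` {a<..<b})"

definition stream_arc :: "'a topology \<Rightarrow> 'a set \<Rightarrow> bool" where
  "stream_arc L A \<longleftrightarrow> (\<exists>h a b. line_param L h \<and> a < b \<and>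
     (A = h ` {a..b} \<or> A = h ` {a<..b} \<or> A = h ` {a..<b} \<or> A = h ` {a<..<b}))"

text \<open>A measured turbulation is the set of its streamlines, each paired with its stream measure.\<close>

type_synonym 'a turbulation = "('a topology \<times> 'a measure) set"

definition measured_turbulation ::
    "'a::metric_space set \<Rightarrow> 'a measure \<Rightarrow> 'a turbulation \<Rightarrow> bool" where
  "measured_turbulation S \<mu> T \<longleftrightarrow>
     (\<forall>(L, N)\<in>T. immersed_line S L \<and> ou_measure L {} N \<and>
        (\<forall>h a b. line_param L h \<and> a < b \<longrightarrow> emeasure N (h ` {a..b}) < \<infinity>)) \<and>
     pairwise (\<lambda>(L, N) (L', N'). disjnt (topspace L) (topspace L')) T \<and>
     (\<Union>(L, N)\<in>T. topspace L) \<in> sets \<mu> \<and> emeasure \<mu> (\<Union>(L, N)\<in>T. topspace L) = 1"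

definition dense_streamlines :: "'a::metric_space set \<Rightarrow> 'a turbulation \<Rightarrow> bool" where
  "dense_streamlines S T \<longleftrightarrow> (\<forall>(L, N)\<in>T. S \<subseteq> closure (topspace L))"

definition tame :: "'a::metric_space turbulation \<Rightarrow> bool" where
  "tame T \<longleftrightarrow> (\<forall>\<epsilon>>0. \<exists>\<delta>>0. \<forall>(L, N)\<in>T. \<forall>h a b.
     line_param L h \<and> a < b \<and> emeasure N (h ` {a..b}) < ennreal \<delta> \<longrightarrow> dist (h a) (h b) < \<epsilon>)"

text \<open>Topological transversality: in some chart of the surface centred at \<open>x\<close>, local arcs of the two
  lines through \<open>x\<close> are the two coordinate axes.\<close>

definition transverse_at ::
    "'a::metric_space set \<Rightarrow> 'a \<Rightarrow> 'a topology \<Rightarrow> 'a topology \<Rightarrow> bool" where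
  "transverse_at S x L L' \<longleftrightarrow> (\<exists>U \<phi> \<psi>. openin (top_of_set S) U \<and>
     homeomorphism ({-1<..<1::real} \<times> {-1<..<1::real}) U \<phi> \<psi> \<and> \<phi> (0, 0) = x \<and>
     open_arc L (\<phi> ` ({-1<..<1} \<times> {0})) \<and> open_arc L' (\<phi> ` ({0} \<times> {-1<..<1})))"

definition transverse_pair ::
    "'a::metric_space set \<Rightarrow> 'a measure \<Rightarrow> 'a turbulation \<Rightarrow> 'a turbulation \<Rightarrow> bool" where
  "transverse_pair S \<mu> Ts Tu \<longleftrightarrow> (AE x in \<mu>. \<exists>(L, N)\<in>Ts. \<exists>(L', N')\<in>Tu.
     x \<in> topspace L \<and> x \<in> topspace L' \<and> transverse_at S x L L')"

definition arc_of :: "'a turbulation \<Rightarrow> 'a topology \<Rightarrow> 'a measure \<Rightarrow> 'a set \<Rightarrow> bool" where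
  "arc_of T L N A \<longleftrightarrow> (L, N) \<in> T \<and> stream_arc L A"

text \<open>Tartans are given by their sets of fibers \<open>fs\<close>, \<open>fu\<close>, so that
  \<open>R\<^sup>s = \<Union>fs\<close> and \<open>R\<^sup>u = \<Union>fu\<close>.\<close>

type_synonym 'a tartan = "'a set set \<times> 'a set set"

definition cross_point :: "'a set \<Rightarrow> 'a set \<Rightarrow> 'a" where
  "cross_point A B = the_elem (A \<inter> B)"

text \<open>The fibers \<open>fs\<close> of \<open>T\<close> can be oriented, the orientation of \<open>A\<close> being that of a parametrization
  \<open>h A\<close> of the streamline containing it, so that all cross the arcs in \<open>fu\<close> in the same order.\<close>

definition cross_in_same_order :: "'a turbulation \<Rightarrow> 'a set set \<Rightarrow> 'a set set \<Rightarrow> bool" where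
  "cross_in_same_order T fs fu \<longleftrightarrow> (\<exists>h.
     (\<forall>A\<in>fs. \<exists>L N. arc_of T L N A \<and> line_param L (h A)) \<and>
     (\<forall>A\<in>fs. \<forall>A'\<in>fs. \<forall>B\<in>fu. \<forall>B'\<in>fu.
        inv (h A) (cross_point A B) < inv (h A) (cross_point A B') \<longleftrightarrow>
        inv (h A') (cross_point A' B) < inv (h A') (cross_point A' B')))"

definition fibers :: "'a measure \<Rightarrow> 'a turbulation \<Rightarrow> 'a set set \<Rightarrow> bool" where
  "fibers \<mu> T fs \<longleftrightarrow> (\<forall>A\<in>fs. \<exists>L N. arc_of T L N A) \<and> pairwise disjnt fs \<and> \<Union>fs \<in> sets \<mu>"

definition bounded_arcs :: "'a turbulation \<Rightarrow> 'a set set \<Rightarrow> bool" where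
  "bounded_arcs T fs \<longleftrightarrow> (\<exists>K::real. \<forall>A\<in>fs. \<forall>L N. arc_of T L N A \<longrightarrow> emeasure N A \<le> ennreal K)"

text \<open>The endpoints of an arc \<open>A\<close> of \<open>L\<close> are the points of \<^term>\<open>L frontier_of A\<close>.\<close>

definition tartan :: "'a::metric_space set \<Rightarrow> 'a measure \<Rightarrow> 'a turbulation \<Rightarrow> 'a turbulation \<Rightarrow>
    'a tartan \<Rightarrow> bool" where
  "tartan S \<mu> Ts Tu = (\<lambda>(fs, fu).
     fibers \<mu> Ts fs \<and> fibers \<mu> Tu fu \<and>
     (\<forall>A\<in>fs. \<forall>B\<in>fu. \<exists>x. A \<inter> B = {x} \<and>
        (\<forall>L N L' N'. arc_of Ts L N A \<and> arc_of Tu L' N' B \<longrightarrow>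
           transverse_at S x L L' \<or> x \<in> L frontier_of A \<or> x \<in> L' frontier_of B)) \<and>
     cross_in_same_order Ts fs fu \<and> cross_in_same_order Tu fu fs \<and>
     bounded_arcs Ts fs \<and> bounded_arcs Tu fu \<and>
     (\<exists>D. openin (top_of_set S) D \<and> D homeomorphic ball (0::complex) 1 \<and> \<Union>fs \<union> \<Union>fu \<subseteq> D))"

definition tartan_cross :: "'a tartan \<Rightarrow> 'a set" where
  "tartan_cross = (\<lambda>(fs, fu). \<Union>fs \<inter> \<Union>fu)"

definition fiber_through :: "'a set set \<Rightarrow> 'a \<Rightarrow> 'a set" where
  "fiber_through fs x = (THE A. A \<in> fs \<and> x \<in> A)"

definition tartan_map :: "'a tartan \<Rightarrow> 'a \<times> 'a \<Rightarrow> 'a" where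
  "tartan_map = (\<lambda>(fs, fu) (x, y). cross_point (fiber_through fu x) (fiber_through fs y))"

definition bimeasurable :: "'a measure \<Rightarrow> 'b measure \<Rightarrow> ('a \<Rightarrow> 'b) \<Rightarrow> bool" where
  "bimeasurable P Q f \<longleftrightarrow> bij_betw f (space P) (space Q) \<and> f \<in> measurable P Q \<and>
     the_inv_into (space P) f \<in> measurable Q P"

definition compatible :: "'a measure \<Rightarrow> 'a turbulation \<Rightarrow> 'a turbulation \<Rightarrow> 'a tartan \<Rightarrow> bool" where
  "compatible \<mu> Ts Tu R \<longleftrightarrow> (\<forall>A\<in>fst R. \<forall>B\<in>snd R. \<forall>L N L' N'.
     arc_of Ts L N A \<and> arc_of Tu L' N' B \<longrightarrow>
     (let P = restrict_space N (A \<inter> tartan_cross R) \<Otimes>\<^sub>M restrict_space N' (B \<inter> tartan_cross R);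
          Q = restrict_space \<mu> (tartan_cross R)
      in bimeasurable P Q (tartan_map R) \<and> distr P Q (tartan_map R) = Q))"

definition pos_compatible_tartan :: "'a::metric_space set \<Rightarrow> 'a measure \<Rightarrow> 'a turbulation \<Rightarrow>
    'a turbulation \<Rightarrow> 'a tartan \<Rightarrow> bool" where
  "pos_compatible_tartan S \<mu> Ts Tu R \<longleftrightarrow>
     tartan S \<mu> Ts Tu R \<and> emeasure \<mu> (tartan_cross R) > 0 \<and> compatible \<mu> Ts Tu R"

definition full_pair ::
    "'a::metric_space set \<Rightarrow> 'a measure \<Rightarrow> 'a turbulation \<Rightarrow> 'a turbulation \<Rightarrow> bool" where
  "full_pair S \<mu> Ts Tu \<longleftrightarrow>
     (\<exists>C. countable C \<and> (\<forall>R\<in>C. pos_compatible_tartan S \<mu> Ts Tu R) \<and>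
        emeasure \<mu> (\<Union>R\<in>C. tartan_cross R) = 1) \<and>
     (\<forall>U. openin (top_of_set S) U \<and> U \<noteq> {} \<longrightarrow>
        (\<exists>fs fu. pos_compatible_tartan S \<mu> Ts Tu (fs, fu) \<and> \<Union>fs \<union> \<Union>fu \<subseteq> U))"

definition pA_turbulations ::
    "'a::metric_space set \<Rightarrow> 'a measure \<Rightarrow> 'a turbulation \<Rightarrow> 'a turbulation \<Rightarrow> bool" where
  "pA_turbulations S \<mu> Ts Tu \<longleftrightarrow>
     measured_turbulation S \<mu> Ts \<and> measured_turbulation S \<mu> Tu \<and>
     transverse_pair S \<mu> Ts Tu \<and> tame Ts \<and> tame Tu \<and> full_pair S \<mu> Ts Tu \<and>
     dense_streamlines S Ts \<and> dense_streamlines S Tu"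

text \<open>The topology on \<open>F(\<ell>)\<close> transported from \<open>\<ell>\<close>; it is only used for \<open>F\<close> injective on \<open>\<ell>\<close>.\<close>

definition image_topology :: "('a \<Rightarrow> 'b) \<Rightarrow> 'a topology \<Rightarrow> 'b topology" where
  "image_topology F L =
     topology (\<lambda>V. V \<subseteq> F ` topspace L \<and> openin L {x \<in> topspace L. F x \<in> V})"

lemma openin_image_topology:
  "openin (image_topology F L) V \<longleftrightarrow>
     V \<subseteq> F ` topspace L \<and> openin L {x \<in> topspace L. F x \<in> V}"
proof -
  have "istopology (\<lambda>V. V \<subseteq> F ` topspace L \<and> openin L {x \<in> topspace L. F x \<in> V})"
    unfolding istopology_def
  proof (intro conjI allI impI)
    fix A B
    assume "A \<subseteq> F ` topspace L \<and> openin L {x \<in> topspace L. F x \<in> A}"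
      and "B \<subseteq> F ` topspace L \<and> openin L {x \<in> topspace L. F x \<in> B}"
    moreover have "{x \<in> topspace L. F x \<in> A \<inter> B} =
        {x \<in> topspace L. F x \<in> A} \<inter> {x \<in> topspace L. F x \<in> B}" by auto
    ultimately show "openin L {x \<in> topspace L. F x \<in> A \<inter> B}" by auto
  next
    fix K
    assume "\<forall>A\<in>K. A \<subseteq> F ` topspace L \<and> openin L {x \<in> topspace L. F x \<in> A}"
    moreover have "{x \<in> topspace L. F x \<in> \<Union>K} = (\<Union>A\<in>K. {x \<in> topspace L. F x \<in> A})" by auto
    ultimately show "openin L {x \<in> topspace L. F x \<in> \<Union>K}" by auto
  qed auto
  then show ?thesis
    unfolding image_topology_def by (simp add: topology_inverse')
qed

lemma topspace_image_topology: "topspace (image_topology F L) = F ` topspace L"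
proof -
  have "{x \<in> topspace L. F x \<in> F ` topspace L} = topspace L" by auto
  then have "openin (image_topology F L) (F ` topspace L)"
    by (simp add: openin_image_topology)
  moreover have "topspace (image_topology F L) \<subseteq> F ` topspace L"
    using openin_topspace[of "image_topology F L"] unfolding openin_image_topology by blast
  ultimately show ?thesis
    using openin_subset by blast
qed

lemma homeomorphic_map_image_topology:
  assumes "inj_on F (topspace L)"
  shows "homeomorphic_map L (image_topology F L) F"
proof -
  have "quotient_map L (image_topology F L) F"
    unfolding quotient_map_def topspace_image_topology openin_image_topology by auto
  then show ?thesis
    using assms by (simp add: homeomorphic_map_def)
qed

definition image_turbulation :: "('a \<Rightarrow> 'a) \<Rightarrow> 'a turbulation \<Rightarrow> 'a turbulation" where
  "image_turbulation F T =
     (\<lambda>(L, N). (image_topology F L, distr N (borel_of (image_topology F L)) F)) ` T"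

definition scale_turbulation :: "real \<Rightarrow> 'a turbulation \<Rightarrow> 'a turbulation" where
  "scale_turbulation c T = (\<lambda>(L, N). (L, scale_measure (ennreal c) N)) ` T"

definition measurable_pA :: "'a::metric_space set \<Rightarrow> 'a measure \<Rightarrow> ('a \<Rightarrow> 'a) \<Rightarrow> bool" where
  "measurable_pA S \<mu> F \<longleftrightarrow>
     (\<exists>G. homeomorphism S S F G) \<and> distr \<mu> \<mu> F = \<mu> \<and>
     (\<exists>Ts Tu c. pA_turbulations S \<mu> Ts Tu \<and> c > 1 \<and>
        image_turbulation F Ts = scale_turbulation c Ts \<and>
        image_turbulation F Tu = scale_turbulation (inverse c) Tu)"

end

theory Submission
  imports Defs "HOL-Complex_Analysis.Complex_Analysis" "HOL-Probability.Probability"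
begin

text \<open>Near a given point choose a disc \<open>U\<close> with \<open>\<mu> U < 1/2\<close> and a compatible tartan in \<open>U\<close>. By recurrence a
  block of the tartan returns to itself with frequency bounded below along infinitely many iterates
  \<open>F\<^sup>n\<close>, while tameness makes \<open>F\<^sup>n\<close> contract the stable fibers, and \<open>F\<^sup>-\<^sup>n\<close> the unstable ones, to small
  diameter. Since membership in a Borel set is locally constant off a set of small measure, the
  product structure yields an \<open>n\<close> and four points of the tartan, the corners of a rectangle \<open>J\<close> of
  fiber arcs, whose images under \<open>F\<^sup>n\<close> are the corners of a rectangle \<open>J'\<close> of fiber arcs that is
  narrower in the stable direction, taller in the unstable direction, and crosses \<open>J\<close>. As \<open>F\<^sup>n\<close>
  preserves \<open>\<mu>\<close>, it must map the inside of \<open>J\<close> to the inside of \<open>J'\<close>, not to the complement, which has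
  measure larger than \<open>1/2\<close>. In the chart \<open>U\<close>, the vector field \<open>F\<^sup>n z - z\<close> has nonzero winding number
  along \<open>J\<close>, hence a zero in the closed inside of \<open>J\<close>. The chart is the plane and not the sphere, so
  the rectangles are taken in that one of two adjacent blocks of the tartan which does not surround
  the point at infinity.\<close>

section \<open>Theta curves\<close>

text \<open>The image of a fiber under an iterate need not be a fiber, and the crossing set of a
  tartan is only a Borel set, so there is no Markov rectangle whose corners could be followed. The
  corners are found by measure, and the obstacle is the order of the choices. The exceptional set
  and the scale of the Borel approximation come before \<open>n\<close>, because tameness makes
  \<open>n\<close> depend on that scale; yet the exceptional set has to be small against the set of
  points that return at time \<open>n\<close>. That each return set has positive measure is too
  little for this: the lower bound has to be fixed before all these choices. The two rectangles
  cross and neither contains the other, so Brouwer's theorem does not apply and an index is computed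
  instead. Only corners and sides are under control, never the map inside, so the index is found
  from the boundary alone. The iterate may reverse either direction; therefore no order is assumed
  between the two rows of \<open>J\<close> or between the two columns of \<open>J'\<close>, and
  either sign of the index may occur.\<close>

lemma connected_subset_open_cases:
  assumes "connected C" "open A" "open B" "C \<subseteq> A \<union> B" "A \<inter> B = {}"
  shows "C \<subseteq> A \<or> C \<subseteq> B"
proof -
  have "A \<inter> B \<inter> C = {}" using assms(5) by simp
  from connectedD[OF assms(1-3) this assms(4)] show ?thesis
    using assms(4) by auto
qed

lemma connected_subset_inside_or_outside:
  fixes C :: "complex set"
  assumes "closed K" "connected C" "C \<inter> K = {}"
  shows "C \<subseteq> inside K \<or> C \<subseteq> outside K"
proof (rule connected_subset_open_cases[OF assms(2)])
  show "C \<subseteq> inside K \<union> outside K"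
    using assms(3) by (simp add: inside_Un_outside disjoint_eq_subset_Compl)
qed (use assms(1) in \<open>simp_all add: open_inside open_outside\<close>)

text \<open>A frame cut by a column is such a figure: two outer arcs and the column, all with the
  same ends. The question is always which of the three arcs lies between the other two.\<close>

locale theta =
  fixes \<alpha> \<beta> \<gamma> :: "real \<Rightarrow> complex" and p q :: complex
  assumes arcs: "arc \<alpha>" "arc \<beta>" "arc \<gamma>"
    and starts: "pathstart \<alpha> = p" "pathstart \<beta> = p" "pathstart \<gamma> = p"
    and finishes: "pathfinish \<alpha> = q" "pathfinish \<beta> = q" "pathfinish \<gamma> = q"
    and meets: "path_image \<alpha> \<inter> path_image \<beta> = {p, q}" "path_image \<alpha> \<inter> path_image \<gamma> = {p, q}"
      "path_image \<beta> \<inter> path_image \<gamma> = {p, q}"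
begin

lemma permute: "theta \<beta> \<gamma> \<alpha> p q" "theta \<beta> \<alpha> \<gamma> p q"
  using arcs starts finishes meets by (simp_all add: theta_def Int_commute)

lemma ends_distinct: "p \<noteq> q"
  using arc_distinct_ends[OF arcs(1)] starts finishes by auto

lemma simple_loop: "simple_path (\<alpha> +++ reversepath \<beta>)"
  "pathfinish (\<alpha> +++ reversepath \<beta>) = pathstart (\<alpha> +++ reversepath \<beta>)"
  "path_image (\<alpha> +++ reversepath \<beta>) = path_image \<alpha> \<union> path_image \<beta>"
  using arcs starts finishes meets
  by (auto intro!: simple_path_join_loop simp: arc_reversepath path_image_join)

lemma jordan:
  "inside (path_image \<alpha> \<union> path_image \<beta>) \<noteq> {}"
  "connected (inside (path_image \<alpha> \<union> path_image \<beta>))"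
  "frontier (inside (path_image \<alpha> \<union> path_image \<beta>)) = path_image \<alpha> \<union> path_image \<beta>"
  using Jordan_inside_outside[OF simple_loop(1,2), unfolded simple_loop(3)] by simp_all

text \<open>The winding number of an arc that is not closed is some complex number, but for two arcs
  with common ends the difference is the winding number of a simple loop.\<close>

lemma winding_number_inside:
  assumes "z \<in> inside (path_image \<alpha> \<union> path_image \<beta>)"
  shows "winding_number \<alpha> z - winding_number \<beta> z \<in> {-1, 1}"
proof -
  have z: "z \<notin> path_image \<alpha>" "z \<notin> path_image \<beta>"
    using assms by (auto simp: inside_def)
  have "z \<in> inside (path_image (\<alpha> +++ reversepath \<beta>))"
    using assms simple_loop(3) by simp
  with simple_closed_path_winding_number_inside[OF simple_loop(1)]
  have "winding_number (\<alpha> +++ reversepath \<beta>) z = 1 \<or> winding_number (\<alpha> +++ reversepath \<beta>) z = -1"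
    by metis
  moreover have "winding_number (\<alpha> +++ reversepath \<beta>) z = winding_number \<alpha> z - winding_number \<beta> z"
    using arcs starts finishes z
    by (subst winding_number_join) (auto simp: winding_number_reversepath arc_imp_path)
  ultimately show ?thesis by auto
qed

lemma winding_number_outside:
  assumes "z \<in> outside (path_image \<alpha> \<union> path_image \<beta>)"
  shows "winding_number \<alpha> z = winding_number \<beta> z"
proof -
  have z: "z \<notin> path_image \<alpha>" "z \<notin> path_image \<beta>"
    using assms by (auto simp: outside_def)
  have "winding_number (\<alpha> +++ reversepath \<beta>) z = 0"
    using winding_number_zero_in_outside[of "\<alpha> +++ reversepath \<beta>" z] simple_loop assms
    by (auto simp: simple_path_imp_path)
  moreover have "winding_number (\<alpha> +++ reversepath \<beta>) z = winding_number \<alpha> z - winding_number \<beta> z"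
    using arcs starts finishes z
    by (subst winding_number_join) (auto simp: winding_number_reversepath arc_imp_path)
  ultimately show ?thesis by simp
qed

lemma closed_images: "closed (path_image \<alpha>)" "closed (path_image \<beta>)" "closed (path_image \<gamma>)"
  using arcs by (auto simp: closed_arc_image)

text \<open>If neither outer arc enters the other inside, each inside is connected and avoids the
  curve around the other. Overlapping would make the two insides equal, hence also their frontiers,
  and \<open>\<alpha>\<close> would be covered by \<open>\<beta>\<close> and
  \<open>\<gamma>\<close>, which it meets only at its ends.\<close>

lemma insides_disjoint:
  assumes "path_image \<gamma> \<inter> inside (path_image \<alpha> \<union> path_image \<beta>) = {}"
    and "path_image \<alpha> \<inter> inside (path_image \<beta> \<union> path_image \<gamma>) = {}"
  shows "inside (path_image \<alpha> \<union> path_image \<beta>) \<inter> inside (path_image \<beta> \<union> path_image \<gamma>) = {}"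
proof (rule ccontr)
  interpret r: theta \<beta> \<gamma> \<alpha> p q by (rule permute)
  let ?ab = "path_image \<alpha> \<union> path_image \<beta>" and ?bc = "path_image \<beta> \<union> path_image \<gamma>"
  assume meet: "inside ?ab \<inter> inside ?bc \<noteq> {}"
  have disj: "inside ?ab \<inter> ?bc = {}" "inside ?bc \<inter> ?ab = {}"
    using assms inside_no_overlap[of ?ab] inside_no_overlap[of ?bc] by (simp_all add: Int_Un_distrib Int_Un_distrib2 Int_commute)
  have "inside ?ab \<subseteq> inside ?bc \<or> inside ?ab \<subseteq> outside ?bc"
    by (rule connected_subset_inside_or_outside) (use jordan(2) disj closed_images in \<open>simp_all add: closed_Un\<close>)
  moreover have "\<not> inside ?ab \<subseteq> outside ?bc"
    using meet inside_Int_outside[of ?bc] by blast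
  moreover have "inside ?bc \<subseteq> inside ?ab \<or> inside ?bc \<subseteq> outside ?ab"
    by (rule connected_subset_inside_or_outside) (use r.jordan(2) disj closed_images in \<open>simp_all add: closed_Un\<close>)
  moreover have "\<not> inside ?bc \<subseteq> outside ?ab"
    using meet inside_Int_outside[of ?ab] by blast
  ultimately have "inside ?ab = inside ?bc"
    by simp
  then have ab: "?ab = ?bc"
    using jordan(3) r.jordan(3) by metis
  have "path_image \<alpha> \<subseteq> {p, q}"
  proof
    fix x assume x: "x \<in> path_image \<alpha>"
    with ab have "x \<in> path_image \<beta> \<or> x \<in> path_image \<gamma>" by (metis Un_iff)
    with x show "x \<in> {p, q}" by (metis IntI meets(1,2))
  qed
  then have "path_image \<alpha> - {p, q} = {}"
    by fast
  then show False
    using nonempty_simple_path_endless[of \<alpha>] arcs(1) starts(1) finishes(1) by (simp add: arc_imp_simple_path)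
qed

text \<open>Were no arc inside the loop of the other two, a point inside the loop of
  \<open>\<alpha>\<close> and \<open>\<beta>\<close> would be outside both other loops. All three
  arcs would have the same winding number about it, while those of \<open>\<alpha>\<close> and
  \<open>\<beta>\<close> differ.\<close>

lemma trichotomy:
  "path_image \<gamma> \<inter> inside (path_image \<alpha> \<union> path_image \<beta>) \<noteq> {} \<or>
   path_image \<alpha> \<inter> inside (path_image \<beta> \<union> path_image \<gamma>) \<noteq> {} \<or>
   path_image \<beta> \<inter> inside (path_image \<gamma> \<union> path_image \<alpha>) \<noteq> {}"
proof (rule ccontr)
  assume none: "\<not> ?thesis"
  interpret r: theta \<beta> \<gamma> \<alpha> p q by (rule permute)
  interpret s: theta \<gamma> \<alpha> \<beta> p q by (rule r.permute)
  obtain z where z: "z \<in> inside (path_image \<alpha> \<union> path_image \<beta>)"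
    using jordan(1) by auto
  have "z \<notin> inside (path_image \<beta> \<union> path_image \<gamma>)"
    using insides_disjoint none z by blast
  moreover have "z \<notin> inside (path_image \<gamma> \<union> path_image \<alpha>)"
    using s.insides_disjoint none z by blast
  moreover have "z \<notin> path_image \<alpha>" "z \<notin> path_image \<beta>"
    using z by (auto simp: inside_def)
  moreover have "z \<notin> path_image \<gamma>"
    using z none by blast
  ultimately have "z \<in> outside (path_image \<beta> \<union> path_image \<gamma>)" "z \<in> outside (path_image \<gamma> \<union> path_image \<alpha>)"
    by (simp_all add: outside_inside)
  then have "winding_number \<alpha> z - winding_number \<beta> z = 0"
    using r.winding_number_outside s.winding_number_outside by simp
  then show False
    using winding_number_inside[OF z] by auto
qed

text \<open>The arc \<open>\<gamma>\<close> cuts the inside in two, and the closure of the piece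
  next to \<open>\<beta>\<close> reaches \<open>\<alpha>\<close> only at \<open>p\<close> and
  \<open>q\<close>. One limit point \<open>w\<close> elsewhere on \<open>\<alpha>\<close> thus tells
  in which piece \<open>C\<close> lies.\<close>

lemma subset_inside_piece:
  assumes \<gamma>: "path_image \<gamma> \<inter> inside (path_image \<alpha> \<union> path_image \<beta>) \<noteq> {}"
    and C: "connected C" "C \<subseteq> inside (path_image \<alpha> \<union> path_image \<beta>) - path_image \<gamma>"
    and w: "w \<in> closure C" "w \<in> path_image \<alpha>" "w \<noteq> p" "w \<noteq> q"
  shows "C \<subseteq> inside (path_image \<alpha> \<union> path_image \<gamma>)"
proof -
  interpret bc: theta \<beta> \<gamma> \<alpha> p q by (rule permute)
  interpret ca: theta \<gamma> \<alpha> \<beta> p q by (rule bc.permute)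
  let ?A = "inside (path_image \<alpha> \<union> path_image \<gamma>)" and ?B = "inside (path_image \<beta> \<union> path_image \<gamma>)"
  have sp: "simple_path \<alpha>" "simple_path \<beta>" "simple_path \<gamma>"
    using arcs by (auto simp: arc_imp_simple_path)
  have AB: "?A \<inter> ?B = {}"
    "?A \<union> ?B \<union> (path_image \<gamma> - {p, q}) = inside (path_image \<alpha> \<union> path_image \<beta>)"
    by (rule split_inside_simple_closed_curve[OF sp(1) starts(1) finishes(1) sp(2) starts(2) finishes(2)
        sp(3) starts(3) finishes(3) ends_distinct meets \<gamma>]; assumption)+
  have op: "open ?A" "open ?B"
    by (simp_all add: open_inside closed_Un closed_images)
  have sub: "C \<subseteq> ?A \<union> ?B"
    using C(2) AB(2) by blast
  have "C \<subseteq> ?A \<or> C \<subseteq> ?B"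
    by (rule connected_subset_open_cases[OF C(1) op sub AB(1)])
  moreover have False if "C \<subseteq> ?B"
  proof -
    have "w \<in> closure ?B"
      using w(1) that closure_mono by blast
    then have "w \<in> ?B \<union> path_image \<beta> \<union> path_image \<gamma>"
      by (simp add: closure_Un_frontier bc.jordan(3) Un_assoc)
    moreover have "w \<notin> inside (path_image \<alpha> \<union> path_image \<beta>)"
      using w(2) by (auto simp: inside_def)
    moreover have "w \<notin> path_image \<beta>" "w \<notin> path_image \<gamma>"
      using meets(1,2) w(2-4) by blast+
    ultimately show False
      using AB(2) by blast
  qed
  ultimately show ?thesis by blast
qed

end

section \<open>Grids of arcs in the plane\<close>

lemma real_closed_segment_iff:
  fixes a b c :: real
  shows "b \<in> closed_segment a c \<longleftrightarrow> (a \<le> b \<and> b \<le> c) \<or> (c \<le> b \<and> b \<le> a)"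
  by (auto simp: closed_segment_eq_real_ivl)

text \<open>The key \<open>kx\<close> orders the columns in the way in which they meet every row; column \<open>x\<close> meets row
  \<open>y\<close> at parameter \<open>pc x y\<close> of the column and parameter \<open>pr y x\<close> of the row.\<close>

locale grid =
  fixes X :: "'i set" and Y :: "'j set" and kx :: "'i \<Rightarrow> real" and ky :: "'j \<Rightarrow> real"
    and col :: "'i \<Rightarrow> real \<Rightarrow> complex" and row :: "'j \<Rightarrow> real \<Rightarrow> complex"
    and Dc :: "'i \<Rightarrow> real set" and Dr :: "'j \<Rightarrow> real set"
    and pc :: "'i \<Rightarrow> 'j \<Rightarrow> real" and pr :: "'j \<Rightarrow> 'i \<Rightarrow> real"
    and pt :: "'i \<Rightarrow> 'j \<Rightarrow> complex"
  assumes convex: "x \<in> X \<Longrightarrow> convex (Dc x)" "y \<in> Y \<Longrightarrow> convex (Dr y)"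
    and cont: "x \<in> X \<Longrightarrow> continuous_on (Dc x) (col x)" "y \<in> Y \<Longrightarrow> continuous_on (Dr y) (row y)"
    and inj: "x \<in> X \<Longrightarrow> inj_on (col x) (Dc x)" "y \<in> Y \<Longrightarrow> inj_on (row y) (Dr y)"
    and pos: "\<lbrakk>x \<in> X; y \<in> Y\<rbrakk> \<Longrightarrow> pc x y \<in> Dc x" "\<lbrakk>x \<in> X; y \<in> Y\<rbrakk> \<Longrightarrow> pr y x \<in> Dr y"
    and pt: "\<lbrakk>x \<in> X; y \<in> Y\<rbrakk> \<Longrightarrow> col x (pc x y) = pt x y" "\<lbrakk>x \<in> X; y \<in> Y\<rbrakk> \<Longrightarrow> row y (pr y x) = pt x y"
    and order: "\<lbrakk>x \<in> X; y \<in> Y; y' \<in> Y\<rbrakk> \<Longrightarrow> pc x y < pc x y' \<longleftrightarrow> ky y < ky y'"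
      "\<lbrakk>y \<in> Y; x \<in> X; x' \<in> X\<rbrakk> \<Longrightarrow> pr y x < pr y x' \<longleftrightarrow> kx x < kx x'"
    and cross: "\<lbrakk>x \<in> X; y \<in> Y\<rbrakk> \<Longrightarrow> col x ` Dc x \<inter> row y ` Dr y = {pt x y}"
    and disj: "\<lbrakk>x \<in> X; x' \<in> X; x \<noteq> x'\<rbrakk> \<Longrightarrow> col x ` Dc x \<inter> col x' ` Dc x' = {}"
      "\<lbrakk>y \<in> Y; y' \<in> Y; y \<noteq> y'\<rbrakk> \<Longrightarrow> row y ` Dr y \<inter> row y' ` Dr y' = {}"
begin

lemma transpose: "grid Y X ky kx row col Dr Dc pr pc (\<lambda>y x. pt x y)"
  by unfold_locales (use convex cont inj pos pt order cross disj in \<open>simp_all add: Int_commute\<close>)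

end

text \<open>Transposing twice gives the grid back, so rows and columns are interchangeable:
  \<open>T.\<close> turns each fact on columns into one on rows.\<close>

sublocale grid \<subseteq> T: grid Y X ky kx row col Dr Dc pr pc "\<lambda>y x. pt x y"
  by (rule transpose)

context grid
begin

text \<open>A directed piece of column: it runs from row \<open>y\<close> to row \<open>y'\<close>
  even against the order of the keys. \<open>T.vp\<close> is the same along a row.\<close>

definition vp :: "'i \<Rightarrow> 'j \<Rightarrow> 'j \<Rightarrow> real \<Rightarrow> complex" where
  "vp x y y' = col x \<circ> linepath (pc x y) (pc x y')"

abbreviation vs :: "'i \<Rightarrow> 'j \<Rightarrow> 'j \<Rightarrow> complex set" where
  "vs x y y' \<equiv> path_image (vp x y y')"

lemma vs_eq: "vs x y y' = col x ` closed_segment (pc x y) (pc x y')"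
  by (simp add: vp_def path_image_compose)

lemma segment_subset:
  assumes "x \<in> X" "y \<in> Y" "y' \<in> Y" shows "closed_segment (pc x y) (pc x y') \<subseteq> Dc x"
  using assms by (simp add: closed_segment_subset convex(1) pos(1))

lemma vp_ends [simp]:
  assumes "x \<in> X" "y \<in> Y" "y' \<in> Y"
  shows "pathstart (vp x y y') = pt x y" "pathfinish (vp x y y') = pt x y'"
  using assms by (simp_all add: vp_def pathstart_compose pathfinish_compose pt(1))

lemma pc_eq_iff:
  assumes "x \<in> X" "y \<in> Y" "y' \<in> Y" shows "pc x y = pc x y' \<longleftrightarrow> ky y = ky y'"
  using order(1)[of x y y'] order(1)[of x y' y] assms by linarith

lemma pc_segment_iff:
  assumes "x \<in> X" "y \<in> Y" "y1 \<in> Y" "y2 \<in> Y"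
  shows "pc x y \<in> closed_segment (pc x y1) (pc x y2) \<longleftrightarrow> ky y \<in> closed_segment (ky y1) (ky y2)"
  using order(1)[OF assms(1,2,3)] order(1)[OF assms(1,3,2)] order(1)[OF assms(1,2,4)] order(1)[OF assms(1,4,2)]
  by (auto simp: real_closed_segment_iff not_less[symmetric])

lemma pc_open_segment_iff:
  assumes "x \<in> X" "y \<in> Y" "y1 \<in> Y" "y2 \<in> Y"
  shows "pc x y \<in> open_segment (pc x y1) (pc x y2) \<longleftrightarrow> ky y \<in> open_segment (ky y1) (ky y2)"
  using pc_segment_iff[OF assms] pc_eq_iff[OF assms(1,2,3)] pc_eq_iff[OF assms(1,2,4)]
  by (simp add: open_segment_def)

lemma path_vp:
  assumes "x \<in> X" "y \<in> Y" "y' \<in> Y" shows "path (vp x y y')"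
  unfolding vp_def using assms
  by (intro path_continuous_image continuous_on_subset[OF cont(1)] path_linepath)
    (auto simp: segment_subset)

lemma arc_vp:
  assumes "x \<in> X" "y \<in> Y" "y' \<in> Y" "ky y \<noteq> ky y'" shows "arc (vp x y y')"
proof -
  have "inj_on (vp x y y') {0..1}"
    unfolding vp_def
  proof (rule comp_inj_on)
    show "inj_on (linepath (pc x y) (pc x y')) {0..1}"
      using arc_linepath[of "pc x y" "pc x y'"] pc_eq_iff assms by (simp add: arc_def)
    show "inj_on (col x) (linepath (pc x y) (pc x y') ` {0..1})"
      using inj(1)[of x] segment_subset[of x y y'] assms
      by (metis path_image_def path_image_linepath inj_on_subset)
  qed
  then show ?thesis
    using assms path_vp by (simp add: arc_def)
qed

lemma pt_inj:
  assumes "x \<in> X" "x' \<in> X" "y \<in> Y" "y' \<in> Y" "pt x y = pt x' y'"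
  shows "x = x' \<and> y = y'"
proof -
  have "pt x y \<in> col x ` Dc x \<inter> row y ` Dr y" "pt x' y' \<in> col x' ` Dc x' \<inter> row y' ` Dr y'"
    using cross assms by blast+
  then show ?thesis
    using disj(1)[of x x'] disj(2)[of y y'] assms by auto
qed

end

context grid
begin

lemma vs_cross:
  assumes "x \<in> X" "x' \<in> X" "x'' \<in> X" "y \<in> Y" "y' \<in> Y" "y'' \<in> Y"
  shows "vs x y y' \<inter> T.vs y'' x' x'' \<subseteq> {pt x y''}"
proof -
  have "vs x y y' \<subseteq> col x ` Dc x"
    unfolding vs_eq by (intro image_mono segment_subset assms)
  moreover have "T.vs y'' x' x'' \<subseteq> row y'' ` Dr y''"
    unfolding T.vs_eq by (intro image_mono T.segment_subset assms)
  ultimately show ?thesis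
    using cross[of x y''] assms by (metis Int_mono)
qed

lemma vs_disjoint:
  assumes "x \<in> X" "x' \<in> X" "x \<noteq> x'" "y \<in> Y" "y' \<in> Y" "y1 \<in> Y" "y1' \<in> Y"
  shows "vs x y y' \<inter> vs x' y1 y1' = {}"
  using disj(1)[OF assms(1-3)] image_mono[OF segment_subset[OF assms(1,4,5)], of "col x"]
    image_mono[OF segment_subset[OF assms(2,6,7)], of "col x'"]
  unfolding vs_eq by (meson disjoint_iff subsetD)

lemma pt_in_vs_iff:
  assumes "x \<in> X" "x' \<in> X" "y \<in> Y" "y1 \<in> Y" "y2 \<in> Y"
  shows "pt x' y \<in> vs x y1 y2 \<longleftrightarrow> x' = x \<and> ky y \<in> closed_segment (ky y1) (ky y2)"
proof -
  have "pt x y \<in> vs x y1 y2 \<longleftrightarrow> pc x y \<in> closed_segment (pc x y1) (pc x y2)"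
    unfolding vs_eq pt(1)[OF assms(1,3), symmetric]
    by (rule inj_on_image_mem_iff[OF inj(1)[OF assms(1)] pos(1)[OF assms(1,3)]
        segment_subset[OF assms(1,4,5)]])
  also have "\<dots> \<longleftrightarrow> ky y \<in> closed_segment (ky y1) (ky y2)"
    using pc_segment_iff assms by simp
  finally have *: "pt x y \<in> vs x y1 y2 \<longleftrightarrow> ky y \<in> closed_segment (ky y1) (ky y2)" .
  show ?thesis
  proof (cases "x' = x")
    case False
    have "pt x' y \<in> vs x' y y" using assms by (metis pathstart_in_path_image vp_ends(1))
    then show ?thesis
      using vs_disjoint[of x' x y y y1 y2] assms False by (metis IntI empty_iff)
  qed (use * in simp)
qed

lemma vs_sym: "x \<in> X \<Longrightarrow> vs x y y' = vs x y' y"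
  by (simp add: vs_eq closed_segment_commute)

lemma vs_subset:
  assumes "x \<in> X" "y \<in> Y" "y' \<in> Y" "y1 \<in> Y" "y2 \<in> Y"
    "ky y \<in> closed_segment (ky y1) (ky y2)" "ky y' \<in> closed_segment (ky y1) (ky y2)"
  shows "vs x y y' \<subseteq> vs x y1 y2"
proof -
  have "pc x y \<in> closed_segment (pc x y1) (pc x y2)" "pc x y' \<in> closed_segment (pc x y1) (pc x y2)"
    using pc_segment_iff assms by simp_all
  then show ?thesis
    unfolding vs_eq by (intro image_mono closed_segment_subset) auto
qed

lemma vs_split:
  assumes "x \<in> X" "y \<in> Y" "y1 \<in> Y" "y2 \<in> Y" "ky y \<in> closed_segment (ky y1) (ky y2)"
  shows "vs x y1 y2 = vs x y1 y \<union> vs x y y2"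
proof -
  have "pc x y \<in> closed_segment (pc x y1) (pc x y2)"
    using pc_segment_iff assms by simp
  then show ?thesis
    unfolding vs_eq by (metis Un_closed_segment image_Un)
qed

definition vo :: "'i \<Rightarrow> 'j \<Rightarrow> 'j \<Rightarrow> complex set" where
  "vo x y y' = col x ` open_segment (pc x y) (pc x y')"

lemma vo_eq:
  assumes "x \<in> X" "y \<in> Y" "y' \<in> Y"
  shows "vo x y y' = vs x y y' - {pt x y, pt x y'}"
proof -
  have "vo x y y' = col x ` closed_segment (pc x y) (pc x y') - col x ` {pc x y, pc x y'}"
    unfolding vo_def open_segment_def
    by (rule inj_on_image_set_diff[OF inj(1)[OF assms(1)]]) (use segment_subset pos assms in auto)
  then show ?thesis
    using assms by (simp add: vs_eq pt(1))
qed

lemma vo_subset: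
  assumes "x \<in> X" "y \<in> Y" "y1 \<in> Y" "y2 \<in> Y" "ky y \<in> open_segment (ky y1) (ky y2)"
  shows "vo x y1 y \<subseteq> vo x y1 y2"
proof -
  have "pc x y \<in> open_segment (pc x y1) (pc x y2)"
    using pc_open_segment_iff assms by simp
  then show ?thesis
    unfolding vo_def by (intro image_mono) (auto simp: open_segment_eq_real_ivl split: if_splits)
qed

lemma connected_vo:
  assumes "x \<in> X" "y \<in> Y" "y' \<in> Y"
  shows "connected (vo x y y')"
proof -
  have "open_segment (pc x y) (pc x y') \<subseteq> Dc x"
    using segment_subset[of x y y'] assms segment_open_subset_closed by blast
  then show ?thesis
    unfolding vo_def
    by (intro connected_continuous_image continuous_on_subset[OF cont(1)[OF assms(1)]])
      (auto intro: convex_connected)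
qed

lemma pt_in_vo_iff:
  assumes "x \<in> X" "y \<in> Y" "y1 \<in> Y" "y2 \<in> Y"
  shows "pt x y \<in> vo x y1 y2 \<longleftrightarrow> ky y \<in> open_segment (ky y1) (ky y2)"
proof -
  have "pt x y = pt x y' \<longleftrightarrow> ky y = ky y'" if "y' \<in> Y" for y'
    using pc_eq_iff[of x y y'] inj(1)[of x] pt(1)[of x y] pt(1)[of x y'] pos(1)[of x y] pos(1)[of x y']
      that assms by (metis inj_onD)
  then show ?thesis
    using assms by (simp add: vo_eq pt_in_vs_iff open_segment_def)
qed

lemma closure_vo:
  assumes "x \<in> X" "y \<in> Y" "y' \<in> Y" "ky y \<noteq> ky y'"
  shows "vs x y y' \<subseteq> closure (vo x y y')"
proof -
  have ne: "pc x y \<noteq> pc x y'"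
    using pc_eq_iff assms by simp
  have "col x ` closure (open_segment (pc x y) (pc x y')) \<subseteq> closure (col x ` open_segment (pc x y) (pc x y'))"
    by (rule image_closure_subset[OF continuous_on_subset[OF cont(1)[OF assms(1)]]])
      (use segment_subset[of x y y'] assms ne closure_subset[of "col x ` open_segment (pc x y) (pc x y')"]
        in \<open>auto simp: closure_open_segment\<close>)
  then show ?thesis
    using ne by (simp add: vs_eq vo_def closure_open_segment)
qed

lemma vs_Int:
  assumes "x \<in> X" "y \<in> Y" "y1 \<in> Y" "y2 \<in> Y" "ky y \<in> closed_segment (ky y1) (ky y2)"
  shows "vs x y1 y \<inter> vs x y y2 = {pt x y}"
proof -
  have "pc x y \<in> closed_segment (pc x y1) (pc x y2)"
    using pc_segment_iff assms by simp
  then have "closed_segment (pc x y1) (pc x y) \<inter> closed_segment (pc x y) (pc x y2) = {pc x y}"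
    by (intro Int_closed_segment disjI1)
  then have "col x ` closed_segment (pc x y1) (pc x y) \<inter> col x ` closed_segment (pc x y) (pc x y2) = col x ` {pc x y}"
    using inj_on_image_Int[OF inj(1)[OF assms(1)] segment_subset[OF assms(1,3,2)] segment_subset[OF assms(1,2,4)]]
    by simp
  then show ?thesis
    using assms by (simp add: vs_eq pt(1))
qed

end

section \<open>Frames as Jordan curves, and their division by a column\<close>

context grid
begin

definition frame :: "'i \<Rightarrow> 'i \<Rightarrow> 'j \<Rightarrow> 'j \<Rightarrow> complex set" where
  "frame i j k l = vs i k l \<union> vs j k l \<union> T.vs k i j \<union> T.vs l i j"

end

context grid
begin

lemma frame_transpose: "T.frame k l i j = frame i j k l"
  unfolding frame_def T.frame_def by blast

lemma frame_commute: "i \<in> X \<Longrightarrow> j \<in> X \<Longrightarrow> k \<in> Y \<Longrightarrow> l \<in> Y \<Longrightarrow> frame i j k l = frame j i k l"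
  unfolding frame_def using T.vs_sym[of k i j] T.vs_sym[of l i j] by blast

end

context grid
begin

text \<open>The frame without its sides on column \<open>c\<close>, run through as one arc from row
  \<open>k\<close> around column \<open>i\<close> to row \<open>l\<close>. For two columns on either
  side of \<open>c\<close> these are the outer arcs of a theta curve.\<close>

definition side :: "'i \<Rightarrow> 'i \<Rightarrow> 'j \<Rightarrow> 'j \<Rightarrow> real \<Rightarrow> complex" where
  "side c i k l = T.vp k c i +++ (vp i k l +++ T.vp l i c)"

context
  fixes c i k l
  assumes mem: "c \<in> X" "i \<in> X" "k \<in> Y" "l \<in> Y" and ne: "kx c \<noteq> kx i" "ky k \<noteq> ky l"
begin

lemma mem_ne: "c \<noteq> i" "k \<noteq> l"
  using ne by auto

lemma side_ends: "pathstart (side c i k l) = pt c k" "pathfinish (side c i k l) = pt c l"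
  using mem by (simp_all add: side_def)

lemma path_image_side: "path_image (side c i k l) = T.vs k c i \<union> vs i k l \<union> T.vs l i c"
  using mem by (simp add: side_def path_image_join Un_assoc)

lemma arc_side: "arc (side c i k l)"
proof -
  have a: "arc (T.vp k c i)" "arc (vp i k l)" "arc (T.vp l i c)"
    using mem ne by (auto intro!: arc_vp T.arc_vp)
  have h1: "vs i k l \<inter> T.vs l i c \<subseteq> {pt i l}" "vs i k l \<inter> T.vs k c i \<subseteq> {pt i k}"
    using mem by (simp_all add: vs_cross)
  have h2: "T.vs k c i \<inter> T.vs l i c = {}"
    using mem mem_ne by (intro T.vs_disjoint) auto
  have "arc (vp i k l +++ T.vp l i c)"
    using a h1 mem by (intro arc_join) auto
  moreover have "T.vs k c i \<inter> path_image (vp i k l +++ T.vp l i c) \<subseteq> {pt i k}"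
    using h1 h2 mem by (auto simp: path_image_join)
  ultimately show ?thesis
    unfolding side_def using a mem by (subst arc_join_eq) auto
qed

lemma side_Int_vs: "path_image (side c i k l) \<inter> vs c k l = {pt c k, pt c l}"
proof -
  have "vs i k l \<inter> vs c k l = {}"
    using mem mem_ne by (intro vs_disjoint) auto
  moreover have "vs c k l \<inter> T.vs k c i \<subseteq> {pt c k}" "vs c k l \<inter> T.vs l i c \<subseteq> {pt c l}"
    using mem by (simp_all add: vs_cross)
  moreover have "pt c k \<in> vs c k l" "pt c l \<in> vs c k l" "pt c k \<in> T.vs k c i" "pt c l \<in> T.vs l i c"
    using mem by (auto simp: pt_in_vs_iff T.pt_in_vs_iff)
  ultimately show ?thesis
    unfolding path_image_side by blast
qed

lemma frame_eq_side: "frame i c k l = path_image (side c i k l) \<union> vs c k l"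
  unfolding frame_def path_image_side using T.vs_sym[of k c i] mem by blast

lemma closed_frame: "closed (frame i c k l)"
  unfolding frame_def using mem by (intro closed_Un closed_path_image path_vp T.path_vp)

lemma jordan_frame:
  "frontier (outside (frame i c k l)) = frame i c k l" "connected (outside (frame i c k l))"
  "inside (frame i c k l) \<noteq> {}" "connected (inside (frame i c k l))"
  "frontier (inside (frame i c k l)) = frame i c k l" "bounded (inside (frame i c k l))"
proof -
  let ?p = "side c i k l +++ reversepath (vp c k l)"
  have "simple_path ?p"
    using arc_side arc_vp[of c k l] side_ends side_Int_vs mem ne
    by (intro simple_path_join_loop) (auto simp: arc_reversepath)
  moreover have "pathfinish ?p = pathstart ?p"
    using mem side_ends by simp
  moreover have "path_image ?p = frame i c k l"
    using mem side_ends by (simp add: path_image_join frame_eq_side)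
  ultimately show "frontier (outside (frame i c k l)) = frame i c k l" "connected (outside (frame i c k l))"
    "inside (frame i c k l) \<noteq> {}" "connected (inside (frame i c k l))"
    "frontier (inside (frame i c k l)) = frame i c k l" "bounded (inside (frame i c k l))"
    using Jordan_inside_outside[of ?p] by simp_all
qed

end

end

context grid
begin

text \<open>Since \<open>c\<close> lies between \<open>i\<close> and \<open>j\<close>, the pieces of
  row \<open>k\<close> that leave \<open>c\<close> in the two directions share only the crossing
  with \<open>c\<close>, and likewise on row \<open>l\<close>; so the outer arcs meet only
  there.\<close>

lemma theta_sides:
  assumes "i \<in> X" "j \<in> X" "c \<in> X" "k \<in> Y" "l \<in> Y"
    and c: "kx c \<in> open_segment (kx i) (kx j)" and kl: "ky k \<noteq> ky l"
  shows "theta (side c i k l) (side c j k l) (vp c k l) (pt c k) (pt c l)"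
    and "frame i j k l = path_image (side c i k l) \<union> path_image (side c j k l)"
proof -
  have ne: "kx c \<noteq> kx i" "kx c \<noteq> kx j" "kx i \<noteq> kx j" "i \<noteq> j" "k \<noteq> l" and c': "kx c \<in> closed_segment (kx i) (kx j)"
    using c kl by (auto simp: open_segment_def)
  have kk: "T.vs k c i \<inter> T.vs k c j = {pt c k}" "T.vs l i c \<inter> T.vs l j c = {pt c l}"
    using T.vs_Int[of k c i j] T.vs_Int[of l c i j] T.vs_sym assms c' by auto
  have 1: "vs i k l \<inter> vs j k l = {}" "vs j k l \<inter> vs i k l = {}"
    using assms ne by (simp_all add: vs_disjoint)
  have 2: "T.vs k c i \<inter> T.vs l j c = {}" "T.vs l i c \<inter> T.vs k c j = {}"
    using assms ne by (simp_all add: T.vs_disjoint)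
  have "vs j k l \<inter> T.vs k c i \<subseteq> {pt j k}" "vs j k l \<inter> T.vs l i c \<subseteq> {pt j l}"
    "vs i k l \<inter> T.vs k c j \<subseteq> {pt i k}" "vs i k l \<inter> T.vs l j c \<subseteq> {pt i l}"
    using assms by (simp_all add: vs_cross)
  moreover have "pt j k \<notin> T.vs k c i" "pt j l \<notin> T.vs l i c" "pt i k \<notin> T.vs k c j" "pt i l \<notin> T.vs l j c"
    using assms ne c' by (auto simp: T.pt_in_vs_iff real_closed_segment_iff)
  ultimately have 3: "vs j k l \<inter> T.vs k c i = {}" "vs j k l \<inter> T.vs l i c = {}"
    "vs i k l \<inter> T.vs k c j = {}" "vs i k l \<inter> T.vs l j c = {}"
    by auto
  have "path_image (side c i k l) \<inter> path_image (side c j k l) = {pt c k, pt c l}"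
    unfolding path_image_side[OF assms(3,1,4,5) ne(1) kl] path_image_side[OF assms(3,2,4,5) ne(2) kl]
      Int_Un_distrib Int_Un_distrib2 kk 1 2 3 Int_commute[of _ "vs j k l"]
    by blast
  then show "theta (side c i k l) (side c j k l) (vp c k l) (pt c k) (pt c l)"
    using assms ne side_ends arc_side side_Int_vs arc_vp by unfold_locales simp_all
  have "T.vs k i j = T.vs k c i \<union> T.vs k c j" "T.vs l i j = T.vs l i c \<union> T.vs l j c"
    using T.vs_split[of k c i j] T.vs_split[of l c i j] T.vs_sym assms c' by auto
  then show "frame i j k l = path_image (side c i k l) \<union> path_image (side c j k l)"
    unfolding frame_def path_image_side[OF assms(3,1,4,5) ne(1) kl] path_image_side[OF assms(3,2,4,5) ne(2) kl]
    by blast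
qed

lemma frame_eqs:
  assumes "i \<in> X" "j \<in> X" "k \<in> Y" "l \<in> Y" "kx i \<noteq> kx j" "ky k \<noteq> ky l"
  shows "closed (frame i j k l)" "connected (outside (frame i j k l))"
    "frontier (outside (frame i j k l)) = frame i j k l"
    "frontier (inside (frame i j k l)) = frame i j k l"
  using closed_frame[of j i k l] jordan_frame[of j i k l] assms by simp_all

lemma vo_frame_disjoint:
  assumes "a \<in> X" "i \<in> X" "j \<in> X" "k \<in> Y" "l \<in> Y" "a \<noteq> i" "a \<noteq> j"
  shows "vo a k l \<inter> frame i j k l = {}"
proof -
  have "vs a k l \<inter> vs i k l = {}" "vs a k l \<inter> vs j k l = {}"
    "vs a k l \<inter> T.vs k i j \<subseteq> {pt a k}" "vs a k l \<inter> T.vs l i j \<subseteq> {pt a l}"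
    using assms by (simp_all add: vs_disjoint vs_cross)
  then show ?thesis
    using assms by (auto simp: vo_eq frame_def)
qed

text \<open>The open column piece is connected and misses the frame, so one of its points decides
  for all.\<close>

lemma vo_inside:
  assumes "a \<in> X" "i \<in> X" "j \<in> X" "k \<in> Y" "l \<in> Y" "r \<in> Y" "kx i \<noteq> kx j" "ky k \<noteq> ky l" "a \<noteq> i" "a \<noteq> j"
    and r: "ky r \<in> open_segment (ky k) (ky l)" and "pt a r \<in> inside (frame i j k l)"
  shows "vo a k l \<subseteq> inside (frame i j k l)"
proof -
  have "pt a r \<in> vo a k l"
    using assms by (simp add: pt_in_vo_iff)
  moreover have "vo a k l \<subseteq> inside (frame i j k l) \<or> vo a k l \<subseteq> outside (frame i j k l)"
    using assms by (intro connected_subset_inside_or_outside frame_eqs connected_vo vo_frame_disjoint)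
  ultimately show ?thesis
    using assms(12) inside_Int_outside[of "frame i j k l"] by blast
qed

text \<open>Not automatic: in the plane the frame may have its interior on the wrong side, with all the
  crossing points between its columns and rows outside.\<close>

definition good :: "'i \<Rightarrow> 'i \<Rightarrow> 'j \<Rightarrow> 'j \<Rightarrow> bool" where
  "good i j k l \<longleftrightarrow> (\<forall>a\<in>X. \<forall>r\<in>Y. kx a \<in> open_segment (kx i) (kx j) \<longrightarrow>
     ky r \<in> open_segment (ky k) (ky l) \<longrightarrow> pt a r \<in> inside (frame i j k l))"

end

section \<open>Frames with their crossing points on the bounded side\<close>

context grid
begin

lemma good_transpose: "T.good k l i j \<longleftrightarrow> good i j k l"
  unfolding good_def T.good_def frame_transpose by blast

text \<open>The one point spreads along its column to all rows in between, and then along each such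
  row to all columns in between. So either all crossing points are inside the frame or none
  is.\<close>

lemma good_of_point:
  assumes mem: "a \<in> X" "i \<in> X" "j \<in> X" "k \<in> Y" "l \<in> Y" "r \<in> Y"
    and a: "kx a \<in> open_segment (kx i) (kx j)" and r: "ky r \<in> open_segment (ky k) (ky l)"
    and in_ar: "pt a r \<in> inside (frame i j k l)"
  shows "good i j k l"
  unfolding good_def
proof (intro ballI impI)
  fix a' r' assume a': "a' \<in> X" "kx a' \<in> open_segment (kx i) (kx j)"
    and r': "r' \<in> Y" "ky r' \<in> open_segment (ky k) (ky l)"
  have ne: "kx i \<noteq> kx j" "ky k \<noteq> ky l" "a \<noteq> i" "a \<noteq> j" "r' \<noteq> k" "r' \<noteq> l"
    using a r r' by (auto simp: open_segment_def)
  have "vo a k l \<subseteq> inside (frame i j k l)"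
    by (rule vo_inside[of a i j k l r]) (use mem ne r in_ar in auto)
  moreover have "pt a r' \<in> vo a k l"
    using mem r' by (simp add: pt_in_vo_iff)
  ultimately have "pt a r' \<in> inside (T.frame k l i j)"
    unfolding frame_transpose by blast
  then have "T.vo r' i j \<subseteq> inside (T.frame k l i j)"
    by (intro T.vo_inside[of r' k l i j a]) (use mem ne r' a in auto)
  moreover have "pt a' r' \<in> T.vo r' i j"
    using mem a' r' by (simp add: T.pt_in_vo_iff)
  ultimately show "pt a' r' \<in> inside (frame i j k l)"
    unfolding frame_transpose by blast
qed

text \<open>Between columns \<open>i\<close> and \<open>c\<close> a row stays inside the large frame
  and off column \<open>c\<close>, and it touches column \<open>i\<close>; hence it lies in the half
  that borders on the side around \<open>i\<close>.\<close>

lemma good_split: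
  assumes mem: "i \<in> X" "j \<in> X" "c \<in> X" "k \<in> Y" "l \<in> Y"
    and c: "kx c \<in> open_segment (kx i) (kx j)" and g: "good i j k l"
  shows "good i c k l"
  unfolding good_def
proof (intro ballI impI)
  fix a r assume a: "a \<in> X" "kx a \<in> open_segment (kx i) (kx c)"
    and r: "r \<in> Y" "ky r \<in> open_segment (ky k) (ky l)"
  have ne: "kx i \<noteq> kx j" "ky k \<noteq> ky l" "kx c \<noteq> kx i" "c \<noteq> i" "c \<noteq> j" "r \<noteq> k" "r \<noteq> l"
    using c r by (auto simp: open_segment_def)
  interpret th: theta "side c i k l" "side c j k l" "vp c k l" "pt c k" "pt c l"
    by (rule theta_sides(1)[OF mem(1-5) c ne(2)])
  have fr: "frame i j k l = path_image (side c i k l) \<union> path_image (side c j k l)"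
    by (rule theta_sides(2)[OF mem(1-5) c ne(2)])
  have cr: "pt c r \<in> inside (frame i j k l)"
    using g c r mem unfolding good_def by blast
  have "T.vo r i j \<subseteq> inside (T.frame k l i j)"
    by (rule T.vo_inside[of r k l i j c]) (use mem ne r c cr frame_transpose in auto)
  moreover have "T.vo r i c \<subseteq> T.vo r i j"
    using mem r c by (intro T.vo_subset)
  moreover have "T.vo r i c \<inter> vs c k l = {}"
    using vs_cross[of c i c k l r] mem r by (auto simp: T.vo_eq)
  ultimately have sub: "T.vo r i c \<subseteq> inside (path_image (side c i k l) \<union> path_image (side c j k l)) - vs c k l"
    unfolding frame_transpose fr by blast
  have cr': "pt c r \<in> vs c k l"
    using mem r by (simp add: pt_in_vs_iff open_segment_def)
  have ir: "pt i r \<in> vs i k l"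
    using mem r by (simp add: pt_in_vs_iff open_segment_def)
  have "pt i r \<in> T.vs r i c"
    using mem r by (simp add: T.pt_in_vs_iff)
  then have "pt i r \<in> closure (T.vo r i c)"
    using T.closure_vo[of r i c] mem r ne by auto
  moreover have "pt i r \<in> path_image (side c i k l)"
    using ir path_image_side[of c i k l] mem ne by simp
  moreover have "pt i r \<noteq> pt c k" "pt i r \<noteq> pt c l"
    using pt_inj mem r ne by blast+
  ultimately have "T.vo r i c \<subseteq> inside (path_image (side c i k l) \<union> vs c k l)"
    using cr cr' sub mem r
    by (intro th.subset_inside_piece[of _ "pt i r"] T.connected_vo) (auto simp: fr)
  moreover have "pt a r \<in> T.vo r i c"
    using mem a r by (simp add: T.pt_in_vo_iff)
  ultimately show "pt a r \<in> inside (frame i c k l)"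
    using frame_eq_side[of c i k l] mem ne by auto
qed

text \<open>Here the frame of \<open>c\<close> and \<open>j\<close> surrounds the side around
  \<open>i\<close>. A row runs from that side to column \<open>c\<close> in the region between them,
  and this region is the inside of the frame of \<open>i\<close> and \<open>c\<close>.\<close>

lemma good_of_inside:
  assumes mem: "i \<in> X" "j \<in> X" "c \<in> X" "k \<in> Y" "l \<in> Y" "a \<in> X" "r \<in> Y"
    and c: "kx c \<in> open_segment (kx i) (kx j)" and a: "kx a \<in> open_segment (kx i) (kx c)"
    and r: "ky r \<in> open_segment (ky k) (ky l)"
    and meet: "path_image (side c i k l) \<inter> inside (vs c k l \<union> path_image (side c j k l)) \<noteq> {}"
  shows "good i c k l"
proof -
  have ne: "kx i \<noteq> kx j" "ky k \<noteq> ky l" "kx c \<noteq> kx i" "kx c \<noteq> kx j" "c \<noteq> i" "c \<noteq> j" "r \<noteq> k" "r \<noteq> l" "i \<noteq> j"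
    using c r by (auto simp: open_segment_def)
  interpret th: theta "side c i k l" "side c j k l" "vp c k l" "pt c k" "pt c l"
    by (rule theta_sides(1)[OF mem(1-5) c ne(2)])
  interpret th1: theta "side c j k l" "vp c k l" "side c i k l" "pt c k" "pt c l"
    by (rule th.permute)
  interpret th2: theta "vp c k l" "side c j k l" "side c i k l" "pt c k" "pt c l"
    by (rule th1.permute)
  let ?A = "path_image (side c i k l)" and ?K = "vs c k l \<union> path_image (side c j k l)"
  have K: "?K = frame j c k l"
    using frame_eq_side[of c j k l] mem ne by auto
  have clK: "closed ?K"
    unfolding K using mem ne by (intro closed_frame) auto
  have ir: "pt i r \<in> ?A" "pt i r \<noteq> pt c k" "pt i r \<noteq> pt c l"
    using path_image_side[of c i k l] mem ne r pt_inj by (auto simp: pt_in_vs_iff open_segment_def)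
  have "?A - {pt c k, pt c l} \<subseteq> inside ?K \<or> ?A - {pt c k, pt c l} \<subseteq> outside ?K"
  proof (rule connected_subset_inside_or_outside[OF clK])
    show "connected (?A - {pt c k, pt c l})"
      using connected_simple_path_endless[of "side c i k l"] th.arcs(1) th.starts(1) th.finishes(1)
      by (simp add: arc_imp_simple_path)
    show "(?A - {pt c k, pt c l}) \<inter> ?K = {}"
      using th.meets(1,2) by blast
  qed
  moreover have "\<not> ?A - {pt c k, pt c l} \<subseteq> outside ?K"
  proof -
    obtain z where z: "z \<in> ?A" "z \<in> inside ?K" using meet by blast
    then have "z \<notin> ?K" "z \<notin> outside ?K" by (auto simp: inside_def outside_def)
    moreover have "pt c k \<in> ?K" "pt c l \<in> ?K" using th.meets(2) by blast+
    ultimately show ?thesis using z by blast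
  qed
  ultimately have ir_in: "pt i r \<in> inside ?K"
    using ir by blast
  \<comment> \<open>The piece keeps its end on column \<open>i\<close>, which is known to be inside
    \<open>?K\<close>, and drops its end on column \<open>c\<close>, which lies on
    \<open>?K\<close>.\<close>
  let ?H = "T.vs r i c - {pt c r}"
  have io: "T.vo r i c \<subseteq> ?H" "?H \<subseteq> closure (T.vo r i c)" "pt i r \<in> ?H"
    using T.closure_vo[of r i c] mem ne pt_inj by (auto simp: T.vo_eq T.pt_in_vs_iff)
  have "?H \<subseteq> inside ?K \<or> ?H \<subseteq> outside ?K"
  proof (rule connected_subset_inside_or_outside[OF clK])
    show "connected ?H"
      using connected_intermediate_closure T.connected_vo mem io by blast
    have "vs c k l \<inter> T.vs r i c \<subseteq> {pt c r}" "vs j k l \<inter> T.vs r i c \<subseteq> {pt j r}"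
      using mem by (simp_all add: vs_cross)
    moreover have "pt j r \<notin> T.vs r i c"
      using mem c ne by (auto simp: T.pt_in_vs_iff real_closed_segment_iff open_segment_eq_real_ivl split: if_splits)
    moreover have "T.vs r i c \<inter> T.vs k j c = {}" "T.vs r i c \<inter> T.vs l j c = {}"
      using mem ne by (simp_all add: T.vs_disjoint)
    ultimately show "?H \<inter> ?K = {}"
      unfolding K frame_def by blast
  qed
  moreover have "\<not> ?H \<subseteq> outside ?K"
    using ir_in io(3) by (auto simp: inside_def outside_def)
  ultimately have "T.vo r i c \<subseteq> inside ?K"
    using io by blast
  moreover have "T.vo r i c \<inter> ?A = {}"
  proof -
    have "T.vo r i c \<inter> T.frame k l i c = {}"
      using mem ne by (intro T.vo_frame_disjoint)
    then show ?thesis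
      using frame_eq_side[of c i k l] mem ne unfolding frame_transpose by auto
  qed
  moreover have "pt c r \<in> vs c k l" "pt c r \<noteq> pt c k" "pt c r \<noteq> pt c l"
    using mem r ne pt_inj by (auto simp: pt_in_vs_iff open_segment_def)
  moreover have "pt c r \<in> closure (T.vo r i c)"
    using T.closure_vo[of r i c] mem ne by (auto simp: T.pt_in_vs_iff)
  moreover have "connected (T.vo r i c)"
    using mem by (simp add: T.connected_vo)
  \<comment> \<open>In the permuted theta curve the side around \<open>i\<close> is the cutting arc,
    and the limit point on column \<open>c\<close> selects the piece next to that column.\<close>
  ultimately have "T.vo r i c \<subseteq> inside (vs c k l \<union> ?A)"
    by (intro th2.subset_inside_piece[OF meet, of _ "pt c r"]) auto
  moreover have "pt a r \<in> T.vo r i c"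
    using mem a r by (simp add: T.pt_in_vo_iff)
  moreover have "vs c k l \<union> ?A = frame i c k l"
    using frame_eq_side[of c i k l] mem ne by auto
  ultimately have "pt a r \<in> inside (frame i c k l)"
    by auto
  then show ?thesis
    by (intro good_of_point[of a i c k l r]) (use mem a r in auto)
qed

text \<open>Seen on the sphere, the point at infinity lies outside at least one of two adjacent rectangles.\<close>

lemma good_half:
  assumes mem: "i \<in> X" "j \<in> X" "c \<in> X" "k \<in> Y" "l \<in> Y" "a \<in> X" "b \<in> X" "r \<in> Y"
    and c: "kx c \<in> open_segment (kx i) (kx j)" and a: "kx a \<in> open_segment (kx i) (kx c)"
    and b: "kx b \<in> open_segment (kx j) (kx c)"
    and r: "ky r \<in> open_segment (ky k) (ky l)"
  shows "good i c k l \<or> good j c k l"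
proof -
  have ne: "ky k \<noteq> ky l"
    using r by (auto simp: open_segment_def)
  interpret th: theta "side c i k l" "side c j k l" "vp c k l" "pt c k" "pt c l"
    by (rule theta_sides(1)[OF mem(1-5) c ne])
  have fr: "frame i j k l = path_image (side c i k l) \<union> path_image (side c j k l)"
    by (rule theta_sides(2)[OF mem(1-5) c ne])
  \<comment> \<open>The arc between the other two decides. If it is the column, the whole frame is
    good and so is its half; if it is one of the sides, the half belonging to that side is
    good.\<close>
  from th.trichotomy consider
      "vs c k l \<inter> inside (path_image (side c i k l) \<union> path_image (side c j k l)) \<noteq> {}"
    | "path_image (side c i k l) \<inter> inside (path_image (side c j k l) \<union> vs c k l) \<noteq> {}"
    | "path_image (side c j k l) \<inter> inside (vs c k l \<union> path_image (side c i k l)) \<noteq> {}"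
    by argo
  then show ?thesis
  proof cases
    case 1
    then obtain z where z: "z \<in> vs c k l" "z \<in> inside (frame i j k l)"
      unfolding fr by blast
    have "pt c k \<in> frame i j k l" "pt c l \<in> frame i j k l"
      using mem c by (auto simp: frame_def T.pt_in_vs_iff open_segment_def)
    then have "z \<in> vo c k l"
      using z inside_no_overlap[of "frame i j k l"] unfolding vo_eq[OF mem(3-5)] by blast
    moreover have "vo c k l \<subseteq> inside (frame i j k l) \<or> vo c k l \<subseteq> outside (frame i j k l)"
      using mem c ne
      by (intro connected_subset_inside_or_outside frame_eqs connected_vo vo_frame_disjoint)
        (auto simp: open_segment_def)
    ultimately have "vo c k l \<subseteq> inside (frame i j k l)"
      using z inside_Int_outside[of "frame i j k l"] by blast
    moreover have "pt c r \<in> vo c k l"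
      using mem r by (simp add: pt_in_vo_iff)
    ultimately have "good i j k l"
      by (intro good_of_point[of c i j k l r]) (use mem c r in auto)
    then show ?thesis
      using good_split mem c by blast
  next
    case 2
    then have "path_image (side c i k l) \<inter> inside (vs c k l \<union> path_image (side c j k l)) \<noteq> {}"
      by (subst Un_commute)
    then show ?thesis
      using good_of_inside[of i j c k l a r] mem c a r by simp
  next
    case 3
    then show ?thesis
      using good_of_inside[of j i c k l b r] mem c b r by (simp add: open_segment_commute)
  qed
qed

lemma good_commute:
  "i \<in> X \<Longrightarrow> j \<in> X \<Longrightarrow> k \<in> Y \<Longrightarrow> l \<in> Y \<Longrightarrow> good i j k l \<longleftrightarrow> good j i k l"
  unfolding good_def by (simp add: frame_commute[of i j k l] open_segment_commute)

end

context grid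
begin

text \<open>\<open>good_split\<close> keeps the column named first, so the columns are swapped
  between the two cuts. The case \<open>i' = i\<close> lets a smaller frame keep its outer
  column.\<close>

lemma good_shrink_cols:
  assumes mem: "i \<in> X" "j \<in> X" "i' \<in> X" "j' \<in> X" "k \<in> Y" "l \<in> Y"
    and lt: "kx i \<le> kx i'" "kx i' < kx j'" "kx j' < kx j" "i' = i \<or> kx i < kx i'"
    and g: "good i j k l"
  shows "good i' j' k l"
proof -
  have "good i j' k l"
    by (rule good_split[OF mem(1,2,4-6) _ g]) (use lt in \<open>auto simp: open_segment_eq_real_ivl\<close>)
  then have g': "good j' i k l"
    using good_commute mem by blast
  show ?thesis
  proof (cases "i' = i")
    case False
    have "good j' i' k l"
      by (rule good_split[OF mem(4,1,3,5,6) _ g']) (use lt False in \<open>auto simp: open_segment_eq_real_ivl\<close>)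
    then show ?thesis
      using good_commute mem by blast
  qed (use \<open>good i j' k l\<close> in simp)
qed

end

context grid
begin

lemma good_shrink:
  assumes mem: "i \<in> X" "j \<in> X" "i' \<in> X" "j' \<in> X" "k \<in> Y" "l \<in> Y" "k' \<in> Y" "l' \<in> Y"
    and lt: "kx i \<le> kx i'" "kx i' < kx j'" "kx j' < kx j" "i' = i \<or> kx i < kx i'"
    and lt': "ky k < ky k'" "ky k' < ky l'" "ky l' < ky l"
    and g: "good i j k l"
  shows "good i' j' k' l'"
proof -
  have "T.good k l i' j'"
    unfolding good_transpose by (rule good_shrink_cols[OF mem(1-6) lt g])
  then have "T.good k' l' i' j'"
    by (intro T.good_shrink_cols[OF mem(5-8,3,4)]) (use lt' in auto)
  then show ?thesis
    unfolding good_transpose .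
qed

end

section \<open>Fixed points from winding numbers\<close>

text \<open>The path \<open>p\<close> need not be closed: its winding number is the change of a
  logarithm along it, up to the constant factor. This is what makes the sum over the sides of a
  quadrilateral computable side by side.\<close>

lemma winding_number_of_log:
  assumes "path g" "\<And>t. t \<in> {0..1} \<Longrightarrow> p t = exp (g t)"
  shows "winding_number p 0 = (g 1 - g 0) / (2 * of_real pi * \<i>)"
proof -
  have "winding_number p 0 = winding_number (exp \<circ> g) 0"
    by (rule winding_number_cong) (use assms(2) in auto)
  then show ?thesis
    using winding_number_compose_exp[OF assms(1)] by (simp add: pathstart_def pathfinish_def)
qed

text \<open>On the square, \<open>w t - z s\<close> has a logarithm, so the diagonal may be replaced by two sides.\<close>

lemma winding_number_diff:
  assumes z: "path z" and w: "path w" and disj: "path_image z \<inter> path_image w = {}"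
  shows "winding_number (\<lambda>t. w t - z t) 0 =
      winding_number w (pathstart z) + winding_number z (pathfinish w)" (is "?N = ?A + ?B")
    and "winding_number (\<lambda>t. w t - z t) 0 =
      winding_number z (pathstart w) + winding_number w (pathfinish z)" (is "_ = ?C + ?D")
proof -
  let ?I = "{0..1::real}"
  have "continuous_on (?I \<times> ?I) (\<lambda>x. w (snd x) - z (fst x))"
    using z w unfolding path_def
    by (auto intro!: continuous_intros continuous_on_compose2[where t = ?I and f = fst]
        continuous_on_compose2[where t = ?I and f = snd])
  moreover have "contractible (?I \<times> ?I)"
    by (intro convex_imp_contractible convex_Times) auto
  moreover have "w (snd x) - z (fst x) \<noteq> 0" if "x \<in> ?I \<times> ?I" for x
    using that disj by (fastforce simp: path_image_def disjoint_iff)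
  ultimately obtain \<Lambda> where cont: "continuous_on (?I \<times> ?I) \<Lambda>"
    and \<Lambda>: "\<And>x. x \<in> ?I \<times> ?I \<Longrightarrow> w (snd x) - z (fst x) = exp (\<Lambda> x)"
  proof (rule continuous_logarithm_on_contractible)
    fix h assume "continuous_on (?I \<times> ?I) h"
      and "\<And>x. x \<in> ?I \<times> ?I \<Longrightarrow> w (snd x) - z (fst x) = exp (h x)"
    then show thesis by (rule that)
  qed
  have path: "path (\<lambda>t. \<Lambda> (p t))" if "continuous_on ?I p" "p ` ?I \<subseteq> ?I \<times> ?I" for p
    unfolding path_def using continuous_on_compose2[OF cont that] .
  have "?N = (\<Lambda> (1, 1) - \<Lambda> (0, 0)) / (2 * of_real pi * \<i>)"
    by (rule winding_number_of_log[of "\<lambda>t. \<Lambda> (t, t)"])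
      (use \<Lambda> in \<open>auto intro!: path continuous_intros\<close>)
  moreover have "?A = (\<Lambda> (0, 1) - \<Lambda> (0, 0)) / (2 * of_real pi * \<i>)"
    unfolding winding_number_offset[of w]
    by (rule winding_number_of_log[of "\<lambda>t. \<Lambda> (0, t)"])
      (use \<Lambda> in \<open>auto intro!: path continuous_intros simp: pathstart_def\<close>)
  moreover have "?D = (\<Lambda> (1, 1) - \<Lambda> (1, 0)) / (2 * of_real pi * \<i>)"
    unfolding winding_number_offset[of w]
    by (rule winding_number_of_log[of "\<lambda>t. \<Lambda> (1, t)"])
      (use \<Lambda> in \<open>auto intro!: path continuous_intros simp: pathfinish_def\<close>)
  \<comment> \<open>For \<open>z\<close> the roles are exchanged: \<open>z t - pathfinish w\<close>
    is minus the function with logarithm \<open>\<Lambda>\<close>, and the shift by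
    \<open>\<i> * pi\<close> supplies the sign.\<close>
  moreover have "?B = (\<Lambda> (1, 1) + \<i> * of_real pi - (\<Lambda> (0, 1) + \<i> * of_real pi)) / (2 * of_real pi * \<i>)"
    unfolding winding_number_offset[of z]
  proof (rule winding_number_of_log[of "\<lambda>t. \<Lambda> (t, 1) + \<i> * of_real pi"])
    show "path (\<lambda>t. \<Lambda> (t, 1) + \<i> * of_real pi)"
    proof -
      have "path (\<lambda>t. \<Lambda> (t, 1))"
        by (rule path) (auto intro!: continuous_intros)
      then show ?thesis
        unfolding path_def by (intro continuous_on_add continuous_on_const)
    qed
    show "z t - pathfinish w = exp (\<Lambda> (t, 1) + \<i> * of_real pi)" if "t \<in> ?I" for t
      using \<Lambda>[of "(t, 1)", symmetric] that by (simp add: exp_add pathfinish_def)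
  qed
  moreover have "?C = (\<Lambda> (1, 0) + \<i> * of_real pi - (\<Lambda> (0, 0) + \<i> * of_real pi)) / (2 * of_real pi * \<i>)"
    unfolding winding_number_offset[of z]
  proof (rule winding_number_of_log[of "\<lambda>t. \<Lambda> (t, 0) + \<i> * of_real pi"])
    show "path (\<lambda>t. \<Lambda> (t, 0) + \<i> * of_real pi)"
    proof -
      have "path (\<lambda>t. \<Lambda> (t, 0))"
        by (rule path) (auto intro!: continuous_intros)
      then show ?thesis
        unfolding path_def by (intro continuous_on_add continuous_on_const)
    qed
    show "z t - pathstart w = exp (\<Lambda> (t, 0) + \<i> * of_real pi)" if "t \<in> ?I" for t
      using \<Lambda>[of "(t, 0)", symmetric] that by (simp add: exp_add pathstart_def)
  qed
  ultimately show "?N = ?A + ?B" "?N = ?C + ?D"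
    by (simp_all add: add_divide_distrib[symmetric] diff_divide_distrib[symmetric])
qed

text \<open>The total winding number of \<open>f z - z\<close> around the quadrilateral with sides \<open>s\<^sub>1, u\<^sub>2, s\<^sub>2, u\<^sub>1\<close>
  is the sum of the three winding numbers occurring in the last three assumptions. If \<open>f\<close> had no
  fixed point, then \<open>f z - z\<close> would have a logarithm on \<open>Q\<close>, and this total would vanish.\<close>

lemma fixed_point_of_winding_numbers:
  fixes f :: "complex \<Rightarrow> complex"
  assumes Q: "compact Q" "connected (- Q)" and f: "continuous_on Q f"
    and paths: "path s1" "path u2" "path s2" "path u1" "path \<Gamma>"
    and s1: "pathstart s1 = a" "pathfinish s1 = b" and u2: "pathstart u2 = b" "pathfinish u2 = c"
    and s2: "pathstart s2 = c" "pathfinish s2 = d" and u1: "pathstart u1 = d" "pathfinish u1 = a"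
    and \<Gamma>: "pathstart \<Gamma> = f a" "pathfinish \<Gamma> = f d"
    and sub: "path_image s1 \<subseteq> Q" "path_image u2 \<subseteq> Q" "path_image s2 \<subseteq> Q" "path_image u1 \<subseteq> Q"
    and disj: "path_image s1 \<inter> f ` path_image s1 = {}" "path_image u2 \<inter> f ` path_image u2 = {}"
      "path_image s2 \<inter> f ` path_image s2 = {}" "path_image u1 \<inter> f ` path_image u1 = {}"
      "path_image u2 \<inter> f ` path_image s2 = {}" "path_image u2 \<inter> path_image \<Gamma> = {}"
      "path_image s2 \<inter> path_image \<Gamma> = {}"
    and W1: "winding_number s1 (f a) + winding_number u2 (f a) + winding_number s2 (f a)
      + winding_number u1 (f a) = 0"
    and W2: "winding_number (f \<circ> s1) b + winding_number (f \<circ> u2) b + winding_number (f \<circ> s2) b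
      = winding_number \<Gamma> b"
    and W3: "winding_number \<Gamma> d + winding_number (f \<circ> u1) d \<noteq> 0"
  shows "\<exists>z\<in>Q. f z = z"
proof (rule ccontr)
  assume no: "\<not> ?thesis"
  \<comment> \<open>A compact plane set with connected complement is Borsukian: a continuous
    function without zeros has a logarithm on it.\<close>
  have "Borsukian Q"
    using Q by (simp add: Borsukian_separation_compact)
  moreover have "continuous_on Q (\<lambda>z. f z - z)" "(\<lambda>z. f z - z) \<in> Q \<rightarrow> - {0}"
    using f no by (auto intro!: continuous_intros)
  ultimately obtain g where g: "continuous_on Q g" "\<And>z. z \<in> Q \<Longrightarrow> f z - z = exp (g z)"
    unfolding Borsukian_continuous_logarithm by blast
  have N: "winding_number (\<lambda>t. (f \<circ> p) t - p t) 0 = (g (pathfinish p) - g (pathstart p)) / (2 * of_real pi * \<i>)"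
    if "path p" "path_image p \<subseteq> Q" for p
  proof -
    have "path (g \<circ> p)"
      using that g(1) by (intro path_continuous_image) (auto intro: continuous_on_subset)
    from winding_number_of_log[OF this, of "\<lambda>t. (f \<circ> p) t - p t"] show ?thesis
      using that g(2) by (auto simp: pathfinish_def pathstart_def path_image_def image_subset_iff)
  qed
  have pf: "path (f \<circ> p)" if "path p" "path_image p \<subseteq> Q" for p
    using that f by (intro path_continuous_image) (auto intro: continuous_on_subset)
  note e = path_image_compose pathstart_compose pathfinish_compose s1 s2 u1 u2 \<Gamma>
  \<comment> \<open>With one logarithm on all of \<open>Q\<close>, its changes along the four sides
    cancel.\<close>
  have "(g b - g a) + (g c - g b) + (g d - g c) + (g a - g d) = 0"
    by simp
  then have "winding_number (\<lambda>t. (f \<circ> s1) t - s1 t) 0 + winding_number (\<lambda>t. (f \<circ> u2) t - u2 t) 0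
    + winding_number (\<lambda>t. (f \<circ> s2) t - s2 t) 0 + winding_number (\<lambda>t. (f \<circ> u1) t - u1 t) 0 = 0"
    using N paths sub by (simp add: e flip: add_divide_distrib)
  moreover have "winding_number (\<lambda>t. (f \<circ> s1) t - s1 t) 0 = winding_number s1 (f a) + winding_number (f \<circ> s1) b"
    using winding_number_diff(2)[of s1 "f \<circ> s1"] paths pf sub disj by (simp add: e)
  moreover have "winding_number (\<lambda>t. (f \<circ> u2) t - u2 t) 0 = winding_number (f \<circ> u2) b + winding_number u2 (f c)"
    using winding_number_diff(1)[of u2 "f \<circ> u2"] paths pf sub disj by (simp add: e)
  moreover have "winding_number (\<lambda>t. (f \<circ> s2) t - s2 t) 0 = winding_number (f \<circ> s2) c + winding_number s2 (f d)"
    using winding_number_diff(1)[of s2 "f \<circ> s2"] paths pf sub disj by (simp add: e)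
  moreover have "winding_number (\<lambda>t. (f \<circ> u1) t - u1 t) 0 = winding_number (f \<circ> u1) d + winding_number u1 (f a)"
    using winding_number_diff(1)[of u1 "f \<circ> u1"] paths pf sub disj by (simp add: e)
  \<comment> \<open>For disjoint paths the two formulas of \<open>winding_number_diff\<close> agree.
    Three such exchanges move the base points of \<open>f \<circ> s2\<close>, \<open>u2\<close>,
    \<open>s2\<close> and \<open>\<Gamma>\<close> to those in the last three assumptions.\<close>
  moreover have "winding_number (f \<circ> s2) b + winding_number u2 (f d) = winding_number u2 (f c) + winding_number (f \<circ> s2) c"
    using winding_number_diff[of u2 "f \<circ> s2"] paths pf sub disj by (simp add: e)
  moreover have "winding_number \<Gamma> b + winding_number u2 (f d) = winding_number u2 (f a) + winding_number \<Gamma> c"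
    using winding_number_diff[of u2 \<Gamma>] paths disj by (simp add: e)
  moreover have "winding_number \<Gamma> c + winding_number s2 (f d) = winding_number s2 (f a) + winding_number \<Gamma> d"
    using winding_number_diff[of s2 \<Gamma>] paths disj by (simp add: e)
  ultimately have "winding_number \<Gamma> d + winding_number (f \<circ> u1) d = 0"
    using W1 W2 by algebra
  with W3 show False by simp
qed

text \<open>The outside of \<open>C\<close> is connected, unbounded and misses \<open>K\<close>, so
  it lies in the outside of \<open>K\<close>; a point of its frontier that is not on
  \<open>K\<close> goes with it.\<close>

lemma frontier_point_in_outside:
  fixes C K :: "complex set"
  assumes C: "bounded C" "connected (outside C)" and K: "closed K" "K \<subseteq> C \<union> inside C"
    and p: "p \<in> frontier (outside C)" "p \<notin> K"
  shows "p \<in> outside K"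
proof -
  have unb: "\<not> bounded (outside C)"
    using C(1) unbounded_outside by blast
  have "outside C \<inter> K = {}"
    using K(2) by (auto simp: inside_def outside_def)
  then have "outside C \<subseteq> inside K \<or> outside C \<subseteq> outside K"
    using connected_subset_inside_or_outside[OF K(1) C(2)] by blast
  moreover have "bounded (inside K)"
  proof -
    have "K \<subseteq> - outside C" using \<open>outside C \<inter> K = {}\<close> by blast
    then have "bounded K" using cobounded_outside[OF C(1)] bounded_subset by blast
    then show ?thesis by (rule bounded_inside)
  qed
  ultimately have sub: "outside C \<subseteq> outside K"
    using unb bounded_subset by blast
  have "p \<in> closure (outside K)"
    using p(1) closure_mono[OF sub] by (auto simp: frontier_def)
  then have "p \<notin> inside K"
    using open_inside[OF K(1)] inside_Int_outside[of K] open_Int_closure_eq_empty[of "inside K" "outside K"] by blast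
  then show ?thesis
    using p(2) by (simp add: outside_inside)
qed

section \<open>The index of a map at two crossing rectangles\<close>

context grid
begin

lemma vs_subset_good_frame:
  assumes mem: "i \<in> X" "j \<in> X" "k \<in> Y" "l \<in> Y" "a \<in> X" "r \<in> Y"
    and ij: "kx i \<noteq> kx j" and a: "a = i \<or> a = j \<or> kx a \<in> open_segment (kx i) (kx j)"
    and r: "ky r \<in> open_segment (ky k) (ky l)" and g: "good i j k l"
  shows "vs a k l \<subseteq> frame i j k l \<union> inside (frame i j k l)"
proof (cases "a = i \<or> a = j")
  case False
  then have a': "kx a \<in> open_segment (kx i) (kx j)" using a by blast
  have "vo a k l \<subseteq> inside (frame i j k l)"
    using g mem False a' r ij unfolding good_def
    by (intro vo_inside[of a i j k l r]) (auto simp: open_segment_def)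
  moreover have "pt a k \<in> T.vs k i j" "pt a l \<in> T.vs l i j"
    using mem a' by (auto simp: T.pt_in_vs_iff open_segment_def)
  ultimately show ?thesis
    using vo_eq[of a k l] mem unfolding frame_def by blast
qed (auto simp: frame_def)

end

context grid
begin

lemma frame_region:
  assumes "i \<in> X" "j \<in> X" "k \<in> Y" "l \<in> Y" "kx i \<noteq> kx j" "ky k \<noteq> ky l"
  shows "compact (frame i j k l \<union> inside (frame i j k l))" "connected (inside (frame i j k l))"
    "inside (frame i j k l) \<noteq> {}" "- (frame i j k l \<union> inside (frame i j k l)) = outside (frame i j k l)"
proof -
  let ?J = "frame i j k l"
  have jf: "bounded (inside ?J)" "closed ?J"
    using jordan_frame[of j i k l] closed_frame[of j i k l] assms by auto
  have "bounded ?J"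
    using assms by (auto simp: frame_def bounded_path_image path_vp T.path_vp)
  moreover show eq: "- (?J \<union> inside ?J) = outside ?J"
    by (auto simp: inside_def outside_def)
  moreover have "closed (?J \<union> inside ?J)"
    unfolding closed_def eq by (rule open_outside[OF jf(2)])
  ultimately show "compact (?J \<union> inside ?J)"
    using jf by (simp add: compact_eq_bounded_closed)
  show "connected (inside ?J)" "inside ?J \<noteq> {}"
    using jordan_frame[of j i k l] assms by auto
qed

text \<open>The sides are compared through a detour \<open>?G\<close> that leaves the image frame at
  one end of its column \<open>x1'\<close>, goes around by column \<open>i\<close>, beyond
  \<open>x1\<close>, and returns at the other end. Together with the image of column
  \<open>x1\<close> it encloses \<open>pt x1 y2\<close>; together with the other three image sides
  it leaves \<open>pt x2 y1\<close> outside.\<close>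

lemma crossing_fixed_point:
  assumes mem: "i \<in> X" "j \<in> X" "x1 \<in> X" "x2 \<in> X" "x1' \<in> X" "x2' \<in> X"
      "k \<in> Y" "l \<in> Y" "y1 \<in> Y" "y2 \<in> Y" "t1 \<in> Y" "t2 \<in> Y"
    and g: "good i j k l"
    and lt: "kx i < kx x1" "kx x1 < kx x1'" "kx x1' < kx x2" "kx x1 < kx x2'" "kx x2' < kx x2" "kx x2 < kx j"
    and lt': "ky k < ky t1" "ky t1 < ky y1" "ky y1 < ky t2" "ky t1 < ky y2" "ky y2 < ky t2" "ky t2 < ky l"
      "ky y1 \<noteq> ky y2"
    and f: "continuous_on (frame x1 x2 y1 y2 \<union> inside (frame x1 x2 y1 y2)) f" "inj_on f (frame x1 x2 y1 y2)"
    and f_pt: "f (pt x1 y1) = pt x1' t1" "f (pt x2 y1) = pt x2' t1" "f (pt x1 y2) = pt x1' t2" "f (pt x2 y2) = pt x2' t2"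
    and f_side: "f ` T.vs y1 x1 x2 = T.vs t1 x1' x2'" "f ` T.vs y2 x1 x2 = T.vs t2 x1' x2'"
      "f ` vs x1 y1 y2 = vs x1' t1 t2" "f ` vs x2 y1 y2 = vs x2' t1 t2"
  shows "\<exists>z\<in>frame x1 x2 y1 y2 \<union> inside (frame x1 x2 y1 y2). f z = z"
proof -
  \<comment> \<open>\<open>?O\<close> is a curve for comparison: \<open>pt x1' t1\<close> and
    \<open>pt x2 y1\<close> lie on it, while the curves that must not wind around them lie in its
    closed inside. \<open>?L\<close> is the loop that contributes the nonzero index.\<close>
  let ?J = "frame x1 x2 y1 y2" and ?O = "frame i x2 t1 t2" and ?L = "frame i x1' t1 t2"
  let ?s1 = "T.vp y1 x1 x2" and ?u2 = "vp x2 y1 y2" and ?s2 = "T.vp y2 x2 x1" and ?u1 = "vp x1 y2 y1"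
  let ?G = "side x1' i t1 t2"
  have ne: "x1 \<noteq> x1'" "x2 \<noteq> x2'" "y1 \<noteq> t1" "y2 \<noteq> t2" "y1 \<noteq> t2" "y2 \<noteq> t1" "x1' \<noteq> i" "x1 \<noteq> i" "x2 \<noteq> i" "x2' \<noteq> i"
    "t1 \<noteq> t2" "x1 \<noteq> x2" "y1 \<noteq> y2" "x1' \<noteq> x2" "x1 \<noteq> x2'"
    using lt lt' by auto
  have kne: "kx x1' \<noteq> kx i" "ky t1 \<noteq> ky t2" "kx i \<noteq> kx x2" "kx x1 \<noteq> kx x2"
    using lt lt' by auto
  have gO: "good i x2 t1 t2" and gL: "good i x1' t1 t2"
    using good_shrink[OF mem(1,2,1,4,7,8,11,12) _ _ _ _ _ _ _ g]
      good_shrink[OF mem(1,2,1,5,7,8,11,12) _ _ _ _ _ _ _ g] lt lt' by auto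
  have subs: "path_image ?s1 \<subseteq> ?J" "path_image ?u2 \<subseteq> ?J" "path_image ?s2 \<subseteq> ?J" "path_image ?u1 \<subseteq> ?J"
    using vs_sym[of x1 y1 y2] T.vs_sym[of y2 x1 x2] mem by (auto simp: frame_def)
  have fs2: "f ` path_image ?s2 = T.vs t2 x1' x2'" and fu1: "f ` path_image ?u1 = vs x1' t1 t2"
    using vs_sym[of x1 y1 y2] T.vs_sym[of y2 x1 x2] mem f_side by auto
  have G: "path_image ?G = T.vs t1 x1' i \<union> vs i t1 t2 \<union> T.vs t2 i x1'"
    by (rule path_image_side) (use mem kne in auto)
  have contJ: "continuous_on ?J f"
    using f(1) continuous_on_subset by blast
  have paths: "path ?s1" "path ?u2" "path ?s2" "path ?u1" "path ?G"
    using mem path_vp T.path_vp arc_side[of x1' i t1 t2] kne by (auto simp: arc_imp_path)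
  have pf: "path (f \<circ> ?s1)" "path (f \<circ> ?u2)" "path (f \<circ> ?s2)" "path (f \<circ> ?u1)"
    using paths subs by (auto intro!: path_continuous_image continuous_on_subset[OF contJ])
  note ends = side_ends[of x1' i t1 t2]
  have Oclosed: "bounded ?O" "connected (outside ?O)" "frontier (outside ?O) = ?O"
    using frame_eqs[of i x2 t1 t2] mem kne
    by (auto simp: frame_def bounded_path_image path_vp T.path_vp)
  have inO: "T.vs y1 i x2 \<subseteq> ?O \<union> inside ?O" "T.vs y2 i x2 \<subseteq> ?O \<union> inside ?O"
    "vs x1 t1 t2 \<subseteq> ?O \<union> inside ?O" "vs x2' t1 t2 \<subseteq> ?O \<union> inside ?O"
  proof -
    have gO': "T.good t1 t2 i x2" using gO by (simp add: good_transpose)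
    show "T.vs y1 i x2 \<subseteq> ?O \<union> inside ?O" "T.vs y2 i x2 \<subseteq> ?O \<union> inside ?O"
      unfolding frame_transpose[of t1 t2 i x2, symmetric]
      using mem lt lt' gO'
      by (intro T.vs_subset_good_frame[of t1 t2 i x2 _ x1]; force simp: open_segment_eq_real_ivl)+
    show "vs x1 t1 t2 \<subseteq> ?O \<union> inside ?O" "vs x2' t1 t2 \<subseteq> ?O \<union> inside ?O"
      using mem lt lt' gO
      by (intro vs_subset_good_frame[of i x2 t1 t2 _ y1]; force simp: open_segment_eq_real_ivl)+
  qed
  have J_sub: "?J \<subseteq> ?O \<union> inside ?O"
  proof -
    have "vs x1 y1 y2 \<subseteq> vs x1 t1 t2" "vs x2 y1 y2 \<subseteq> vs x2 t1 t2"
      using mem lt' by (intro vs_subset; simp add: real_closed_segment_iff)+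
    moreover have "T.vs y1 x1 x2 \<subseteq> T.vs y1 i x2" "T.vs y2 x1 x2 \<subseteq> T.vs y2 i x2"
      using mem lt by (intro T.vs_subset; simp add: real_closed_segment_iff)+
    moreover have "vs x2 t1 t2 \<subseteq> ?O" by (auto simp: frame_def)
    ultimately show ?thesis
      using inO unfolding frame_def[of x1] by blast
  qed
  have Jclosed: "closed ?J"
    using frame_eqs mem kne lt' by blast
  have W1: "winding_number ?s1 (pt x1' t1) + winding_number ?u2 (pt x1' t1) + winding_number ?s2 (pt x1' t1)
      + winding_number ?u1 (pt x1' t1) = 0"
  proof -
    have "pt x1' t1 \<notin> ?J"
      using mem ne lt lt' by (auto simp: frame_def pt_in_vs_iff T.pt_in_vs_iff)
    moreover have "pt x1' t1 \<in> ?O"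
      using mem lt by (auto simp: frame_def T.pt_in_vs_iff real_closed_segment_iff)
    ultimately have out: "pt x1' t1 \<in> outside ?J"
      by (intro frontier_point_in_outside[OF Oclosed(1,2) Jclosed J_sub]) (auto simp: Oclosed(3))
    let ?p = "?s1 +++ (?u2 +++ (?s2 +++ ?u1))"
    have pim: "path_image ?p = ?J"
      using mem vs_sym[of x1 y1 y2] T.vs_sym[of y2 x1 x2] by (auto simp: path_image_join frame_def)
    have "winding_number ?p (pt x1' t1) = 0"
      using mem paths out by (intro winding_number_zero_in_outside) (auto simp: pim)
    moreover have "pt x1' t1 \<notin> path_image ?s1" "pt x1' t1 \<notin> path_image ?u2" "pt x1' t1 \<notin> path_image ?s2"
      "pt x1' t1 \<notin> path_image ?u1"
      using out subs by (auto simp: outside_def)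
    ultimately show ?thesis
      using mem paths by (simp add: winding_number_join path_image_join add.assoc)
  qed
  have W2: "winding_number (f \<circ> ?s1) (pt x2 y1) + winding_number (f \<circ> ?u2) (pt x2 y1) + winding_number (f \<circ> ?s2) (pt x2 y1)
      = winding_number ?G (pt x2 y1)"
  proof -
    let ?p = "(f \<circ> ?s1) +++ ((f \<circ> ?u2) +++ ((f \<circ> ?s2) +++ reversepath ?G))"
    let ?K = "T.vs t1 x1' x2' \<union> vs x2' t1 t2 \<union> T.vs t2 x1' x2' \<union> path_image ?G"
    have pst: "pathstart (f \<circ> ?s1) = pt x1' t1" "pathfinish (f \<circ> ?s1) = pt x2' t1"
      "pathstart (f \<circ> ?u2) = pt x2' t1" "pathfinish (f \<circ> ?u2) = pt x2' t2"
      "pathstart (f \<circ> ?s2) = pt x2' t2" "pathfinish (f \<circ> ?s2) = pt x1' t2"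
      "pathstart ?G = pt x1' t1" "pathfinish ?G = pt x1' t2"
      using mem f_pt ends kne by (simp_all add: pathstart_compose pathfinish_compose)
    have pim: "path_image ?p = ?K"
      using pst by (simp add: path_image_join path_image_compose f_side fs2 Un_assoc)
    have "path ?p" using pf paths pst by simp
    have "T.vs t1 x1' x2' \<subseteq> T.vs t1 i x2" "T.vs t2 x1' x2' \<subseteq> T.vs t2 i x2"
      "T.vs t1 x1' i \<subseteq> T.vs t1 i x2" "T.vs t2 i x1' \<subseteq> T.vs t2 i x2"
      using mem lt by (intro T.vs_subset; simp add: real_closed_segment_iff)+
    then have "?K \<subseteq> ?O \<union> inside ?O"
      using inO(4) unfolding G frame_def[of i x2] by blast
    moreover have "pt x2 y1 \<notin> ?K"
      using mem ne by (auto simp: G pt_in_vs_iff T.pt_in_vs_iff)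
    moreover have "pt x2 y1 \<in> ?O"
      using mem lt' by (auto simp: frame_def pt_in_vs_iff real_closed_segment_iff)
    moreover have "closed ?K"
      using closed_path_image[OF \<open>path ?p\<close>] pim by simp
    ultimately have out: "pt x2 y1 \<in> outside ?K"
      by (intro frontier_point_in_outside[OF Oclosed(1,2)]) (auto simp: Oclosed(3))
    have "winding_number ?p (pt x2 y1) = 0"
      using \<open>path ?p\<close> out pst by (intro winding_number_zero_in_outside) (auto simp: pim)
    moreover have "pt x2 y1 \<notin> path_image (f \<circ> ?s1)" "pt x2 y1 \<notin> path_image (f \<circ> ?u2)" "pt x2 y1 \<notin> path_image (f \<circ> ?s2)"
      "pt x2 y1 \<notin> path_image ?G"
      using \<open>pt x2 y1 \<notin> ?K\<close> by (simp_all add: path_image_compose f_side fs2)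
    ultimately show ?thesis
      using pf paths pst by (simp add: winding_number_join path_image_join winding_number_reversepath algebra_simps)
  qed
  \<comment> \<open>This is the nonzero term: goodness puts the crossing point
    \<open>pt x1 y2\<close> inside \<open>?L\<close>.\<close>
  have W3: "winding_number ?G (pt x1 y2) + winding_number (f \<circ> ?u1) (pt x1 y2) \<noteq> 0"
  proof -
    have pst: "pathstart (f \<circ> ?u1) = pt x1' t2" "pathfinish (f \<circ> ?u1) = pt x1' t1"
      "pathstart ?G = pt x1' t1" "pathfinish ?G = pt x1' t2"
      using mem f_pt ends kne by (simp_all add: pathstart_compose pathfinish_compose)
    have "arc (f \<circ> ?u1)"
    proof -
      have "arc ?u1" using arc_vp mem lt' by simp
      then show ?thesis
        using pf subs(4) inj_on_subset[OF f(2)] by (auto simp: arc_def path_image_def intro!: comp_inj_on)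
    qed
    moreover have "arc ?G"
      using arc_side mem kne by blast
    moreover have im: "path_image ?G \<inter> path_image (f \<circ> ?u1) = {pt x1' t1, pt x1' t2}"
      using side_Int_vs[of x1' i t1 t2] mem kne by (simp add: path_image_compose fu1)
    ultimately have "simple_path (?G +++ (f \<circ> ?u1))"
      using pst by (intro simple_path_join_loop) auto
    moreover have "path_image (?G +++ (f \<circ> ?u1)) = ?L"
      using pst frame_eq_side[of x1' i t1 t2] mem kne by (simp add: path_image_join path_image_compose fu1)
    moreover have "pt x1 y2 \<in> inside ?L"
      using gL mem lt lt' unfolding good_def by (auto simp: open_segment_eq_real_ivl)
    ultimately have "winding_number (?G +++ (f \<circ> ?u1)) (pt x1 y2) = 1 \<or> winding_number (?G +++ (f \<circ> ?u1)) (pt x1 y2) = -1"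
      by (metis simple_closed_path_winding_number_inside)
    moreover have "pt x1 y2 \<notin> path_image ?G" "pt x1 y2 \<notin> path_image (f \<circ> ?u1)"
      using mem ne by (auto simp: G path_image_compose fu1 pt_in_vs_iff T.pt_in_vs_iff)
    then have "winding_number (?G +++ (f \<circ> ?u1)) (pt x1 y2) = winding_number ?G (pt x1 y2) + winding_number (f \<circ> ?u1) (pt x1 y2)"
      using pst paths pf by (simp add: winding_number_join)
    ultimately show ?thesis by auto
  qed
  have d1: "path_image ?s1 \<inter> f ` path_image ?s1 = {}" "path_image ?s2 \<inter> f ` path_image ?s2 = {}"
    unfolding fs2 f_side using mem ne by (simp_all add: T.vs_disjoint)
  have d2: "path_image ?u2 \<inter> f ` path_image ?u2 = {}" "path_image ?u1 \<inter> f ` path_image ?u1 = {}"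
    unfolding fu1 f_side using mem ne by (simp_all add: vs_disjoint)
  have v: "vs x2 y1 y2 \<inter> T.vs t x x' = {}" if "t = t1 \<or> t = t2" "x \<in> X" "x' \<in> X" for t x x'
  proof -
    have "vs x2 y1 y2 \<inter> T.vs t x x' \<subseteq> {pt x2 t}"
      using vs_cross mem that by blast
    moreover have "pt x2 t \<notin> vs x2 y1 y2"
      using that mem lt' by (auto simp: pt_in_vs_iff real_closed_segment_iff)
    ultimately show ?thesis by blast
  qed
  have d3: "path_image ?u2 \<inter> f ` path_image ?s2 = {}"
    unfolding fs2 using v mem by simp
  have d4: "path_image ?u2 \<inter> path_image ?G = {}"
    unfolding G Int_Un_distrib using v mem vs_disjoint[of x2 i y1 y2 t1 t2] ne by simp
  have d5: "path_image ?s2 \<inter> path_image ?G = {}"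
  proof -
    have "T.vs y2 x2 x1 \<inter> T.vs t1 x1' i = {}" "T.vs y2 x2 x1 \<inter> T.vs t2 i x1' = {}"
      using mem ne by (simp_all add: T.vs_disjoint)
    moreover have "vs i t1 t2 \<inter> T.vs y2 x2 x1 \<subseteq> {pt i y2}"
      using mem by (intro vs_cross)
    moreover have "pt i y2 \<notin> T.vs y2 x2 x1"
      using mem lt by (auto simp: T.pt_in_vs_iff real_closed_segment_iff)
    ultimately show ?thesis
      unfolding G by blast
  qed
  show ?thesis
  proof (rule fixed_point_of_winding_numbers[where f = f and \<Gamma> = ?G and ?s1.0 = ?s1 and ?u2.0 = ?u2
        and ?s2.0 = ?s2 and ?u1.0 = ?u1])
    note region = frame_region[OF mem(3,4,9,10) kne(4) lt'(7)]
    show "compact (?J \<union> inside ?J)" by (rule region(1))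
    show "connected (- (?J \<union> inside ?J))"
      unfolding region(4) using jordan_frame[of x2 x1 y1 y2] mem kne lt' by auto
  qed (use f(1) paths mem ends kne f_pt subs d1 d2 d3 d4 d5 W1 W2 W3 in \<open>auto\<close>)
qed

end

section \<open>Borel measures, recurrence and product measures\<close>

lemma sets_borel_of: "sets (borel_of X) = sigma_sets (topspace X) {U. openin X U}"
  unfolding borel_of_def by (rule sets_measure_of) (use openin_subset in auto)

lemma space_borel_of: "space (borel_of X) = topspace X"
  unfolding borel_of_def by (rule space_measure_of) (use openin_subset in auto)

lemma openin_in_borel_of: "openin X U \<Longrightarrow> U \<in> sets (borel_of X)"
  by (auto simp: sets_borel_of)

lemma measurable_borel_of:
  assumes "sets M = sets (borel_of X)" "continuous_map X Y f"
  shows "f \<in> measurable M (borel_of Y)"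
  unfolding borel_of_def
proof (rule measurable_measure_of)
  have sp: "space M = topspace X"
    using sets_eq_imp_space_eq[OF assms(1)] by (simp add: space_borel_of)
  show "f \<in> space M \<rightarrow> topspace Y"
    using continuous_map_image_subset_topspace[OF assms(2)] by (auto simp: sp)
  fix U assume "U \<in> {U. openin Y U}"
  then have "openin X {x \<in> topspace X. f x \<in> U}"
    using assms(2) by (simp add: continuous_map_def)
  moreover have "f -` U \<inter> space M = {x \<in> topspace X. f x \<in> U}"
    by (auto simp: sp)
  ultimately show "f -` U \<inter> space M \<in> sets M"
    using openin_in_borel_of assms(1) by metis
qed (use openin_subset in auto)

lemma sets_borel_of_euclidean: "sets (borel_of euclidean) = sets borel"
  by (simp add: sets_borel_of borel_def)

lemma openin_union_balls: "openin (top_of_set S) {x \<in> S. \<exists>q\<in>Q. dist x q < (r::real)}"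
proof -
  have "{x \<in> S. \<exists>q\<in>Q. dist x q < r} = S \<inter> (\<Union>q\<in>Q. ball q r)"
    by (auto simp: dist_commute)
  then show ?thesis
    by (auto simp: openin_open intro!: exI[of _ "\<Union>q\<in>Q. ball q r"])
qed

text \<open>The sets with this property contain the open ones and form a sigma-algebra:
  contraposition of the condition on \<open>p\<close> and \<open>q\<close> gives it for the
  complement, with the same \<open>Z\<close> and \<open>\<delta>\<close>. It makes membership in
  \<open>B\<close> locally constant off \<open>Z\<close>, at one uniform scale.\<close>

lemma uniform_approximation:
  fixes S :: "'a::metric_space set" and M :: "'a measure"
  assumes "finite_measure M" and sets: "sets M = sets (borel_of (top_of_set S))" and B: "B \<in> sets M" and "\<epsilon> > 0"
  shows "\<exists>Z\<in>sets M. \<exists>\<delta>>0. measure M Z < \<epsilon> \<and> (\<forall>p\<in>B - Z. \<forall>q\<in>S. dist p q < \<delta> \<longrightarrow> q \<in> B \<union> Z)"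
proof -
  interpret finite_measure M by fact
  have sp: "space M = S"
    using sets_eq_imp_space_eq[OF sets] by (simp add: space_borel_of)
  have "B \<in> sigma_sets S {U. openin (top_of_set S) U}"
    using B by (simp add: sets sets_borel_of)
  then show ?thesis
    using \<open>\<epsilon> > 0\<close>
  proof (induction arbitrary: \<epsilon>)
    case (Basic U)
    then have U: "openin (top_of_set S) U" by simp
    \<comment> \<open>Points of \<open>U\<close> whose neighborhood in \<open>S\<close> of radius
      \<open>1 / Suc k\<close> stays in \<open>U\<close>. They exhaust \<open>U\<close>, so a late
      \<open>U - A k\<close> serves as \<open>Z\<close>.\<close>
    define A where "A = (\<lambda>k::nat. {x \<in> U. \<forall>q\<in>S. dist x q < 1 / real (Suc k) \<longrightarrow> q \<in> U})"
    have US: "U \<subseteq> S" and Um: "U \<in> sets M"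
      using openin_subset[OF U] openin_in_borel_of[OF U] by (auto simp: sets)
    have Am: "A k \<in> sets M" for k
    proof -
      have eq: "A k = space M - {x \<in> S. \<exists>q\<in>S - U. dist x q < 1 / real (Suc k)}"
      proof (intro set_eqI iffI)
        fix x assume x: "x \<in> space M - {x \<in> S. \<exists>q\<in>S - U. dist x q < 1 / real (Suc k)}"
        have "x \<in> U"
        proof (rule ccontr)
          assume "x \<notin> U"
          moreover have "dist x x < 1 / real (Suc k)" by simp
          ultimately show False using x sp by blast
        qed
        then show "x \<in> A k" using x sp by (auto simp: A_def simp del: of_nat_Suc)
      qed (use US in \<open>auto simp: A_def sp simp del: of_nat_Suc\<close>)
      have "{x \<in> S. \<exists>q\<in>S - U. dist x q < 1 / real (Suc k)} \<in> sets M"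
        unfolding sets by (rule openin_in_borel_of[OF openin_union_balls])
      then show ?thesis
        unfolding eq by (rule sets.compl_sets)
    qed
    have dec: "decseq (\<lambda>k. U - A k)"
    proof (rule decseq_SucI)
      fix k show "U - A (Suc k) \<subseteq> U - A k"
      proof -
        have "1 / real (Suc (Suc k)) \<le> 1 / real (Suc k)" by (simp add: field_simps)
        then show ?thesis unfolding A_def by (smt (verit) Diff_iff mem_Collect_eq subsetI)
      qed
    qed
    have empty: "(\<Inter>k. U - A k) = {}"
    proof -
      have "\<exists>k. x \<in> A k" if x: "x \<in> U" for x
      proof -
        obtain e where e: "e > 0" "\<And>q. q \<in> S \<Longrightarrow> dist q x < e \<Longrightarrow> q \<in> U"
          using U x unfolding openin_euclidean_subtopology_iff by blast
        obtain k where "1 / real (Suc k) < e"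
          using e(1) nat_approx_posE by blast
        then show ?thesis
          using e x unfolding A_def by (smt (verit) dist_commute mem_Collect_eq)
      qed
      then show ?thesis by blast
    qed
    have "(\<lambda>k. measure M (U - A k)) \<longlonglongrightarrow> measure M (\<Inter>k. U - A k)"
      by (rule finite_Lim_measure_decseq) (use Am Um dec in auto)
    then have "(\<lambda>k. measure M (U - A k)) \<longlonglongrightarrow> 0"
      unfolding empty by simp
    then have "eventually (\<lambda>k. measure M (U - A k) < \<epsilon>) sequentially"
      by (rule order_tendstoD(2)) (use Basic in simp)
    then obtain k where k: "measure M (U - A k) < \<epsilon>"
      by (auto simp: eventually_sequentially)
    show ?case
    proof (intro bexI[of _ "U - A k"] exI[of _ "1 / real (Suc k)"] conjI ballI impI)
      fix p q assume "p \<in> U - (U - A k)" "q \<in> S" "dist p q < 1 / real (Suc k)"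
      then show "q \<in> U \<union> (U - A k)" by (auto simp: A_def)
    qed (use k Am Um in auto)
  next
    case Empty
    then show ?case by (intro bexI[of _ "{}"] exI[of _ 1]) auto
  next
    case (Compl A)
    from Compl.IH[OF Compl.prems] obtain Z \<delta> where Z: "Z \<in> sets M" "\<delta> > 0" "measure M Z < \<epsilon>"
      "\<And>p q. p \<in> A - Z \<Longrightarrow> q \<in> S \<Longrightarrow> dist p q < \<delta> \<Longrightarrow> q \<in> A \<union> Z"
      by blast
    have AS: "A \<subseteq> S"
      using sigma_sets_into_sp[OF _ Compl.hyps] openin_subset by fastforce
    show ?case
    proof (intro bexI[of _ Z] exI[of _ \<delta>] conjI ballI impI)
      fix p q assume pq: "p \<in> S - A - Z" "q \<in> S" "dist p q < \<delta>"
      show "q \<in> (S - A) \<union> Z"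
      proof (rule ccontr)
        assume "\<not> ?thesis"
        then have "q \<in> A - Z" using pq by blast
        then have "p \<in> A \<union> Z"
          using Z(4)[of q p] pq by (simp add: dist_commute)
        then show False using pq by blast
      qed
    qed (use Z in auto)
  next
    case (Union A)
    have Am: "A i \<in> sets M" for i
      using Union.hyps by (simp add: sets sets_borel_of)
    let ?D = "\<lambda>n. (\<Union>i. A i) - (\<Union>i\<le>n. A i)"
    have dec: "decseq ?D"
      by (rule decseq_SucI) (auto simp: le_Suc_eq)
    have empty: "(\<Inter>n. ?D n) = {}" by auto
    have "(\<lambda>n. measure M (?D n)) \<longlonglongrightarrow> measure M (\<Inter>n. ?D n)"
      by (rule finite_Lim_measure_decseq) (use Am dec in auto)
    then have "(\<lambda>n. measure M (?D n)) \<longlonglongrightarrow> 0"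
      unfolding empty by simp
    then have "eventually (\<lambda>n. measure M (?D n) < \<epsilon> / 2) sequentially"
      by (rule order_tendstoD(2)) (use Union.prems in simp)
    then obtain n where n: "measure M (?D n) < \<epsilon> / 2"
      by (auto simp: eventually_sequentially)
    \<comment> \<open>Half of \<open>\<epsilon>\<close> goes to the tail of the union; the other
      half is divided among the \<open>Suc n\<close> sets up to index \<open>n\<close>.\<close>
    have "\<epsilon> / (2 * real (Suc n)) > 0" using Union.prems by simp
    then have "\<forall>i. \<exists>Z \<delta>. Z \<in> sets M \<and> \<delta> > 0 \<and> measure M Z < \<epsilon> / (2 * real (Suc n)) \<and>
        (\<forall>p\<in>A i - Z. \<forall>q\<in>S. dist p q < \<delta> \<longrightarrow> q \<in> A i \<union> Z)"
      using Union.IH by blast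
    then obtain Z \<delta> where Z: "\<And>i. Z i \<in> sets M" "\<And>i. \<delta> i > 0" "\<And>i. measure M (Z i) < \<epsilon> / (2 * real (Suc n))"
      "\<And>i p q. p \<in> A i - Z i \<Longrightarrow> q \<in> S \<Longrightarrow> dist p q < \<delta> i \<Longrightarrow> q \<in> A i \<union> Z i"
      by metis
    let ?Z = "?D n \<union> (\<Union>i\<le>n. Z i)"
    define d where "d = Min (\<delta> ` {..n})"
    have d: "d > 0" "\<And>i. i \<le> n \<Longrightarrow> d \<le> \<delta> i"
      using Z(2) by (auto simp: d_def)
    have "measure M (\<Union>i\<le>n. Z i) \<le> (\<Sum>i\<le>n. measure M (Z i))"
      by (rule finite_measure_subadditive_finite) (use Z in auto)
    also have "\<dots> \<le> (\<Sum>i\<le>n. \<epsilon> / (2 * real (Suc n)))"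
      by (intro sum_mono less_imp_le Z)
    also have "\<dots> = \<epsilon> / 2" by (simp add: field_simps)
    finally have half: "measure M (\<Union>i\<le>n. Z i) \<le> \<epsilon> / 2" .
    have Dn: "?D n \<in> sets M"
      by (intro sets.Diff sets.countable_UN sets.finite_UN) (use Am in auto)
    have Zn: "(\<Union>i\<le>n. Z i) \<in> sets M"
      by (intro sets.finite_UN) (use Z in auto)
    have Zs: "?Z \<in> sets M"
      using Dn Zn by (rule sets.Un)
    have mZ: "measure M ?Z < \<epsilon>"
    proof -
      have "measure M ?Z \<le> measure M (?D n) + measure M (\<Union>i\<le>n. Z i)"
        by (rule measure_Un_le[OF Dn Zn])
      also have "\<dots> < \<epsilon> / 2 + \<epsilon> / 2"
        by (rule add_less_le_mono[OF n half])
      finally show ?thesis by simp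
    qed
    have "q \<in> (\<Union>i. A i) \<union> ?Z" if "p \<in> (\<Union>i. A i) - ?Z" "q \<in> S" "dist p q < d" for p q
    proof -
      have "p \<in> (\<Union>i\<le>n. A i)" and nZ: "p \<notin> (\<Union>i\<le>n. Z i)"
        using that(1) by (metis DiffE UnCI DiffI)+
      then obtain i where i: "i \<le> n" "p \<in> A i" by (elim UN_E) simp
      then have "p \<in> A i - Z i" using nZ by simp
      have "dist p q < \<delta> i" using that(3) d(2)[OF i(1)] by linarith
      then have "q \<in> A i \<union> Z i" by (rule Z(4)[OF \<open>p \<in> A i - Z i\<close> that(2)])
      then show ?thesis using i(1) by auto
    qed
    then show ?case
      by (intro bexI[OF _ Zs] exI[of _ d] conjI d(1) mZ) auto
  qed
qed

text \<open>If no late return set had measure \<open>c\<close>, preimages of \<open>C\<close> at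
  widely spaced times would hardly overlap, and enough of them would exceed total measure one. What
  matters is the order of the quantifiers: \<open>c\<close> is fixed before
  \<open>N\<close>.\<close>

lemma (in prob_space) quantitative_recurrence:
  assumes T: "T \<in> measurable M M" "distr M M T = M" and C: "C \<in> sets M" "prob C > 0"
  shows "\<exists>c>0. \<forall>N. \<exists>n\<ge>N. n > 0 \<and> c \<le> prob {x \<in> C. (T ^^ n) x \<in> C}"
proof -
  have Tn: "T ^^ n \<in> measurable M M" for n
    by (induction n) (use T(1) in \<open>auto simp: measurable_ident_sets id_def intro: measurable_comp\<close>)
  have pres: "prob {x \<in> space M. (T ^^ n) x \<in> A} = prob A" if "A \<in> sets M" for A n
  proof (induction n)
    case 0
    have "{x \<in> space M. x \<in> A} = A" using sets.sets_into_space[OF that] by blast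
    then show ?case by simp
  next
    case (Suc n)
    let ?B = "{x \<in> space M. (T ^^ n) x \<in> A}"
    have "?B \<in> sets M" using Tn[of n] that by (auto simp: measurable_def vimage_def Int_def conj_commute)
    then have "prob ?B = prob (T -` ?B \<inter> space M)"
      using T measure_distr[of T M M ?B] by simp
    also have "T -` ?B \<inter> space M = {x \<in> space M. (T ^^ Suc n) x \<in> A}"
      using measurable_space[OF T(1)] by (auto simp: funpow_swap1)
    finally show ?case using Suc by simp
  qed
  define m where "m = prob C"
  \<comment> \<open>Take \<open>r\<close> preimages with \<open>r * m > 2\<close>. With overlaps of
    at most \<open>c\<close> each, the loss is at most \<open>r * r * c = 1 / 2\<close>, so the
    union would have measure above one.\<close>
  obtain r :: nat where r: "2 / m < real r" using reals_Archimedean2 by blast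
  have "2 / m > 0" using C by (simp add: m_def)
  then have r0: "real r > 0" using r by linarith
  have rm: "real r * m > 2" using r C by (simp add: m_def field_simps)
  define c where "c = 1 / (2 * real r * real r)"
  have c0: "c > 0" using r0 by (simp add: c_def)
  show ?thesis
  proof (intro exI[of _ c] conjI allI, rule c0)
    fix N0 :: nat
    \<comment> \<open>The spacing must be positive, so that the differences of the chosen times are
      admissible return times.\<close>
    define N where "N = Suc N0"
    show "\<exists>n\<ge>N0. n > 0 \<and> c \<le> prob {x \<in> C. (T ^^ n) x \<in> C}"
    proof (rule ccontr)
      assume "\<not> ?thesis"
      then have small: "prob {x \<in> C. (T ^^ n) x \<in> C} < c" if "n \<ge> N" for n
        using that unfolding N_def by (meson Suc_leD Suc_le_D not_le zero_less_Suc order_less_le_trans)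
      define A where "A k = {x \<in> space M. (T ^^ (k * N)) x \<in> C}" for k
      have Am: "A k \<in> sets M" for k
        unfolding A_def using Tn[of "k * N"] C(1) by (auto simp: measurable_def vimage_def Int_def conj_commute)
      have pA: "prob (A k) = m" for k
        unfolding A_def m_def by (rule pres[OF C(1)])
      have AA: "prob (A i \<inter> A k) \<le> c" if "i < k" for i k
      proof -
        let ?B = "{x \<in> C. (T ^^ ((k - i) * N)) x \<in> C}"
        have "?B = {x \<in> space M. (T ^^ ((k - i) * N)) x \<in> C} \<inter> C"
          using sets.sets_into_space[OF C(1)] by blast
        then have B: "?B \<in> sets M"
          using Tn[of "(k - i) * N"] C(1) by (auto simp: measurable_def vimage_def Int_def conj_commute)
        have "k * N = (k - i) * N + i * N"
          using that by (metis add_mult_distrib le_add_diff_inverse2 less_imp_le)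
        then have "(T ^^ (k * N)) x = (T ^^ ((k - i) * N)) ((T ^^ (i * N)) x)" for x
          by (simp add: funpow_add)
        then have "A i \<inter> A k = {x \<in> space M. (T ^^ (i * N)) x \<in> ?B}"
          unfolding A_def by auto
        then have "prob (A i \<inter> A k) = prob ?B"
          using pres[OF B] by simp
        moreover have "N \<le> (k - i) * N" using that by (simp add: Suc_leI)
        ultimately show ?thesis using small by fastforce
      qed
      have "real k * m - real k * (real r * c) \<le> prob (\<Union>i<k. A i)" if "k \<le> r" for k
        using that
      proof (induction k)
        case (Suc k)
        have "prob ((\<Union>i<k. A i) \<inter> A k) = prob (\<Union>i<k. A i \<inter> A k)"
          by (rule arg_cong[of _ _ prob]) auto
        also have "\<dots> \<le> (\<Sum>i<k. prob (A i \<inter> A k))"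
          by (rule finite_measure_subadditive_finite) (use Am in auto)
        also have "\<dots> \<le> (\<Sum>i<k. c)" by (intro sum_mono AA) auto
        also have "\<dots> \<le> real r * c" using Suc.prems c0 by simp
        finally have "prob ((\<Union>i<k. A i) \<inter> A k) \<le> real r * c" .
        moreover have "prob ((\<Union>i<k. A i) \<union> A k) = prob (\<Union>i<k. A i) + prob (A k) - prob ((\<Union>i<k. A i) \<inter> A k)"
          by (rule measure_Un3) (use Am in \<open>auto simp: fmeasurable_def emeasure_eq_measure\<close>)
        moreover have "(\<Union>i<Suc k. A i) = (\<Union>i<k. A i) \<union> A k" by (auto simp: less_Suc_eq)
        ultimately show ?case using Suc by (simp add: pA algebra_simps)
      qed simp
      from this[of r] have "real r * m - real r * (real r * c) \<le> 1"
        using prob_le_1 order_trans by blast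
      moreover have "real r * (real r * c) = 1 / 2"
        using r0 by (simp add: c_def)
      ultimately show False using rm by linarith
    qed
  qed
qed

text \<open>Over a point of \<open>Bad\<close> almost all of \<open>T\<close> lies in
  \<open>Z\<close>, so \<open>Bad \<times> T\<close> is in \<open>Z\<close> up to a null set, and
  \<open>Bad\<close> is small once \<open>Z\<close> is small against \<open>T\<close>. Null sections
  instead of empty ones keep \<open>Bad\<close> measurable, and a point off \<open>Bad\<close> still
  has a partner in \<open>T\<close> with the pair off \<open>Z\<close>.\<close>

lemma pair_measure_null_sections:
  assumes "finite_measure M1" "finite_measure M2"
    and Z: "Z \<in> sets (M1 \<Otimes>\<^sub>M M2)" and T: "T \<in> sets M2"
  defines "Bad \<equiv> {x \<in> space M1. emeasure M2 {y \<in> T. (x, y) \<notin> Z} = 0}"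
  shows "Bad \<in> sets M1" and "measure M1 Bad * measure M2 T \<le> measure (M1 \<Otimes>\<^sub>M M2) Z"
proof -
  interpret M1: finite_measure M1 by fact
  interpret M2: finite_measure M2 by fact
  interpret P: pair_sigma_finite M1 M2 ..
  interpret PF: finite_measure "M1 \<Otimes>\<^sub>M M2"
    by (intro finite_measure_pair_measure) unfold_locales
  let ?V = "space M1 \<times> T - Z"
  have TS: "T \<subseteq> space M2" using sets.sets_into_space[OF T] .
  have V: "?V \<in> sets (M1 \<Otimes>\<^sub>M M2)" using Z T by auto
  have sec: "Pair x -` ?V = {y \<in> T. (x, y) \<notin> Z}" if "x \<in> space M1" for x using that by auto
  have "(\<lambda>x. emeasure M2 (Pair x -` ?V)) \<in> borel_measurable M1"
    using M2.measurable_emeasure_Pair[OF V] .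
  then have "{x \<in> space M1. emeasure M2 (Pair x -` ?V) = 0} \<in> sets M1" by measurable
  moreover have "{x \<in> space M1. emeasure M2 (Pair x -` ?V) = 0} = Bad"
    unfolding Bad_def using sec by auto
  ultimately show Bad: "Bad \<in> sets M1" by simp
  have BT: "Bad \<times> T \<in> sets (M1 \<Otimes>\<^sub>M M2)" using Bad T by auto
  have "emeasure (M1 \<Otimes>\<^sub>M M2) (Bad \<times> T - Z) = (\<integral>\<^sup>+x. emeasure M2 (Pair x -` (Bad \<times> T - Z)) \<partial>M1)"
    by (rule M2.emeasure_pair_measure_alt) (use BT Z in auto)
  also have "\<dots> = (\<integral>\<^sup>+x. 0 \<partial>M1)"
  proof (rule nn_integral_cong)
    fix x assume "x \<in> space M1"
    show "emeasure M2 (Pair x -` (Bad \<times> T - Z)) = 0"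
    proof (cases "x \<in> Bad")
      case True
      then have "Pair x -` (Bad \<times> T - Z) = {y \<in> T. (x, y) \<notin> Z}" by auto
      then show ?thesis using True by (simp add: Bad_def)
    next
      case False
      then have "Pair x -` (Bad \<times> T - Z) = {}" by auto
      then show ?thesis by simp
    qed
  qed
  finally have null: "measure (M1 \<Otimes>\<^sub>M M2) (Bad \<times> T - Z) = 0"
    by (simp add: measure_def)
  have "measure M1 Bad * measure M2 T = measure (M1 \<Otimes>\<^sub>M M2) (Bad \<times> T)"
    using M2.emeasure_pair_measure_Times[OF Bad T] by (simp add: measure_def enn2real_mult)
  also have "\<dots> \<le> measure (M1 \<Otimes>\<^sub>M M2) (Z \<union> (Bad \<times> T - Z))"
    by (rule PF.finite_measure_mono) (use BT Z in auto)
  also have "\<dots> \<le> measure (M1 \<Otimes>\<^sub>M M2) Z + 0"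
    using measure_Un_le[of Z "M1 \<Otimes>\<^sub>M M2" "Bad \<times> T - Z"] BT Z null by simp
  finally show "measure M1 Bad * measure M2 T \<le> measure (M1 \<Otimes>\<^sub>M M2) Z" by simp
qed

lemma pair_measure_null_sections':
  assumes "finite_measure M1" "finite_measure M2"
    and Z: "Z \<in> sets (M1 \<Otimes>\<^sub>M M2)" and T: "T \<in> sets M1"
  defines "Bad \<equiv> {y \<in> space M2. emeasure M1 {x \<in> T. (x, y) \<notin> Z} = 0}"
  shows "Bad \<in> sets M2" and "measure M2 Bad * measure M1 T \<le> measure (M1 \<Otimes>\<^sub>M M2) Z"
proof -
  interpret M1: finite_measure M1 by fact
  interpret M2: finite_measure M2 by fact
  interpret P: pair_sigma_finite M1 M2 ..
  let ?sw = "\<lambda>(x, y). (y, x)"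
  let ?W = "?sw -` Z \<inter> space (M2 \<Otimes>\<^sub>M M1)"
  have W: "?W \<in> sets (M2 \<Otimes>\<^sub>M M1)" using Z measurable_pair_swap' by (rule measurable_sets[rotated])
  have TS: "T \<subseteq> space M1" using sets.sets_into_space[OF T] .
  have "(y, x) \<in> ?W \<longleftrightarrow> (x, y) \<in> Z" if "y \<in> space M2" "x \<in> T" for x y
    using that TS by (auto simp: space_pair_measure)
  then have eq: "{y \<in> space M2. emeasure M1 {x \<in> T. (y, x) \<notin> ?W} = 0} = Bad"
    unfolding Bad_def by (intro Collect_cong conj_cong refl arg_cong[where f = "\<lambda>A. emeasure M1 A = 0"]) auto
  have "measure (M1 \<Otimes>\<^sub>M M2) Z = measure (M2 \<Otimes>\<^sub>M M1) ?W"
    by (subst P.distr_pair_swap) (simp add: measure_distr measurable_pair_swap' Z)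
  then show "Bad \<in> sets M2" "measure M2 Bad * measure M1 T \<le> measure (M1 \<Otimes>\<^sub>M M2) Z"
    using pair_measure_null_sections[OF assms(2,1) W T] eq by simp_all
qed

lemma (in finite_borel_measure) equal_mass_intervals:
  assumes noatoms: "\<And>x. measure M {x} = 0" and pos: "measure M (space M) > 0"
  shows "\<exists>(t::nat \<Rightarrow> real) \<kappa>. \<kappa> > 0 \<and> (\<forall>k<n. t k < t (Suc k) \<and> measure M {t k<..<t (Suc k)} = \<kappa>)"
proof -
  let ?m = "measure M (space M)"
  \<comment> \<open>The levels stay strictly between \<open>0\<close> and the total mass, which the
    distribution function need not attain; hence the denominator \<open>n + 2\<close> for
    \<open>n + 1\<close> levels.\<close>
  define v where "v k = ?m * real (Suc k) / real (n + 2)" for k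
  have "\<exists>x. cdf M x = v k" if "k \<le> n" for k
  proof -
    have v: "0 < v k" "v k < ?m"
      using pos mult_strict_left_mono[of "real (Suc k) / real (n + 2)" 1 ?m] that
      by (simp_all add: v_def)
    have "eventually (\<lambda>x. cdf M x < v k) at_bot"
      using cdf_lim_at_bot v(1) by (rule order_tendstoD(2))
    then obtain a where a: "cdf M a < v k" by (auto simp: eventually_at_bot_linorder)
    have "eventually (\<lambda>x. cdf M x > v k) at_top"
      using cdf_lim_at_top v(2) by (rule order_tendstoD(1))
    then obtain b where b: "cdf M b > v k" by (auto simp: eventually_at_top_linorder)
    have "a \<le> b" using a b cdf_nondecreasing[of b a] by linarith
    moreover have "isCont (cdf M) x" for x using isCont_cdf noatoms by simp
    ultimately show ?thesis
      using IVT[of "cdf M" a "v k" b] a b by auto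
  qed
  then obtain t where t: "\<And>k. k \<le> n \<Longrightarrow> cdf M (t k) = v k" by metis
  define \<kappa> where "\<kappa> = ?m / real (n + 2)"
  have "\<kappa> > 0" using pos by (simp add: \<kappa>_def)
  moreover have "t k < t (Suc k) \<and> measure M {t k<..<t (Suc k)} = \<kappa>" if "k < n" for k
  proof -
    have d: "v (Suc k) - v k = \<kappa>"
      by (simp add: v_def \<kappa>_def diff_divide_distrib[symmetric] right_diff_distrib[symmetric])
    then have "cdf M (t k) < cdf M (t (Suc k))" using t that \<open>\<kappa> > 0\<close> by simp
    then have lt: "t k < t (Suc k)" using cdf_nondecreasing[of "t (Suc k)" "t k"] by (meson not_le less_le_not_le)
    have "measure M {t k<..t (Suc k)} = \<kappa>"
      using cdf_diff_eq[OF lt] t that d by simp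
    moreover have "{t k<..t (Suc k)} = {t k<..<t (Suc k)} \<union> {t (Suc k)}" using lt by auto
    moreover have "measure M ({t k<..<t (Suc k)} \<union> {t (Suc k)}) = measure M {t k<..<t (Suc k)} + measure M {t (Suc k)}"
      by (rule finite_measure_Union) auto
    ultimately show ?thesis using lt noatoms by simp
  qed
  ultimately show ?thesis by blast
qed

section \<open>Discs in the surface\<close>

lemma nonatomic_singleton:
  assumes "nonatomic M" "{x} \<in> sets M"
  shows "emeasure M {x} = 0"
proof (rule ccontr)
  assume "emeasure M {x} \<noteq> 0"
  then have "emeasure M {x} > 0" by (simp add: zero_less_iff_neq_zero)
  then obtain B where B: "B \<subseteq> {x}" "0 < emeasure M B" "emeasure M B < emeasure M {x}"
    using assms unfolding nonatomic_def by blast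
  then have "B = {} \<or> B = {x}" by blast
  with B show False by auto
qed

text \<open>The disc need not contain \<open>p\<close>: its center is pushed into the open half
  plane, which also covers boundary points of the surface. Concentric discs shrink to a point, which
  has measure zero, and this gives the bound \<open>\<eta>\<close>.\<close>

lemma small_disc:
  fixes S :: "'a::metric_space set"
  assumes S: "compact_surface S" and ou: "ou_measure (top_of_set S) B \<mu>" and fin: "finite_measure \<mu>"
    and p: "p \<in> S" and "\<epsilon> > 0" "\<eta> > 0"
  obtains U \<phi> \<psi> where "openin (top_of_set S) U" "U \<subseteq> ball p \<epsilon>" "measure \<mu> U < \<eta>"
    "homeomorphism (UNIV :: complex set) U \<phi> \<psi>"
proof -
  interpret finite_measure \<mu> by fact
  let ?H = "{z::complex. 0 \<le> Im z}"
  have sets: "sets \<mu> = sets (borel_of (top_of_set S))" and na: "nonatomic \<mu>"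
    using ou by (auto simp: ou_measure_def)
  obtain U1 V1 where U1: "openin (top_of_set S) U1" "p \<in> U1" and V1: "openin (top_of_set ?H) V1"
    and "U1 homeomorphic V1"
    using S p unfolding compact_surface_def by blast
  then obtain g h where gh: "homeomorphism U1 V1 g h"
    unfolding homeomorphic_def by blast
  have gcont: "continuous_on U1 g" and hcont: "continuous_on V1 h" and img: "g ` U1 = V1" "h ` V1 = U1"
    and inv: "\<And>x. x \<in> U1 \<Longrightarrow> h (g x) = x" "\<And>y. y \<in> V1 \<Longrightarrow> g (h y) = y"
    using gh by (auto simp: homeomorphism_def)
  have U1S: "U1 \<subseteq> S" using U1 openin_subset by fastforce
  have "openin (top_of_set U1) (U1 \<inter> ball p \<epsilon>)" by (auto simp: openin_open)
  then have "openin (top_of_set V1) (g ` (U1 \<inter> ball p \<epsilon>))"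
    using homeomorphism_imp_open_map[OF gh] by blast
  then have "openin (top_of_set ?H) (g ` (U1 \<inter> ball p \<epsilon>))"
    using V1 openin_trans by blast
  moreover have "g p \<in> g ` (U1 \<inter> ball p \<epsilon>)" using U1 \<open>\<epsilon> > 0\<close> by auto
  ultimately obtain e where e: "e > 0" "ball (g p) e \<inter> ?H \<subseteq> g ` (U1 \<inter> ball p \<epsilon>)" and gp: "0 \<le> Im (g p)"
    unfolding openin_contains_ball by blast
  define z where "z = g p + \<i> * of_real (e / 2)"
  have ball: "ball z (e / 2) \<subseteq> g ` (U1 \<inter> ball p \<epsilon>)"
  proof
    fix w assume w: "w \<in> ball z (e / 2)"
    have "dist (g p) z = e / 2" using e(1) by (simp add: z_def dist_norm norm_mult)
    then have "w \<in> ball (g p) e" using w dist_triangle[of "g p" w z] by simp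
    moreover have "\<bar>Im (w - z)\<bar> < e / 2"
      using w abs_Im_le_cmod[of "w - z"] by (simp add: dist_norm norm_minus_commute)
    then have "\<bar>Im w - (Im (g p) + e / 2)\<bar> < e / 2" by (simp add: z_def)
    then have "Im w \<ge> 0" using gp by linarith
    ultimately show "w \<in> g ` (U1 \<inter> ball p \<epsilon>)" using e(2) by blast
  qed
  then have ballV: "ball z (e / 2) \<subseteq> V1" using img by blast
  define W where "W k = h ` ball z (e / (2 * real (Suc k)))" for k
  have rad: "e / (2 * real (Suc k)) \<le> e / 2" "e / (2 * real (Suc k)) > 0" for k
    using e(1) by (auto simp: field_simps)
  have Wsub: "ball z (e / (2 * real (Suc k))) \<subseteq> ball z (e / 2)" for k
    by (rule subset_ball) (rule rad)
  have Wopen: "openin (top_of_set S) (W k)" for k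
  proof -
    have "openin (top_of_set V1) (ball z (e / (2 * real (Suc k))))"
      using ballV Wsub by (intro open_subset) blast+
    then have "openin (top_of_set U1) (W k)"
      unfolding W_def using homeomorphism_imp_open_map[of V1 U1 h g] gh homeomorphism_sym by blast
    then show ?thesis using U1 openin_trans by blast
  qed
  have Wm: "W k \<in> sets \<mu>" for k
    unfolding sets by (rule openin_in_borel_of[OF Wopen])
  have inj: "inj_on h V1" using inv(2) by (metis inj_onI)
  have zV: "z \<in> V1" using ballV e(1) by auto
  have empty: "(\<Inter>k. W k) = {h z}"
  proof (intro equalityI subsetI)
    fix x assume x: "x \<in> (\<Inter>k. W k)"
    then have gx: "g x \<in> ball z (e / (2 * real (Suc k)))" for k
      using inv(2) ballV Wsub unfolding W_def by fastforce
    have "dist z (g x) \<le> 0"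
    proof (rule ccontr)
      assume "\<not> ?thesis"
      then have "2 * dist z (g x) / e > 0" using e(1) by simp
      then obtain k where k: "1 / real (Suc k) < 2 * dist z (g x) / e" using nat_approx_posE by blast
      have "e / (2 * real (Suc k)) = e / 2 * (1 / real (Suc k))" by simp
      also have "\<dots> < e / 2 * (2 * dist z (g x) / e)" using k e(1) by (intro mult_strict_left_mono) auto
      also have "\<dots> = dist z (g x)" using e(1) by simp
      finally show False using gx[of k] by simp
    qed
    moreover obtain y where "y \<in> V1" "x = h y" using x[THEN INT_D, of 0] ballV Wsub[of 0] unfolding W_def by blast
    ultimately show "x \<in> {h z}" using inv(2) by simp
  qed (use rad(2) in \<open>auto simp: W_def simp del: of_nat_Suc intro!: imageI\<close>)
  have dec: "decseq W"
  proof (rule decseq_SucI)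
    fix k
    have "e / (2 * real (Suc (Suc k))) \<le> e / (2 * real (Suc k))" using e(1) by (intro divide_left_mono) auto
    then show "W (Suc k) \<subseteq> W k" unfolding W_def by (intro image_mono subset_ball)
  qed
  have "(\<lambda>k. measure \<mu> (W k)) \<longlonglongrightarrow> measure \<mu> (\<Inter>k. W k)"
    by (rule finite_Lim_measure_decseq) (use Wm dec in auto)
  moreover have "{h z} \<in> sets \<mu>"
    unfolding empty[symmetric] using Wm by auto
  then have "measure \<mu> {h z} = 0"
    using nonatomic_singleton[OF na] by (simp add: measure_def)
  ultimately have "(\<lambda>k. measure \<mu> (W k)) \<longlonglongrightarrow> 0" unfolding empty by simp
  then have "eventually (\<lambda>k. measure \<mu> (W k) < \<eta>) sequentially"
    by (rule order_tendstoD(2)) fact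
  then obtain k where k: "measure \<mu> (W k) < \<eta>" by (auto simp: eventually_sequentially)
  have "ball z (e / (2 * real (Suc k))) homeomorphic W k"
    unfolding W_def homeomorphic_def
    using homeomorphism_of_subsets[OF homeomorphism_symD[OF gh], of "ball z (e / (2 * real (Suc k)))"] ballV Wsub by blast
  moreover have "(UNIV :: complex set) homeomorphic ball z (e / (2 * real (Suc k)))"
    using homeomorphic_ball_UNIV[OF rad(2)] homeomorphic_sym by blast
  ultimately have "(UNIV :: complex set) homeomorphic W k" by (rule homeomorphic_trans[rotated])
  then obtain \<phi> \<psi> where "homeomorphism (UNIV :: complex set) (W k) \<phi> \<psi>"
    unfolding homeomorphic_def by blast
  moreover have "W k \<subseteq> ball p \<epsilon>"
  proof -
    have "W k \<subseteq> h ` g ` (U1 \<inter> ball p \<epsilon>)" unfolding W_def using ball Wsub by (intro image_mono) blast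
    also have "\<dots> \<subseteq> ball p \<epsilon>" using inv(1) by auto
    finally show ?thesis .
  qed
  ultimately show thesis using that[OF Wopen _ k] by blast
qed

lemma connected_subset_openin_cases:
  assumes "connected C" "openin (top_of_set S) A" "openin (top_of_set S) B" "C \<subseteq> A \<union> B" "A \<inter> B = {}"
  shows "C \<subseteq> A \<or> C \<subseteq> B"
proof -
  obtain A' B' where AB: "open A'" "open B'" "A = S \<inter> A'" "B = S \<inter> B'"
    using assms(2,3) by (auto simp: openin_open)
  have "C \<subseteq> S" using assms(4) AB by blast
  then have "A' \<inter> B' \<inter> C = {}" using assms(5) AB by blast
  moreover have "C \<subseteq> A' \<union> B'" using assms(4) AB by blast
  ultimately have "A' \<inter> C = {} \<or> B' \<inter> C = {}"
    using connectedD[OF assms(1) AB(1,2)] by blast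
  then show ?thesis using assms(4) AB by blast
qed

text \<open>The alternative to the conclusion is that \<open>f\<close> maps the inside of \<open>K\<close> onto the complement of
  the closed inside of \<open>K'\<close>, which has too large measure.\<close>

lemma image_of_inside:
  fixes S :: "'a::metric_space set" and K K' :: "complex set"
  assumes S: "compact S" "connected S" and sets: "sets \<mu> = sets (borel_of (top_of_set S))"
    and prob: "prob_space \<mu>" and f: "homeomorphism S S f g" and inv: "distr \<mu> \<mu> f = \<mu>"
    and U: "openin (top_of_set S) U" "measure \<mu> U < 1 / 2" and \<phi>: "homeomorphism UNIV U \<phi> \<psi>"
    and K: "compact (K \<union> inside K)" "closed K" "connected (inside K)" "inside K \<noteq> {}"
    and K': "compact (K' \<union> inside K')" "closed K'" "connected (outside K')" "K' \<noteq> {}"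
    and fK: "f ` \<phi> ` K = \<phi> ` K'"
  shows "f ` \<phi> ` (K \<union> inside K) \<subseteq> U"
proof -
  interpret prob_space \<mu> by fact
  have sp: "space \<mu> = S"
    using sets_eq_imp_space_eq[OF sets] by (simp add: space_borel_of)
  have US: "U \<subseteq> S" using U openin_subset by fastforce
  have \<phi>c: "continuous_on A \<phi>" for A
    using continuous_on_subset[OF homeomorphism_cont1[OF \<phi>] subset_UNIV] .
  have \<phi>i: "inj \<phi>" by (rule inj_on_inverseI[of _ \<psi>]) (rule homeomorphism_apply1[OF \<phi>])
  have \<phi>U: "range \<phi> = U" using \<phi> by (simp add: homeomorphism_def)
  have \<phi>o: "openin (top_of_set S) (\<phi> ` A)" if "open A" for A
  proof -
    have "openin (top_of_set U) (\<phi> ` A)"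
      using homeomorphism_imp_open_map[OF \<phi>, of A] that by simp
    then show ?thesis using U openin_trans by blast
  qed
  have fc: "continuous_on A f" if "A \<subseteq> S" for A
    using continuous_on_subset[OF homeomorphism_cont1[OF f] that] .
  have fS: "f ` S = S" using f by (simp add: homeomorphism_def)
  have fi: "inj_on f S" by (rule inj_on_inverseI[of _ g]) (rule homeomorphism_apply1[OF f])
  have fo: "openin (top_of_set S) (f ` A)" if "openin (top_of_set S) A" for A
    using homeomorphism_imp_open_map[OF f that] .
  define I I' J' O' Q where "I = \<phi> ` inside K" and "I' = \<phi> ` inside K'" and "J' = \<phi> ` K'"
    and "O' = \<phi> ` outside K'" and "Q = \<phi> ` (K \<union> inside K)"
  have QU: "Q \<subseteq> U" "I \<subseteq> Q" unfolding Q_def I_def using \<phi>U by auto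
  have fQ: "f ` Q = J' \<union> f ` I"
    unfolding Q_def I_def J'_def fK[symmetric] by (simp add: image_Un)
  have "K' \<union> inside K' \<union> outside K' = UNIV" by (simp add: inside_Un_outside Un_assoc)
  then have U_eq: "U = J' \<union> I' \<union> O'"
    unfolding J'_def I'_def O'_def \<phi>U[symmetric] by (simp add: image_Un[symmetric])
  have "K' \<inter> inside K' = {}" "K' \<inter> outside K' = {}" "inside K' \<inter> outside K' = {}"
    by (auto simp: inside_def outside_def)
  then have disj: "J' \<inter> I' = {}" "J' \<inter> O' = {}" "I' \<inter> O' = {}"
    unfolding J'_def I'_def O'_def by (simp_all add: image_Int[OF \<phi>i, symmetric])
  have fIJ: "f ` I \<inter> J' = {}"
  proof -
    have "f ` I \<inter> f ` \<phi> ` K = f ` (I \<inter> \<phi> ` K)"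
      using QU US \<phi>U by (intro inj_on_image_Int[OF fi, symmetric]) auto
    also have "I \<inter> \<phi> ` K = {}" unfolding I_def by (simp add: image_Int[OF \<phi>i, symmetric])
    finally show ?thesis using fK by (simp add: J'_def)
  qed
  have oI: "openin (top_of_set S) I" "openin (top_of_set S) I'" "openin (top_of_set S) O'"
    unfolding I_def I'_def O'_def using K K' by (auto intro!: \<phi>o simp: open_inside open_outside)
  have ofI: "openin (top_of_set S) (f ` I)" by (rule fo[OF oI(1)])
  have cQ': "closed (J' \<union> I')"
  proof -
    have "compact (\<phi> ` (K' \<union> inside K'))" by (intro compact_continuous_image \<phi>c K')
    then show ?thesis by (simp add: J'_def I'_def image_Un compact_imp_closed)
  qed
  have cfQ: "closed (f ` Q)"
    unfolding Q_def
    by (intro compact_imp_closed compact_continuous_image fc \<phi>c K) (use \<phi>U US in auto)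
  have ne: "J' \<noteq> {}" "I \<noteq> {}" using K K' by (auto simp: J'_def I_def)
  have JS: "J' \<subseteq> S" using US U_eq by blast
  have fIS: "f ` I \<subseteq> S" using QU US fS by blast
  have clopen: "T = {} \<or> T = S" if "openin (top_of_set S) T" "closedin (top_of_set S) T" for T
    using S(2) that unfolding connected_clopen by blast
  have oC: "openin (top_of_set S) (S - (J' \<union> I'))"
    using openin_diff[of "top_of_set S" S "J' \<union> I'"] cQ' closed_subset[of "J' \<union> I'" S] US U_eq by auto
  have "f ` I \<subseteq> I' \<or> f ` I \<subseteq> S - (J' \<union> I')"
  proof (rule connected_subset_openin_cases)
    show "connected (f ` I)"
      unfolding I_def by (intro connected_continuous_image fc \<phi>c K) (use \<phi>U US in auto)
  qed (use oI oC fIJ fIS in auto)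
  moreover have False if out: "f ` I \<subseteq> S - (J' \<union> I')"
  proof -
    \<comment> \<open>What remains of the surface besides the closed inside of \<open>K'\<close> and
      the image of the closed inside of \<open>K\<close>. The connected set \<open>O'\<close> lies
      either in the image of \<open>I\<close> or in \<open>E\<close>.\<close>
    define E where "E = S - (J' \<union> I') - f ` Q"
    have E_eq: "E = S - (J' \<union> I' \<union> f ` I)" unfolding E_def fQ by blast
    have oE: "openin (top_of_set S) E"
      unfolding E_def using openin_diff[OF oC, of "f ` Q"] cfQ closed_subset[of "f ` Q" S] fQ JS fIS by auto
    have "O' \<subseteq> f ` I \<or> O' \<subseteq> E"
    proof (rule connected_subset_openin_cases)
      show "connected O'" unfolding O'_def by (intro connected_continuous_image \<phi>c K')
      show "O' \<subseteq> f ` I \<union> E" unfolding E_eq using disj U_eq US by blast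
      show "f ` I \<inter> E = {}" unfolding E_eq by blast
    qed (use ofI oE in auto)
    then show False
    proof
      \<comment> \<open>The image of \<open>I\<close> then avoids the disc altogether, so it equals
        the part of the compact image of \<open>Q\<close> off \<open>U\<close> and is open and
        closed in \<open>S\<close>.\<close>
      assume "O' \<subseteq> E"
      then have "f ` I \<inter> U = {}" using out U_eq unfolding E_eq by blast
      then have "f ` I = f ` Q - U" using fQ U_eq by blast
      then have "f ` I = f ` Q \<inter> (S - U)" using fIS by blast
      moreover have "closedin (top_of_set S) (f ` Q \<inter> (S - U))"
        using cfQ closed_subset[of "f ` Q" S] fQ JS fIS U(1) by (intro closedin_Int) auto
      ultimately have "f ` I = {} \<or> f ` I = S" using clopen[OF ofI] by simp
      then show False using ne JS fIJ by blast
    next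
      assume O: "O' \<subseteq> f ` I"
      \<comment> \<open>Now \<open>E\<close> is open and closed, hence empty: \<open>S\<close> is
        covered by the disc and the image of \<open>I\<close>, two sets of measure below
        \<open>1 / 2\<close>.\<close>
      then have "E = S - (U \<union> f ` I)" unfolding E_eq U_eq by blast
      then have "closedin (top_of_set S) E" using U(1) ofI by auto
      then have "E = {}" using clopen[OF oE] JS ne unfolding E_eq by blast
      then have SU: "S \<subseteq> U \<union> f ` I" unfolding E_eq U_eq by blast
      have m: "U \<in> sets \<mu>" "I \<in> sets \<mu>" "f ` I \<in> sets \<mu>"
        unfolding sets using U oI ofI by (auto intro: openin_in_borel_of)
      have meas: "f \<in> measurable \<mu> \<mu>"
        using measurable_borel_of[OF sets, of "top_of_set S" f] f sets
        by (auto simp: homeomorphism_def cong: measurable_cong_sets)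
      have "measure \<mu> (f ` I) = measure \<mu> (f -` f ` I \<inter> space \<mu>)"
        using inv measure_distr[OF meas m(3)] by simp
      also have "f -` f ` I \<inter> space \<mu> = I"
        using fi QU US unfolding sp inj_on_def by blast
      also have "measure \<mu> I \<le> measure \<mu> U"
        using QU m by (intro finite_measure_mono) auto
      finally have "measure \<mu> (f ` I) < 1 / 2" using U(2) by simp
      moreover have "measure \<mu> S \<le> measure \<mu> (U \<union> f ` I)"
        using SU m by (intro finite_measure_mono) auto
      ultimately show False
        using measure_Un_le[OF m(1,3)] U(2) prob_space sp by simp
    qed
  qed
  ultimately have "f ` I \<subseteq> U" using U_eq by blast
  then show ?thesis using fQ U_eq unfolding Q_def by blast
qed

section \<open>Streamlines\<close>

lemma line_paramD:
  assumes "line_param L h"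
  shows "continuous_map euclideanreal L h" "inj h" "range h = topspace L"
    "p \<in> topspace L \<Longrightarrow> h (inv h p) = p" "inv h (h t) = t" "continuous_map L euclideanreal (inv h)"
proof -
  show 1: "continuous_map euclideanreal L h" "inj h" and 2: "range h = topspace L"
    using assms homeomorphic_imp_continuous_map homeomorphic_imp_injective_map homeomorphic_imp_surjective_map
    by (metis topspace_euclidean)+
  show "p \<in> topspace L \<Longrightarrow> h (inv h p) = p" using 2 by (metis f_inv_into_f)
  show "inv h (h t) = t" using 1 by simp
  obtain g where g: "homeomorphic_maps euclideanreal L h g"
    using assms homeomorphic_map_maps by blast
  have "continuous_map L euclideanreal g" using g by (simp add: homeomorphic_maps_def)
  moreover have "g x = inv h x" if "x \<in> topspace L" for x
  proof -
    have "h (g x) = x" using g that by (simp add: homeomorphic_maps_def)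
    then show ?thesis using 1 by (metis inv_f_f)
  qed
  ultimately show "continuous_map L euclideanreal (inv h)"
    by (rule continuous_map_eq) auto
qed

lemma immersed_line_param: "immersed_line S L \<Longrightarrow> \<exists>h. line_param L h"
  unfolding immersed_line_def
  using homeomorphic_space_sym homeomorphic_space by metis

lemma immersed_line_subset: "immersed_line S L \<Longrightarrow> topspace L \<subseteq> S"
  unfolding immersed_line_def using continuous_map_image_subset_topspace by fastforce

lemma immersed_line_continuous:
  assumes "immersed_line S L" "line_param L h"
  shows "continuous_on UNIV h"
proof -
  have "continuous_map euclideanreal (top_of_set S) ((\<lambda>x. x) \<circ> h)"
    using assms line_paramD(1) unfolding immersed_line_def by (intro continuous_map_compose) auto
  then show ?thesis
    by (simp add: continuous_map_in_subtopology o_def)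
qed

definition arc_between :: "'a topology \<Rightarrow> 'a \<Rightarrow> 'a \<Rightarrow> 'a set" where
  "arc_between L p q = (let h = SOME h. line_param L h in h ` closed_segment (inv h p) (inv h q))"

text \<open>Two parametrizations of a line differ by a continuous injection of the real line, which
  carries segments to segments; so the choice made in \<open>arc_between\<close> is
  immaterial.\<close>

lemma arc_between_eq:
  assumes h: "line_param L h" and pq: "p \<in> topspace L" "q \<in> topspace L"
  shows "arc_between L p q = h ` closed_segment (inv h p) (inv h q)"
proof -
  define k where "k = (SOME h. line_param L h)"
  have k: "line_param L k" unfolding k_def using someI[of "line_param L" h] h by simp
  note H = line_paramD[OF h] and K = line_paramD[OF k]
  let ?t = "inv h \<circ> k"
  have "continuous_map euclideanreal euclideanreal ?t"
    using H(6) K(1) by (rule continuous_map_compose[rotated])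
  then have "continuous_on UNIV ?t" by simp
  moreover have hk: "h (?t x) = k x" for x using H(4)[of "k x"] K(3) by auto
  have "inj ?t"
  proof (rule injI)
    fix x y assume "?t x = ?t y"
    then have "h (?t x) = h (?t y)" by (rule arg_cong)
    then show "x = y" unfolding hk using K(2) by (simp only: inj_eq)
  qed
  ultimately have "?t ` closed_segment (inv k p) (inv k q) = closed_segment (?t (inv k p)) (?t (inv k q))"
    by (intro continuous_injective_image_segment_1) (auto intro: continuous_on_subset inj_on_subset)
  also have "\<dots> = closed_segment (inv h p) (inv h q)" using K(4) pq by simp
  finally have "h ` closed_segment (inv h p) (inv h q) = h ` ?t ` closed_segment (inv k p) (inv k q)" by simp
  also have "\<dots> = k ` closed_segment (inv k p) (inv k q)" unfolding image_image using hk by simp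
  finally show ?thesis by (simp add: arc_between_def k_def[symmetric])
qed

lemma mem_arc_between_iff:
  assumes "line_param L h" "p \<in> topspace L" "q \<in> topspace L" "x \<in> topspace L"
  shows "x \<in> arc_between L p q \<longleftrightarrow> inv h x \<in> closed_segment (inv h p) (inv h q)"
  unfolding arc_between_eq[OF assms(1-3)]
  using line_paramD(4,5)[OF assms(1)] assms(4) by (metis image_iff)

lemma line_param_compose: "line_param L h \<Longrightarrow> homeomorphic_map L L' f \<Longrightarrow> line_param L' (f \<circ> h)"
  by (rule homeomorphic_map_compose)

lemma image_arc_between:
  assumes h: "line_param L h" and f: "homeomorphic_map L L' f" and pq: "p \<in> topspace L" "q \<in> topspace L"
  shows "f ` arc_between L p q = arc_between L' (f p) (f q)"
proof -
  have k: "line_param L' (f \<circ> h)" using line_param_compose[OF h f] .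
  have "inv (f \<circ> h) (f x) = inv h x" if "x \<in> topspace L" for x
    using line_paramD(5)[OF k, of "inv h x"] line_paramD(4)[OF h that] by simp
  moreover have "f p \<in> topspace L'" "f q \<in> topspace L'"
    using f pq homeomorphic_imp_surjective_map by blast+
  ultimately show ?thesis
    using arc_between_eq[OF h pq] arc_between_eq[OF k] pq by (simp add: image_comp)
qed

lemma param_image_in_sets:
  assumes h: "line_param L h" and N: "sets N = sets (borel_of L)" and I: "I \<in> sets borel"
  shows "h ` I \<in> sets N"
proof -
  note H = line_paramD[OF h]
  have sp: "space N = topspace L" using sets_eq_imp_space_eq[OF N] by (simp add: space_borel_of)
  have "inv h \<in> measurable N (borel_of euclidean)"
    by (rule measurable_borel_of[OF N H(6)])
  then have "inv h -` I \<inter> space N \<in> sets N"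
    by (rule measurable_sets) (simp add: sets_borel_of_euclidean I)
  moreover have "inv h -` I \<inter> space N = h ` I"
    using H(3,4,5) by (force simp: sp)
  ultimately show ?thesis by simp
qed

lemma arc_between_in_sets:
  assumes "line_param L h" "sets N = sets (borel_of L)" "p \<in> topspace L" "q \<in> topspace L"
  shows "arc_between L p q \<in> sets N"
  unfolding arc_between_eq[OF assms(1,3,4)] by (rule param_image_in_sets[OF assms(1,2)]) auto

lemma stream_arcD:
  assumes "stream_arc L A"
  shows "A \<subseteq> topspace L" "A \<noteq> {}" "\<And>p q. p \<in> A \<Longrightarrow> q \<in> A \<Longrightarrow> arc_between L p q \<subseteq> A"
    "sets N = sets (borel_of L) \<Longrightarrow> A \<in> sets N"
proof -
  obtain h I where h: "line_param L h" and A: "A = h ` I" and I: "convex I" "I \<in> sets borel" "I \<noteq> {}"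
  proof -
    obtain h a b where "line_param L h" "a < b" and
      "A = h ` {a..b} \<or> A = h ` {a<..b} \<or> A = h ` {a..<b} \<or> A = h ` {a<..<b}"
      using assms unfolding stream_arc_def by blast
    then show thesis
      using that[of h "{a..b}"] that[of h "{a<..b}"] that[of h "{a..<b}"] that[of h "{a<..<b}"] by auto
  qed
  note H = line_paramD[OF h]
  show sub: "A \<subseteq> topspace L" using A H(3) by blast
  show "A \<noteq> {}" using A I by simp
  show "sets N = sets (borel_of L) \<Longrightarrow> A \<in> sets N"
    unfolding A by (rule param_image_in_sets[OF h _ I(2)])
  fix p q assume pq: "p \<in> A" "q \<in> A"
  then have "inv h p \<in> I" "inv h q \<in> I" using A H(5) by auto
  then have "closed_segment (inv h p) (inv h q) \<subseteq> I" by (rule closed_segment_subset[OF _ _ I(1)])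
  then show "arc_between L p q \<subseteq> A"
    using arc_between_eq[OF h] pq sub A by (metis image_mono subsetD)
qed

section \<open>Streamlines under a map that scales stream measure\<close>

lemma measured_turbulationD:
  assumes "measured_turbulation S \<mu> T" "(L, N) \<in> T"
  shows "immersed_line S L" "sets N = sets (borel_of L)" "nonatomic N" "topspace L \<subseteq> S"
proof -
  have "\<forall>(L, N)\<in>T. immersed_line S L \<and> ou_measure L {} N \<and>
      (\<forall>h a b. line_param L h \<and> a < b \<longrightarrow> emeasure N (h ` {a..b}) < \<infinity>)"
    using assms(1) unfolding measured_turbulation_def by (rule conjunct1)
  from bspec[OF this assms(2)] have *: "immersed_line S L" "ou_measure L {} N" by simp_all
  then show "immersed_line S L" "sets N = sets (borel_of L)" "nonatomic N"
    by (simp_all add: ou_measure_def)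
  show "topspace L \<subseteq> S" by (rule immersed_line_subset[OF *(1)])
qed

lemma measured_turbulation_unique:
  assumes "measured_turbulation S \<mu> T" "(L, N) \<in> T" "(L', N') \<in> T" "x \<in> topspace L" "x \<in> topspace L'"
  shows "L = L' \<and> N = N'"
proof (rule ccontr)
  assume ne: "\<not> ?thesis"
  have pw: "pairwise (\<lambda>(L, N) (L', N'). disjnt (topspace L) (topspace L')) T"
    using assms(1) by (simp add: measured_turbulation_def)
  from pairwiseD[OF pw assms(2,3)] ne have "disjnt (topspace L) (topspace L')" by simp
  then show False using assms(4,5) by (simp add: disjnt_iff)
qed

text \<open>The factor stands with the measure of the image, so \<open>c > 1\<close> means that
  \<open>f\<close> contracts. This agrees with the equation
  \<open>image_turbulation F T = scale_turbulation c T\<close>.\<close>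

definition scales :: "real \<Rightarrow> ('a \<Rightarrow> 'a) \<Rightarrow> 'a topology \<times> 'a measure \<Rightarrow> 'a topology \<times> 'a measure \<Rightarrow> bool" where
  "scales c f = (\<lambda>(L, N) (L', N'). homeomorphic_map L L' f \<and>
     (\<forall>A\<in>sets N. f ` A \<in> sets N' \<and> emeasure N A = ennreal c * emeasure N' (f ` A)))"

text \<open>The second half, that every streamline is an image, is what lets
  \<open>acts_inverse\<close> pass to the inverse map.\<close>

definition acts :: "real \<Rightarrow> ('a \<Rightarrow> 'a) \<Rightarrow> 'a turbulation \<Rightarrow> bool" where
  "acts c f T \<longleftrightarrow> (\<forall>l\<in>T. \<exists>l'\<in>T. scales c f l l') \<and> (\<forall>l'\<in>T. \<exists>l\<in>T. scales c f l l')"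

lemma homeomorphic_image_in_borel_of:
  assumes f: "homeomorphic_map L L' f" and N: "sets N = sets (borel_of L)" and A: "A \<in> sets N"
  shows "f ` A \<in> sets (borel_of L')"
proof -
  obtain g where g: "homeomorphic_maps L L' f g" using f homeomorphic_map_maps by blast
  then have "g \<in> measurable (borel_of L') (borel_of L)"
    by (intro measurable_borel_of) (auto simp: homeomorphic_maps_def)
  then have "g -` A \<inter> space (borel_of L') \<in> sets (borel_of L')"
    using A N by (auto intro: measurable_sets)
  moreover have "A \<subseteq> topspace L"
    using sets.sets_into_space[OF A] sets_eq_imp_space_eq[OF N] by (simp add: space_borel_of)
  have "g -` A \<inter> space (borel_of L') = f ` A"
  proof (intro equalityI subsetI)
    fix x assume "x \<in> g -` A \<inter> space (borel_of L')"
    then have "g x \<in> A" "f (g x) = x" using g by (auto simp: space_borel_of homeomorphic_maps_def)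
    then show "x \<in> f ` A" by (metis imageI)
  next
    fix x assume "x \<in> f ` A"
    then obtain a where a: "a \<in> A" "x = f a" by blast
    then have "a \<in> topspace L" using \<open>A \<subseteq> topspace L\<close> by blast
    then have "g x = a" "x \<in> topspace L'"
      using g a homeomorphic_imp_surjective_map[OF f] by (auto simp: homeomorphic_maps_def)
    then show "x \<in> g -` A \<inter> space (borel_of L')" using a by (simp add: space_borel_of)
  qed
  ultimately show ?thesis by simp
qed

lemma acts_of_image_turbulation:
  assumes eq: "image_turbulation F T = scale_turbulation c T" and inj: "inj_on F S"
    and T: "measured_turbulation S \<mu> T"
  shows "acts c F T"
proof -
  have key: "scales c F (L, N) (L', N')"
    if "(L, N) \<in> T" "(L', N') \<in> T" "image_topology F L = L'"
      "distr N (borel_of (image_topology F L)) F = scale_measure (ennreal c) N'" for L N L' N'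
  proof -
    note N = measured_turbulationD(2)[OF T that(1)] measured_turbulationD(2)[OF T that(2)]
      and LS = measured_turbulationD(4)[OF T that(1)]
    have hm: "homeomorphic_map L L' F"
      using homeomorphic_map_image_topology[of F L] inj_on_subset[OF inj LS] that by simp
    have sp: "space N = topspace L" using sets_eq_imp_space_eq[OF N(1)] by (simp add: space_borel_of)
    have Fm: "F \<in> measurable N (borel_of L')"
      by (rule measurable_borel_of[OF N(1)]) (rule homeomorphic_imp_continuous_map[OF hm])
    have "F ` A \<in> sets N' \<and> emeasure N A = ennreal c * emeasure N' (F ` A)" if A: "A \<in> sets N" for A
    proof -
      have FA: "F ` A \<in> sets (borel_of L')" by (rule homeomorphic_image_in_borel_of[OF hm N(1) A])
      have "A \<subseteq> topspace L" using sets.sets_into_space[OF A] sp by simp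
      then have "F -` F ` A \<inter> space N = A"
        using inj_on_subset[OF inj LS] unfolding sp inj_on_def by blast
      then have "emeasure N A = emeasure (distr N (borel_of L') F) (F ` A)"
        using emeasure_distr[OF Fm FA] by simp
      also have "\<dots> = ennreal c * emeasure N' (F ` A)"
        using \<open>image_topology F L = L'\<close> \<open>distr N (borel_of (image_topology F L)) F = scale_measure (ennreal c) N'\<close>
        by simp
      finally show ?thesis using FA N by simp
    qed
    then show ?thesis using hm by (simp add: scales_def)
  qed
  show ?thesis
    unfolding acts_def
  proof (intro conjI ballI)
    fix l assume l: "l \<in> T"
    obtain L N where LN: "l = (L, N)" by (cases l)
    have "(image_topology F L, distr N (borel_of (image_topology F L)) F) \<in> scale_turbulation c T"
      unfolding eq[symmetric] image_turbulation_def using l LN by force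
    then obtain L' N' where "(L', N') \<in> T" "image_topology F L = L'"
      "distr N (borel_of (image_topology F L)) F = scale_measure (ennreal c) N'"
      unfolding scale_turbulation_def by auto
    then show "\<exists>l'\<in>T. scales c F l l'" using key l LN by blast
  next
    fix l' assume l: "l' \<in> T"
    obtain L' N' where LN: "l' = (L', N')" by (cases l')
    have "(L', scale_measure (ennreal c) N') \<in> image_turbulation F T"
      unfolding eq scale_turbulation_def using l LN by force
    then obtain L N where "(L, N) \<in> T" "image_topology F L = L'"
      "distr N (borel_of (image_topology F L)) F = scale_measure (ennreal c) N'"
      unfolding image_turbulation_def by auto
    then show "\<exists>l\<in>T. scales c F l l'" using key l LN by blast
  qed
qed

lemma scales_compose:
  assumes "scales c f l l'" "scales d g l' l''" "c \<ge> 0" "d \<ge> 0"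
  shows "scales (c * d) (g \<circ> f) l l''"
proof -
  obtain L N L' N' L'' N'' where l: "l = (L, N)" "l' = (L', N')" "l'' = (L'', N'')"
    by (metis surj_pair)
  have "homeomorphic_map L L'' (g \<circ> f)"
    using assms l homeomorphic_map_compose by (auto simp: scales_def)
  moreover have "(g \<circ> f) ` A \<in> sets N'' \<and> emeasure N A = ennreal (c * d) * emeasure N'' ((g \<circ> f) ` A)"
    if "A \<in> sets N" for A
  proof -
    have e: "(g \<circ> f) ` A = g ` f ` A" by (simp add: image_comp)
    show ?thesis
      using assms l that unfolding e by (simp add: scales_def ennreal_mult mult.assoc)
  qed
  ultimately show ?thesis by (simp add: scales_def l)
qed

lemma acts_funpow:
  assumes "acts c f T" "c \<ge> 0"
  shows "acts (c ^ n) (f ^^ n) T"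
proof (induction n)
  case 0
  have "scales 1 id l l" for l :: "'a topology \<times> 'a measure"
    by (cases l) (simp add: scales_def)
  then show ?case by (auto simp: acts_def id_def)
next
  case (Suc n)
  have "scales (c ^ n * c) (f \<circ> f ^^ n) l l''" if "scales (c ^ n) (f ^^ n) l l'" "scales c f l' l''" for l l' l''
    using scales_compose[OF that] assms(2) by simp
  then show ?case
    using Suc assms(1) unfolding acts_def funpow.simps power_Suc2 by meson
qed

lemma acts_inverse:
  assumes a: "acts c f T" and c: "c > 0" and g: "\<And>x. x \<in> S \<Longrightarrow> g (f x) = x"
    and T: "measured_turbulation S \<mu> T"
  shows "acts (1 / c) g T"
proof -
  have "scales (1 / c) g l' l" if l: "l \<in> T" "l' \<in> T" "scales c f l l'" for l l'
  proof -
    obtain L N L' N' where eq: "l = (L, N)" "l' = (L', N')" by (metis surj_pair)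
    note N = measured_turbulationD(2)[OF T l(1)[unfolded eq]] measured_turbulationD(2)[OF T l(2)[unfolded eq]]
      and LS = measured_turbulationD(4)[OF T l(1)[unfolded eq]]
    have f: "homeomorphic_map L L' f" using l eq by (simp add: scales_def)
    then obtain g' where g': "homeomorphic_maps L L' f g'" using homeomorphic_map_maps by blast
    then have "homeomorphic_map L' L g'"
      using homeomorphic_maps_sym homeomorphic_map_maps by blast
    moreover have "g' y = g y" if "y \<in> topspace L'" for y
    proof -
      have "g' y \<in> topspace L" "f (g' y) = y"
        using g' that by (auto simp: homeomorphic_maps_def continuous_map_def)
      then show ?thesis using g[of "g' y"] LS by auto
    qed
    ultimately have hm: "homeomorphic_map L' L g"
      using homeomorphic_map_eq by blast
    have "g ` B \<in> sets N \<and> emeasure N' B = ennreal (1 / c) * emeasure N (g ` B)" if B: "B \<in> sets N'" for B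
    proof -
      have gB: "g ` B \<in> sets N"
        using homeomorphic_image_in_borel_of[OF hm N(2) B] N by simp
      have BL: "B \<subseteq> topspace L'"
        using sets.sets_into_space[OF B] sets_eq_imp_space_eq[OF N(2)] by (simp add: space_borel_of)
      have "f (g y) = y" if "y \<in> topspace L'" for y
      proof -
        have "y \<in> f ` topspace L" using homeomorphic_imp_surjective_map[OF f] that by simp
        then show ?thesis using g LS by auto
      qed
      then have "f ` g ` B = B" using BL by force
      then have "emeasure N (g ` B) = ennreal c * emeasure N' B"
        using l(3) eq gB by (auto simp: scales_def)
      then have "ennreal (1 / c) * emeasure N (g ` B) = ennreal (1 / c * c) * emeasure N' B"
        using c by (subst ennreal_mult) (auto simp: mult.assoc)
      then show ?thesis using gB c by simp
    qed
    then show ?thesis using hm by (simp add: scales_def eq)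
  qed
  then show ?thesis using a unfolding acts_def by meson
qed

lemma tame_arc_between:
  assumes "tame T" "\<epsilon> > 0" and T: "measured_turbulation S \<mu> T"
  shows "\<exists>\<delta>>0. \<forall>(L, N)\<in>T. \<forall>p\<in>topspace L. \<forall>q\<in>topspace L.
    emeasure N (arc_between L p q) < ennreal \<delta> \<longrightarrow> dist p q < \<epsilon>"
proof -
  obtain \<delta> where \<delta>: "\<delta> > 0" and close: "\<And>L N h a b. (L, N) \<in> T \<Longrightarrow> line_param L h \<Longrightarrow> a < b \<Longrightarrow>
      emeasure N (h ` {a..b}) < ennreal \<delta> \<Longrightarrow> dist (h a) (h b) < \<epsilon>"
    using assms(1,2) unfolding tame_def by (smt (verit) case_prodD)
  have "dist p q < \<epsilon>" if LN: "(L, N) \<in> T" and pq: "p \<in> topspace L" "q \<in> topspace L"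
    and small: "emeasure N (arc_between L p q) < ennreal \<delta>" for L N p q
  proof -
    obtain h where h: "line_param L h" using immersed_line_param measured_turbulationD(1)[OF T LN] by blast
    note H = line_paramD[OF h]
    have e: "arc_between L p q = h ` closed_segment (inv h p) (inv h q)" by (rule arc_between_eq[OF h pq])
    consider "inv h p < inv h q" | "inv h q < inv h p" | "inv h p = inv h q" by linarith
    then show ?thesis
    proof cases
      case 1
      then show ?thesis
        using close[OF LN h 1] small e H(4)[OF pq(1)] H(4)[OF pq(2)] by (simp add: closed_segment_eq_real_ivl)
    next
      case 2
      then show ?thesis
        using close[OF LN h 2] small e H(4)[OF pq(1)] H(4)[OF pq(2)]
        by (simp add: closed_segment_eq_real_ivl dist_commute)
    next
      case 3
      then have "p = q" using H(4) pq by metis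
      then show ?thesis using \<open>\<epsilon> > 0\<close> by simp
    qed
  qed
  then show ?thesis using \<delta> by blast
qed

section \<open>Fibers of a tartan\<close>

text \<open>One direction of a tartan: \<open>fs\<close> are the fibers under study and
  \<open>gs\<close> those of the other direction. Both directions are instances, with
  \<open>fs\<close> and \<open>gs\<close> exchanged.\<close>

locale fiber_family =
  fixes S :: "'a::metric_space set" and \<mu> :: "'a measure" and T :: "'a turbulation"
    and fs gs :: "'a set set"
  assumes turb: "measured_turbulation S \<mu> T"
    and fib: "fibers \<mu> T fs" and ord: "cross_in_same_order T fs gs" and bdd: "bounded_arcs T fs"
    and gs_disj: "pairwise disjnt gs"
    and meet: "\<And>A B. A \<in> fs \<Longrightarrow> B \<in> gs \<Longrightarrow> \<exists>x. A \<inter> B = {x}"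
    and ne: "fs \<noteq> {}" "gs \<noteq> {}"
begin

text \<open>The choice here and in \<open>smeas\<close> is harmless: by \<open>arc_of_unique\<close>
  a fiber determines its streamline and its stream measure.\<close>

definition line :: "'a set \<Rightarrow> 'a topology" where
  "line A = (SOME L. \<exists>N. arc_of T L N A)"

definition smeas :: "'a set \<Rightarrow> 'a measure" where
  "smeas A = (SOME N. arc_of T (line A) N A)"

definition oriented :: "('a set \<Rightarrow> real \<Rightarrow> 'a) \<Rightarrow> bool" where
  "oriented h \<longleftrightarrow> ((\<forall>A\<in>fs. \<exists>L N. arc_of T L N A \<and> line_param L (h A)) \<and>
     (\<forall>A\<in>fs. \<forall>A'\<in>fs. \<forall>B\<in>gs. \<forall>B'\<in>gs.
        inv (h A) (cross_point A B) < inv (h A) (cross_point A B') \<longleftrightarrow>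
        inv (h A') (cross_point A' B) < inv (h A') (cross_point A' B')))"

definition par :: "'a set \<Rightarrow> real \<Rightarrow> 'a" where "par = (SOME h. oriented h)"

definition base :: "'a set" where "base = (SOME A. A \<in> fs)"

text \<open>The common order in which the fibers of \<open>fs\<close> cross those of
  \<open>gs\<close>, turned into real numbers by reading it off along one fiber.\<close>

definition key :: "'a set \<Rightarrow> real" where "key B = inv (par base) (cross_point base B)"

definition X :: "'a set" where "X = \<Union>fs \<inter> \<Union>gs"

definition K :: real where
  "K = (SOME K. K > 0 \<and> (\<forall>A\<in>fs. \<forall>L N. arc_of T L N A \<longrightarrow> emeasure N A \<le> ennreal K))"

abbreviation own :: "'a \<Rightarrow> 'a set" where "own \<equiv> fiber_through fs"
abbreviation other :: "'a \<Rightarrow> 'a set" where "other \<equiv> fiber_through gs"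

lemma base: "base \<in> fs" unfolding base_def using ne(1) by (simp add: some_in_eq)

lemma arc_of_line: assumes "A \<in> fs" shows "arc_of T (line A) (smeas A) A"
proof -
  have "\<exists>L N. arc_of T L N A" using fib assms by (simp add: fibers_def)
  then have "\<exists>N. arc_of T (line A) N A" unfolding line_def by (rule someI_ex)
  then show ?thesis unfolding smeas_def by (rule someI_ex)
qed

lemma line_smeas:
  assumes "A \<in> fs"
  shows "(line A, smeas A) \<in> T" "stream_arc (line A) A" "A \<subseteq> topspace (line A)" "A \<noteq> {}"
    "A \<in> sets (smeas A)" "sets (smeas A) = sets (borel_of (line A))" "nonatomic (smeas A)"
    "space (smeas A) = topspace (line A)"
proof -
  show 1: "(line A, smeas A) \<in> T" "stream_arc (line A) A"
    using arc_of_line[OF assms] by (simp_all add: arc_of_def)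
  show "A \<subseteq> topspace (line A)" "A \<noteq> {}" by (rule stream_arcD[OF 1(2)])+
  show s: "sets (smeas A) = sets (borel_of (line A))" "nonatomic (smeas A)"
    using measured_turbulationD[OF turb 1(1)] by simp_all
  show "A \<in> sets (smeas A)" by (rule stream_arcD(4)[OF 1(2) s(1)])
  show "space (smeas A) = topspace (line A)"
    using sets_eq_imp_space_eq[OF s(1)] by (simp add: space_borel_of)
qed

lemma line_unique:
  assumes "A \<in> fs" "(L, N) \<in> T" "x \<in> A" "x \<in> topspace L"
  shows "L = line A" "N = smeas A"
  using measured_turbulation_unique[OF turb assms(2) line_smeas(1)[OF assms(1)] assms(4)]
    line_smeas(3)[OF assms(1)] assms(3) by auto

lemma arc_of_unique:
  assumes "A \<in> fs" "arc_of T L N A" shows "L = line A" "N = smeas A"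
proof -
  obtain x where "x \<in> A" using line_smeas(4)[OF assms(1)] by blast
  moreover have "(L, N) \<in> T" "A \<subseteq> topspace L"
    using assms(2) stream_arcD(1) by (auto simp: arc_of_def)
  ultimately show "L = line A" "N = smeas A" using line_unique[OF assms(1)] by blast+
qed

lemma oriented_par: "oriented par"
proof -
  have "\<exists>h. oriented h" using ord unfolding cross_in_same_order_def oriented_def .
  then show ?thesis unfolding par_def by (rule someI_ex)
qed

lemma par: assumes "A \<in> fs" shows "line_param (line A) (par A)"
proof -
  obtain L N where "arc_of T L N A" "line_param L (par A)" using oriented_par assms unfolding oriented_def by blast
  then show ?thesis using arc_of_unique[OF assms] by simp
qed

lemmas parD = line_paramD[OF par]

lemma cross_order:
  assumes "A \<in> fs" "B \<in> gs" "B' \<in> gs"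
  shows "inv (par A) (cross_point A B) < inv (par A) (cross_point A B') \<longleftrightarrow> key B < key B'"
  using oriented_par assms base unfolding key_def oriented_def by blast

lemma cross: assumes "A \<in> fs" "B \<in> gs" shows "A \<inter> B = {cross_point A B}"
proof -
  obtain x where "A \<inter> B = {x}" using meet[OF assms] by blast
  then show ?thesis by (simp add: cross_point_def)
qed

lemma fs_disj: "pairwise disjnt fs" using fib by (simp add: fibers_def)

lemma ownI: assumes "A \<in> fs" "x \<in> A" shows "own x = A"
  unfolding fiber_through_def
proof (rule the_equality)
  fix A' assume A': "A' \<in> fs \<and> x \<in> A'"
  show "A' = A"
  proof (rule ccontr)
    assume "A' \<noteq> A"
    then have "disjnt A' A" using fs_disj A' assms(1) by (simp add: pairwise_def)
    then show False using A' assms(2) by (simp add: disjnt_iff)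
  qed
qed (use assms in simp)

lemma otherI: assumes "B \<in> gs" "x \<in> B" shows "other x = B"
  unfolding fiber_through_def
proof (rule the_equality)
  fix A' assume A': "A' \<in> gs \<and> x \<in> A'"
  show "A' = B"
  proof (rule ccontr)
    assume "A' \<noteq> B"
    then have "disjnt A' B" using gs_disj A' assms(1) by (simp add: pairwise_def)
    then show False using A' assms(2) by (simp add: disjnt_iff)
  qed
qed (use assms in simp)

lemma XD:
  assumes "z \<in> X"
  shows "own z \<in> fs" "z \<in> own z" "other z \<in> gs" "z \<in> other z" "cross_point (own z) (other z) = z"
proof -
  obtain A B where AB: "A \<in> fs" "z \<in> A" "B \<in> gs" "z \<in> B" using assms by (auto simp: X_def)
  then have "own z = A" "other z = B" by (simp_all add: ownI otherI)
  with AB show m: "own z \<in> fs" "z \<in> own z" "other z \<in> gs" "z \<in> other z" by simp_all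
  have "z \<in> own z \<inter> other z" using m by blast
  then have "z \<in> {cross_point (own z) (other z)}" unfolding cross[OF m(1,3)] .
  then show "cross_point (own z) (other z) = z" by simp
qed

lemma cross_in_X:
  assumes "A \<in> fs" "B \<in> gs"
  shows "cross_point A B \<in> X" "cross_point A B \<in> A" "cross_point A B \<in> B"
    "own (cross_point A B) = A" "other (cross_point A B) = B"
proof -
  show 1: "cross_point A B \<in> A" "cross_point A B \<in> B" using cross[OF assms] by blast+
  then show "cross_point A B \<in> X" "own (cross_point A B) = A" "other (cross_point A B) = B"
    using assms ownI otherI by (auto simp: X_def)
qed

lemma X_eqI: "z \<in> X \<Longrightarrow> w \<in> X \<Longrightarrow> own z = own w \<Longrightarrow> other z = other w \<Longrightarrow> z = w"
  using XD(5) by metis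

lemma par_less_iff:
  assumes "A \<in> fs" "z \<in> X" "w \<in> X" "own z = A" "own w = A"
  shows "inv (par A) z < inv (par A) w \<longleftrightarrow> key (other z) < key (other w)"
  using cross_order[OF assms(1) XD(3)[OF assms(2)] XD(3)[OF assms(3)]] XD(5)[OF assms(2)] XD(5)[OF assms(3)] assms
  by simp

lemma key_inj:
  assumes "B \<in> gs" "B' \<in> gs" "key B = key B'" shows "B = B'"
proof -
  have "cross_point base B \<in> topspace (line base)" "cross_point base B' \<in> topspace (line base)"
    using cross_in_X(2)[OF base] line_smeas(3)[OF base] assms by blast+
  then have "cross_point base B = cross_point base B'"
    using assms(3) parD(4)[OF base] unfolding key_def by metis
  then show ?thesis using cross_in_X(5)[OF base] assms by metis
qed

lemma mem_arc_iff:
  assumes "A \<in> fs" "x \<in> X" "z \<in> X" "w \<in> X" "own x = A" "own z = A" "own w = A"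
  shows "x \<in> arc_between (line A) z w \<longleftrightarrow> key (other x) \<in> closed_segment (key (other z)) (key (other w))"
proof -
  have t: "x \<in> topspace (line A)" "z \<in> topspace (line A)" "w \<in> topspace (line A)"
    using XD(2) line_smeas(3)[OF assms(1)] assms by blast+
  have "inv (par A) x \<le> inv (par A) z \<longleftrightarrow> key (other x) \<le> key (other z)" "inv (par A) z \<le> inv (par A) x \<longleftrightarrow> key (other z) \<le> key (other x)"
    "inv (par A) x \<le> inv (par A) w \<longleftrightarrow> key (other x) \<le> key (other w)" "inv (par A) w \<le> inv (par A) x \<longleftrightarrow> key (other w) \<le> key (other x)"
    using par_less_iff[OF assms(1)] assms by (simp_all add: not_less[symmetric])
  then show ?thesis
    unfolding mem_arc_between_iff[OF par[OF assms(1)] t(2,3,1)] by (auto simp: closed_segment_eq_real_ivl)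
qed

lemma K: "K > 0" "\<And>A. A \<in> fs \<Longrightarrow> emeasure (smeas A) A \<le> ennreal K"
proof -
  obtain K0 where K0: "\<And>A L N. A \<in> fs \<Longrightarrow> arc_of T L N A \<Longrightarrow> emeasure N A \<le> ennreal K0"
    using bdd unfolding bounded_arcs_def by blast
  have "ennreal K0 \<le> ennreal (max K0 1)" by (intro ennreal_leI) simp
  then have "max K0 1 > 0 \<and> (\<forall>A\<in>fs. \<forall>L N. arc_of T L N A \<longrightarrow> emeasure N A \<le> ennreal (max K0 1))"
    using order_trans[OF K0] by simp
  then have "\<exists>K. K > 0 \<and> (\<forall>A\<in>fs. \<forall>L N. arc_of T L N A \<longrightarrow> emeasure N A \<le> ennreal K)"
    by (rule exI)
  then have "K > 0 \<and> (\<forall>A\<in>fs. \<forall>L N. arc_of T L N A \<longrightarrow> emeasure N A \<le> ennreal K)"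
    unfolding K_def by (rule someI_ex)
  then show "K > 0" "\<And>A. A \<in> fs \<Longrightarrow> emeasure (smeas A) A \<le> ennreal K" using arc_of_line by metis+
qed

section \<open>Fibers under a strongly contracting map\<close>

lemma arc_le_K:
  assumes "A \<in> fs" "p \<in> A" "q \<in> A"
  shows "emeasure (smeas A) (arc_between (line A) p q) \<le> ennreal K"
proof -
  have "arc_between (line A) p q \<subseteq> A" by (rule stream_arcD(3)[OF line_smeas(2)[OF assms(1)] assms(2,3)])
  then have "emeasure (smeas A) (arc_between (line A) p q) \<le> emeasure (smeas A) A"
    by (rule emeasure_mono) (rule line_smeas(5)[OF assms(1)])
  then show ?thesis using K(2)[OF assms(1)] by (rule order_trans)
qed

text \<open>To leave the fiber \<open>A\<close> from \<open>p\<close>, an arc must run over all of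
  \<open>A\<close> on one side of \<open>p\<close>, hence over \<open>W1\<close> or
  \<open>W2\<close>. An arc lighter than both these guards therefore stays in
  \<open>A\<close>.\<close>

lemma margin:
  assumes A: "A \<in> fs" and p: "p \<in> X" "own p = A" and q: "q \<in> topspace (line A)"
    and W: "W1 \<subseteq> A \<inter> X" "W2 \<subseteq> A \<inter> X"
      "\<And>w. w \<in> W1 \<Longrightarrow> key (other w) < key (other p)" "\<And>w. w \<in> W2 \<Longrightarrow> key (other p) < key (other w)"
    and m: "m \<le> emeasure (smeas A) W1" "m \<le> emeasure (smeas A) W2"
    and small: "emeasure (smeas A) (arc_between (line A) p q) < m"
  shows "q \<in> A"
proof (rule ccontr)
  assume nq: "q \<notin> A"
  let ?i = "inv (par A)"
  have pA: "p \<in> A" "p \<in> topspace (line A)" using XD(2)[OF p(1)] p(2) line_smeas(3)[OF A] by auto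
  have meas: "arc_between (line A) p q \<in> sets (smeas A)"
    by (rule arc_between_in_sets[OF par[OF A] line_smeas(6)[OF A] pA(2) q])
  have not_sub: "\<not> W \<subseteq> arc_between (line A) p q" if "m \<le> emeasure (smeas A) W" for W
    using small that emeasure_mono[OF _ meas, of W] by (meson leD order_trans)
  have outside: "\<not> (?i q \<in> closed_segment (?i p) (?i w))" if w: "w \<in> A" for w
  proof
    assume "?i q \<in> closed_segment (?i p) (?i w)"
    then have "q \<in> arc_between (line A) p w"
      using mem_arc_between_iff[OF par[OF A] pA(2) _ q] w line_smeas(3)[OF A] by blast
    then show False using stream_arcD(3)[OF line_smeas(2)[OF A] pA(1) w] nq by blast
  qed
  have less: "?i w < ?i p" if w: "w \<in> W1" for w
  proof -
    have "w \<in> X" "own w = A" using w W(1) ownI[OF A] by blast+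
    then show ?thesis using par_less_iff[OF A _ p(1) _ p(2)] W(3)[OF w] by simp
  qed
  have more: "?i p < ?i w" if w: "w \<in> W2" for w
  proof -
    have "w \<in> X" "own w = A" using w W(2) ownI[OF A] by blast+
    then show ?thesis using par_less_iff[OF A p(1) _ p(2)] W(4)[OF w] by simp
  qed
  have top: "w \<in> topspace (line A)" if "w \<in> A" for w using that line_smeas(3)[OF A] by blast
  show False
  proof (cases "?i q \<le> ?i p")
    case True
    have "W1 \<subseteq> arc_between (line A) p q"
    proof
      fix w assume w: "w \<in> W1"
      then have wA: "w \<in> A" using W by blast
      have "?i q \<le> ?i w" using outside[OF wA] less[OF w] True by (simp add: closed_segment_eq_real_ivl split: if_splits)
      then show "w \<in> arc_between (line A) p q"
        using less[OF w] mem_arc_between_iff[OF par[OF A] pA(2) q top[OF wA]] by (simp add: closed_segment_eq_real_ivl)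
    qed
    then show False using not_sub m by blast
  next
    case False
    have "W2 \<subseteq> arc_between (line A) p q"
    proof
      fix w assume w: "w \<in> W2"
      then have wA: "w \<in> A" using W by blast
      have "?i w \<le> ?i q" using outside[OF wA] more[OF w] False by (simp add: closed_segment_eq_real_ivl split: if_splits)
      then show "w \<in> arc_between (line A) p q"
        using more[OF w] mem_arc_between_iff[OF par[OF A] pA(2) q top[OF wA]] by (simp add: closed_segment_eq_real_ivl)
    qed
    then show False using not_sub m by blast
  qed
qed

lemma scales_line:
  assumes f: "acts c f T" and A: "A \<in> fs"
  shows "\<exists>L' N'. (L', N') \<in> T \<and> homeomorphic_map (line A) L' f \<and>
    (\<forall>p\<in>A. \<forall>q\<in>A. f p \<in> topspace L' \<and> f q \<in> topspace L' \<and>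
      ennreal c * emeasure N' (arc_between L' (f p) (f q)) \<le> ennreal K)"
proof -
  obtain L' N' where l: "(L', N') \<in> T" "scales c f (line A, smeas A) (L', N')"
    using f line_smeas(1)[OF A] unfolding acts_def by fastforce
  then have hm: "homeomorphic_map (line A) L' f" by (simp add: scales_def)
  moreover have "f p \<in> topspace L' \<and> f q \<in> topspace L' \<and>
      ennreal c * emeasure N' (arc_between L' (f p) (f q)) \<le> ennreal K" if pq: "p \<in> A" "q \<in> A" for p q
  proof -
    have t: "p \<in> topspace (line A)" "q \<in> topspace (line A)" using pq line_smeas(3)[OF A] by blast+
    have "arc_between (line A) p q \<in> sets (smeas A)"
      by (rule arc_between_in_sets[OF par[OF A] line_smeas(6)[OF A] t])
    then have "ennreal c * emeasure N' (f ` arc_between (line A) p q) = emeasure (smeas A) (arc_between (line A) p q)"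
      using l(2) by (simp add: scales_def)
    then show ?thesis
      using image_arc_between[OF par[OF A] hm t] arc_le_K[OF A pq] t homeomorphic_imp_surjective_map[OF hm] by auto
  qed
  ultimately show ?thesis using l(1) by blast
qed

text \<open>The image of a fiber has stream measure at most \<open>K / c\<close>, which is less than
  the measure of the guards on both sides of \<open>f z\<close>; so \<open>margin\<close>
  applies.\<close>

lemma image_in_own:
  assumes f: "acts c f T" and c: "K < c * m" "c > 0" and z: "z \<in> X" "f z \<in> X" and z': "z' \<in> own z"
    and W: "W1 \<subseteq> own (f z) \<inter> X" "W2 \<subseteq> own (f z) \<inter> X"
      "\<And>w. w \<in> W1 \<Longrightarrow> key (other w) < key (other (f z))" "\<And>w. w \<in> W2 \<Longrightarrow> key (other (f z)) < key (other w)"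
      "ennreal m \<le> emeasure (smeas (own (f z))) W1" "ennreal m \<le> emeasure (smeas (own (f z))) W2"
  shows "f z' \<in> own (f z)"
proof -
  obtain L' N' where L': "(L', N') \<in> T" "homeomorphic_map (line (own z)) L' f"
    "\<forall>p\<in>own z. \<forall>q\<in>own z. f p \<in> topspace L' \<and> f q \<in> topspace L' \<and>
      ennreal c * emeasure N' (arc_between L' (f p) (f q)) \<le> ennreal K"
    using scales_line[OF f XD(1)[OF z(1)]] by blast
  note l = L'(3)[rule_format, OF XD(2)[OF z(1)] z']
  have eq: "L' = line (own (f z))" "N' = smeas (own (f z))"
    using line_unique[OF XD(1)[OF z(2)] L'(1) XD(2)[OF z(2)]] l by simp_all
  let ?e = "emeasure N' (arc_between L' (f z) (f z'))"
  have "?e < ennreal m"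
  proof (rule ccontr)
    assume "\<not> ?thesis"
    then have "ennreal c * ennreal m \<le> ennreal c * ?e" by (intro mult_left_mono) auto
    also have "\<dots> \<le> ennreal K" using l by blast
    finally have "ennreal (c * m) \<le> ennreal K" using c by (simp add: ennreal_mult')
    then show False using c K(1) by (simp add: ennreal_le_iff)
  qed
  then have small: "emeasure (smeas (own (f z))) (arc_between (line (own (f z))) (f z) (f z')) < ennreal m"
    by (simp only: eq)
  have "f z' \<in> topspace L'"
    using l by (rule conjunct1[OF conjunct2])
  then have top: "f z' \<in> topspace (line (own (f z)))"
    by (simp only: eq)
  show ?thesis
    by (rule margin[OF XD(1)[OF z(2)] z(2) refl top W small])
qed

text \<open>The images span an arc of stream measure at most \<open>K / c\<close>, which lies below
  the threshold of tameness.\<close>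

lemma images_close:
  assumes f: "acts c f T" and c: "K < c * \<delta>" "c > 0" and A: "A \<in> fs" "z \<in> A" "z' \<in> A"
    and tm: "\<forall>(L, N)\<in>T. \<forall>p\<in>topspace L. \<forall>q\<in>topspace L. emeasure N (arc_between L p q) < ennreal \<delta> \<longrightarrow> dist p q < \<epsilon>"
  shows "dist (f z) (f z') < \<epsilon>"
proof -
  obtain L' N' where L': "(L', N') \<in> T" "homeomorphic_map (line A) L' f"
    "\<forall>p\<in>A. \<forall>q\<in>A. f p \<in> topspace L' \<and> f q \<in> topspace L' \<and>
      ennreal c * emeasure N' (arc_between L' (f p) (f q)) \<le> ennreal K"
    using scales_line[OF f A(1)] by blast
  note l = L'(3)[rule_format, OF A(2,3)]
  have "emeasure N' (arc_between L' (f z) (f z')) < ennreal \<delta>"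
  proof (rule ccontr)
    assume "\<not> ?thesis"
    then have "ennreal c * ennreal \<delta> \<le> ennreal c * emeasure N' (arc_between L' (f z) (f z'))" by (intro mult_left_mono) auto
    also have "\<dots> \<le> ennreal K" using l by blast
    finally have "ennreal (c * \<delta>) \<le> ennreal K" using c by (simp add: ennreal_mult')
    then show False using c K(1) by (simp add: ennreal_le_iff)
  qed
  moreover have "\<forall>p\<in>topspace L'. \<forall>q\<in>topspace L'. emeasure N' (arc_between L' p q) < ennreal \<delta> \<longrightarrow> dist p q < \<epsilon>"
    using bspec[OF tm L'(1)] by simp
  ultimately show ?thesis using l by blast
qed

text \<open>\<open>f\<close> maps arcs of streamlines to arcs of streamlines.\<close>

lemma between_image:
  assumes f: "acts c f T" and z: "x \<in> X" "z \<in> X" "w \<in> X" "own x = A" "own z = A" "own w = A"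
    and fz: "f z \<in> X" "f w \<in> X" "own (f z) = A'" "own (f w) = A'"
    and x: "key (other x) \<in> closed_segment (key (other z)) (key (other w))"
  shows "f x \<in> A'" and "f x \<in> X \<Longrightarrow> key (other (f x)) \<in> closed_segment (key (other (f z))) (key (other (f w)))"
proof -
  have A: "A \<in> fs" using XD(1) z by blast
  have A': "A' \<in> fs" using XD(1) fz by blast
  have mem: "x \<in> A" "z \<in> A" "w \<in> A" "f z \<in> A'" "f w \<in> A'" using XD(2) z fz by blast+
  obtain L' N' where L': "(L', N') \<in> T" "homeomorphic_map (line A) L' f"
    "\<forall>p\<in>A. \<forall>q\<in>A. f p \<in> topspace L' \<and> f q \<in> topspace L' \<and>
      ennreal c * emeasure N' (arc_between L' (f p) (f q)) \<le> ennreal K"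
    using scales_line[OF f A] by blast
  have eq: "L' = line A'" using line_unique[OF A' L'(1) mem(4)] L'(3) mem by blast
  have "x \<in> arc_between (line A) z w" using mem_arc_iff[OF A z] x by blast
  then have "f x \<in> f ` arc_between (line A) z w" by (rule imageI)
  then have arc: "f x \<in> arc_between (line A') (f z) (f w)"
    using image_arc_between[OF par[OF A] L'(2)] mem line_smeas(3)[OF A] eq by blast
  then show fx: "f x \<in> A'"
    using stream_arcD(3)[OF line_smeas(2)[OF A'] mem(4,5)] by blast
  assume X: "f x \<in> X"
  then have "own (f x) = A'" using ownI[OF A' fx] by simp
  then show "key (other (f x)) \<in> closed_segment (key (other (f z))) (key (other (f w)))"
    using mem_arc_iff[OF A' X fz(1,2)] fz arc by blast
qed

lemma image_arc:
  assumes f: "acts c f T" and z: "z \<in> X" "w \<in> X" "own z = A" "own w = A"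
    and fz: "f z \<in> X" "own (f z) = A'"
  shows "f ` arc_between (line A) z w = arc_between (line A') (f z) (f w)"
proof -
  have A: "A \<in> fs" "A' \<in> fs" using XD(1) z fz by blast+
  have mem: "z \<in> A" "w \<in> A" "f z \<in> A'" using XD(2) z fz by blast+
  obtain L' N' where L': "(L', N') \<in> T" "homeomorphic_map (line A) L' f"
    "\<forall>p\<in>A. \<forall>q\<in>A. f p \<in> topspace L' \<and> f q \<in> topspace L' \<and>
      ennreal c * emeasure N' (arc_between L' (f p) (f q)) \<le> ennreal K"
    using scales_line[OF f A(1)] by blast
  have "L' = line A'" using line_unique[OF A(2) L'(1) mem(3)] L'(3) mem by blast
  then show ?thesis
    using image_arc_between[OF par[OF A(1)] L'(2)] mem line_smeas(3)[OF A(1)] by blast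
qed

text \<open>A strip of the tartan: the crossing points on those fibers of the other direction whose
  key is in \<open>I\<close>.\<close>

definition cset :: "real set \<Rightarrow> 'a set" where "cset I = {z \<in> X. key (other z) \<in> I}"

lemma borel_sets_on_line:
  assumes sets_mu: "sets \<mu> = sets (borel_of (top_of_set S))" and "A \<in> fs" "B \<in> sets \<mu>"
  shows "A \<inter> B \<in> sets (smeas A)"
proof -
  have "immersed_line S (line A)" by (rule measured_turbulationD(1)[OF turb line_smeas(1)[OF assms(2)]])
  then have "continuous_map (line A) (top_of_set S) (\<lambda>x. x)" by (simp add: immersed_line_def)
  then have "(\<lambda>x. x) \<in> measurable (smeas A) (borel_of (top_of_set S))"
    by (rule measurable_borel_of[OF line_smeas(6)[OF assms(2)]])
  then have "(\<lambda>x. x) -` B \<inter> space (smeas A) \<in> sets (smeas A)"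
    by (rule measurable_sets) (use assms(3) sets_mu in simp)
  moreover have "A \<inter> B = A \<inter> ((\<lambda>x. x) -` B \<inter> space (smeas A))"
    using line_smeas(3,8)[OF assms(2)] by auto
  ultimately show ?thesis using line_smeas(5)[OF assms(2)] by simp
qed

lemma inv_par_base_iff: assumes "z \<in> base" shows "inv (par base) z \<in> I \<longleftrightarrow> z \<in> par base ` I"
proof
  assume "inv (par base) z \<in> I"
  then have "par base (inv (par base) z) \<in> par base ` I" by (rule imageI)
  then show "z \<in> par base ` I" using parD(4)[OF base] line_smeas(3)[OF base] assms by auto
qed (use parD(5)[OF base] in auto)

lemma base_cset: "base \<inter> cset I = base \<inter> X \<inter> par base ` I"
proof -
  have "key (other z) = inv (par base) z" if z: "z \<in> base" "z \<in> X" for z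
  proof -
    have "own z = base" by (rule ownI[OF base z(1)])
    then have "cross_point base (other z) = z" using XD(5)[OF z(2)] by simp
    then show ?thesis by (simp add: key_def)
  qed
  then have "z \<in> base \<inter> cset I \<longleftrightarrow> z \<in> base \<inter> X \<inter> par base ` I" for z
    using inv_par_base_iff[of z I] by (cases "z \<in> base"; cases "z \<in> X") (auto simp: cset_def)
  then show ?thesis by blast
qed

lemma base_cset_in_sets:
  assumes "sets \<mu> = sets (borel_of (top_of_set S))" "X \<in> sets \<mu>" "I \<in> sets borel"
  shows "base \<inter> cset I \<in> sets (smeas base)"
  unfolding base_cset
  by (intro sets.Int borel_sets_on_line[OF assms(1) base assms(2)] param_image_in_sets[OF par[OF base] line_smeas(6)[OF base] assms(3)])

text \<open>The parametrization of the base fiber pushes its stream measure, restricted to crossing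
  points, to a measure on the line without atoms, which is then cut into intervals of equal
  mass.\<close>

lemma equal_mass_csets:
  assumes mu: "sets \<mu> = sets (borel_of (top_of_set S))" "X \<in> sets \<mu>" and pos: "emeasure (smeas base) (base \<inter> X) > 0"
  shows "\<exists>(t::nat \<Rightarrow> real) \<kappa>. \<kappa> > 0 \<and> (\<forall>k<n. t k < t (Suc k) \<and>
    emeasure (smeas base) (base \<inter> cset {t k<..<t (Suc k)}) = ennreal \<kappa>)"
proof -
  let ?N = "smeas base"
  have BX: "base \<inter> X \<in> sets ?N" by (rule borel_sets_on_line[OF mu(1) base mu(2)])
  have fin: "emeasure ?N (base \<inter> X) \<noteq> \<infinity>"
  proof -
    have "emeasure ?N (base \<inter> X) \<le> emeasure ?N base" by (intro emeasure_mono line_smeas(5) base) auto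
    also have "\<dots> \<le> ennreal K" by (rule K(2)[OF base])
    finally show ?thesis by (auto simp: top_unique)
  qed
  define M where "M = restrict_space ?N (base \<inter> X)"
  have spM: "space M = base \<inter> X"
    using sets.sets_into_space[OF BX] by (simp add: M_def space_restrict_space Int_absorb2)
  have eM: "emeasure M A = emeasure ?N A" if "A \<subseteq> base \<inter> X" for A
    unfolding M_def by (rule emeasure_restrict_space) (use BX that in auto)
  interpret M: finite_measure M
    by (rule finite_measureI) (use eM fin spM in simp)
  have "inv (par base) \<in> measurable ?N (borel_of euclidean)"
    by (rule measurable_borel_of[OF line_smeas(6)[OF base] parD(6)[OF base]])
  then have "inv (par base) \<in> borel_measurable ?N"
    by (simp cong: measurable_cong_sets add: sets_borel_of_euclidean)
  then have meas: "inv (par base) \<in> borel_measurable M"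
    unfolding M_def by (rule measurable_restrict_space1)
  define D where "D = distr M borel (inv (par base))"
  interpret D: finite_measure D unfolding D_def by (rule M.finite_measure_distr[OF meas])
  interpret D: finite_borel_measure D by unfold_locales (simp add: D_def)
  have eD: "emeasure D I = emeasure ?N (base \<inter> cset I)" if I: "I \<in> sets borel" for I
  proof -
    have eq: "inv (par base) -` I \<inter> space M = base \<inter> cset I"
    proof (rule set_eqI)
      fix z show "z \<in> inv (par base) -` I \<inter> space M \<longleftrightarrow> z \<in> base \<inter> cset I"
        unfolding base_cset spM using inv_par_base_iff[of z I] by (cases "z \<in> base"; cases "z \<in> X") simp_all
    qed
    have "base \<inter> cset I \<subseteq> base \<inter> X" by (auto simp: cset_def)
    from eM[OF this] show ?thesis
      unfolding D_def emeasure_distr[OF meas I] eq .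
  qed
  have "measure D {r} = 0" for r
  proof -
    have "base \<inter> cset {r} \<subseteq> {par base r}" by (auto simp: base_cset)
    moreover have "{par base r} \<in> sets ?N"
      using param_image_in_sets[OF par[OF base] line_smeas(6)[OF base], of "{r}"] by simp
    moreover have "emeasure ?N {par base r} = 0"
      by (rule nonatomic_singleton[OF line_smeas(7)[OF base]]) fact
    ultimately have "emeasure ?N (base \<inter> cset {r}) = 0"
      using emeasure_mono[of "base \<inter> cset {r}" "{par base r}" ?N] by simp
    then show ?thesis using eD[of "{r}"] by (simp add: measure_def)
  qed
  moreover have "measure D (space D) > 0"
  proof -
    have "cset UNIV = X" by (simp add: cset_def)
    then have "emeasure D UNIV = emeasure ?N (base \<inter> X)" using eD[of UNIV] by simp
    moreover have "space D = UNIV" by (simp add: D_def)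
    ultimately show ?thesis using pos D.emeasure_eq_measure[of UNIV] by (simp add: ennreal_less_zero_iff[symmetric])
  qed
  ultimately obtain t \<kappa> where t: "\<kappa> > 0" "\<And>k. k < n \<Longrightarrow> t k < t (Suc k) \<and> measure D {t k<..<t (Suc k)} = \<kappa>"
    using D.equal_mass_intervals[of n] by blast
  have "emeasure ?N (base \<inter> cset {t k<..<t (Suc k)}) = ennreal \<kappa>" if "k < n" for k
    using eD[of "{t k<..<t (Suc k)}"] t(2)[OF that] D.emeasure_eq_measure by simp
  then show ?thesis using t by blast
qed

end

section \<open>The product structure of a tartan\<close>

text \<open>Stable fibers are pictured as rows and unstable ones as columns. Then
  \<open>s.own z\<close> is the row and \<open>s.other z\<close> the column through
  \<open>z\<close>, \<open>s.key\<close> orders the columns and \<open>u.key\<close> the rows;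
  \<open>s.cset\<close> gives strips of columns and \<open>u.cset\<close> strips of rows.\<close>

locale tartan_pair =
  s: fiber_family S \<mu> Ts fs fu + u: fiber_family S \<mu> Tu fu fs
  for S :: "'a::metric_space set" and \<mu> :: "'a measure" and Ts Tu :: "'a turbulation" and fs fu :: "'a set set" +
  assumes compat: "compatible \<mu> Ts Tu (fs, fu)"
    and sets_mu: "sets \<mu> = sets (borel_of (top_of_set S))" and prob: "prob_space \<mu>"
    and pos: "emeasure \<mu> (tartan_cross (fs, fu)) > 0"
begin

sublocale prob_space \<mu> by (rule prob)

abbreviation X where "X \<equiv> s.X"

lemma uX: "u.X = X" by (simp add: s.X_def u.X_def Int_commute)
lemma cross_X: "tartan_cross (fs, fu) = X" by (simp add: tartan_cross_def s.X_def)

lemma X_sets: "X \<in> sets \<mu>"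
  using pos emeasure_notin_sets unfolding cross_X by fastforce

lemma space_mu: "space \<mu> = S"
  using sets_eq_imp_space_eq[OF sets_mu] by (simp add: space_borel_of)

abbreviation \<psi> :: "'a \<times> 'a \<Rightarrow> 'a" where "\<psi> \<equiv> tartan_map (fs, fu)"

definition Ms :: "'a set \<Rightarrow> 'a measure" where "Ms A = restrict_space (s.smeas A) (A \<inter> X)"
definition Mu :: "'a set \<Rightarrow> 'a measure" where "Mu B = restrict_space (u.smeas B) (B \<inter> X)"

lemma fiber_sets: "A \<in> fs \<Longrightarrow> A \<inter> X \<in> sets (s.smeas A)" "B \<in> fu \<Longrightarrow> B \<inter> X \<in> sets (u.smeas B)"
  using s.borel_sets_on_line[OF sets_mu _ X_sets] u.borel_sets_on_line[OF sets_mu _ X_sets] by simp_all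

lemma space_M:
  "A \<in> fs \<Longrightarrow> space (Ms A) = A \<inter> X" "B \<in> fu \<Longrightarrow> space (Mu B) = B \<inter> X"
  using fiber_sets[THEN sets.sets_into_space] by (simp_all add: Ms_def Mu_def space_restrict_space Int_absorb2)

lemma sets_M:
  "A \<in> fs \<Longrightarrow> E \<subseteq> A \<inter> X \<Longrightarrow> E \<in> sets (s.smeas A) \<Longrightarrow> E \<in> sets (Ms A)"
  "B \<in> fu \<Longrightarrow> E \<subseteq> B \<inter> X \<Longrightarrow> E \<in> sets (u.smeas B) \<Longrightarrow> E \<in> sets (Mu B)"
  unfolding Ms_def Mu_def using fiber_sets by (subst sets_restrict_space_iff; auto)+

lemma emeasure_M:
  "A \<in> fs \<Longrightarrow> E \<subseteq> A \<inter> X \<Longrightarrow> emeasure (Ms A) E = emeasure (s.smeas A) E"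
  "B \<in> fu \<Longrightarrow> E \<subseteq> B \<inter> X \<Longrightarrow> emeasure (Mu B) E = emeasure (u.smeas B) E"
  unfolding Ms_def Mu_def using fiber_sets by (subst emeasure_restrict_space; auto)+

lemma finite_M: "A \<in> fs \<Longrightarrow> finite_measure (Ms A)" "B \<in> fu \<Longrightarrow> finite_measure (Mu B)"
proof -
  assume A: "A \<in> fs"
  have "emeasure (Ms A) (A \<inter> X) \<le> emeasure (s.smeas A) A"
    using emeasure_M(1)[OF A] s.line_smeas(5)[OF A] by (simp add: emeasure_mono)
  also have "\<dots> \<le> ennreal s.K" by (rule s.K(2)[OF A])
  finally show "finite_measure (Ms A)" by (intro finite_measureI) (auto simp: space_M(1)[OF A] top_unique)
next
  assume B: "B \<in> fu"
  have "emeasure (Mu B) (B \<inter> X) \<le> emeasure (u.smeas B) B"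
    using emeasure_M(2)[OF B] u.line_smeas(5)[OF B] by (simp add: emeasure_mono)
  also have "\<dots> \<le> ennreal u.K" by (rule u.K(2)[OF B])
  finally show "finite_measure (Mu B)" by (intro finite_measureI) (auto simp: space_M(2)[OF B] top_unique)
qed

lemma compat_AB:
  assumes "A \<in> fs" "B \<in> fu"
  shows "bij_betw \<psi> ((A \<inter> X) \<times> (B \<inter> X)) X"
    "\<psi> \<in> measurable (Ms A \<Otimes>\<^sub>M Mu B) (restrict_space \<mu> X)"
    "the_inv_into ((A \<inter> X) \<times> (B \<inter> X)) \<psi> \<in> measurable (restrict_space \<mu> X) (Ms A \<Otimes>\<^sub>M Mu B)"
    "distr (Ms A \<Otimes>\<^sub>M Mu B) (restrict_space \<mu> X) \<psi> = restrict_space \<mu> X"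
proof -
  have "bimeasurable (Ms A \<Otimes>\<^sub>M Mu B) (restrict_space \<mu> X) \<psi> \<and>
      distr (Ms A \<Otimes>\<^sub>M Mu B) (restrict_space \<mu> X) \<psi> = restrict_space \<mu> X"
    using compat s.arc_of_line[OF assms(1)] u.arc_of_line[OF assms(2)] assms
    unfolding compatible_def Let_def cross_X Ms_def Mu_def by simp
  moreover have "space (Ms A \<Otimes>\<^sub>M Mu B) = (A \<inter> X) \<times> (B \<inter> X)"
    using assms by (simp add: space_pair_measure space_M)
  moreover have "space (restrict_space \<mu> X) = X"
    using sets.sets_into_space[OF X_sets] by (simp add: space_restrict_space Int_absorb2)
  ultimately show "bij_betw \<psi> ((A \<inter> X) \<times> (B \<inter> X)) X"
    "\<psi> \<in> measurable (Ms A \<Otimes>\<^sub>M Mu B) (restrict_space \<mu> X)"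
    "the_inv_into ((A \<inter> X) \<times> (B \<inter> X)) \<psi> \<in> measurable (restrict_space \<mu> X) (Ms A \<Otimes>\<^sub>M Mu B)"
    "distr (Ms A \<Otimes>\<^sub>M Mu B) (restrict_space \<mu> X) \<psi> = restrict_space \<mu> X"
    by (simp_all add: bimeasurable_def)
qed

lemma psi:
  assumes "x \<in> X" "y \<in> X"
  shows "\<psi> (x, y) \<in> X" "s.other (\<psi> (x, y)) = s.other x" "s.own (\<psi> (x, y)) = s.own y"
proof -
  have "\<psi> (x, y) = cross_point (s.own y) (s.other x)"
    by (simp add: tartan_map_def cross_point_def Int_commute)
  then show "\<psi> (x, y) \<in> X" "s.other (\<psi> (x, y)) = s.other x" "s.own (\<psi> (x, y)) = s.own y"
    using s.cross_in_X[OF s.XD(1)[OF assms(2)] s.XD(3)[OF assms(1)]] by simp_all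
qed

text \<open>With \<open>cy\<close> this is the inverse of \<open>\<psi>\<close>: the column and the
  row of \<open>z\<close>, marked on the two base fibers.\<close>

definition cx :: "'a \<Rightarrow> 'a" where "cx z = cross_point s.base (s.other z)"
definition cy :: "'a \<Rightarrow> 'a" where "cy z = cross_point u.base (s.own z)"

lemma coords:
  assumes "z \<in> X"
  shows "cx z \<in> s.base \<inter> X" "cy z \<in> u.base \<inter> X" "s.other (cx z) = s.other z" "s.own (cy z) = s.own z"
    "\<psi> (cx z, cy z) = z"
proof -
  show 1: "cx z \<in> s.base \<inter> X" "s.other (cx z) = s.other z"
    using s.cross_in_X[OF s.base s.XD(3)[OF assms]] by (simp_all add: cx_def)
  show 2: "cy z \<in> u.base \<inter> X" "s.own (cy z) = s.own z"
    using u.cross_in_X[OF u.base s.XD(1)[OF assms]] by (simp_all add: cy_def uX)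
  show "\<psi> (cx z, cy z) = z"
    using psi[of "cx z" "cy z"] 1 2 assms by (intro s.X_eqI) auto
qed

lemma coords_psi:
  assumes "x \<in> s.base \<inter> X" "y \<in> u.base \<inter> X"
  shows "cx (\<psi> (x, y)) = x" "cy (\<psi> (x, y)) = y"
proof -
  have xy: "x \<in> X" "y \<in> X" using assms by auto
  note p = psi[OF xy]
  show "cx (\<psi> (x, y)) = x"
  proof (rule s.X_eqI)
    show "s.own (cx (\<psi> (x, y))) = s.own x"
      using coords(1)[OF p(1)] assms s.ownI[OF s.base] by auto
  qed (use coords[OF p(1)] p xy in auto)
  show "cy (\<psi> (x, y)) = y"
  proof (rule s.X_eqI)
    show "s.other (cy (\<psi> (x, y))) = s.other y"
      using coords(2)[OF p(1)] assms s.otherI[OF u.base] by auto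
  qed (use coords[OF p(1)] p xy in auto)
qed

abbreviation P where "P \<equiv> Ms s.base \<Otimes>\<^sub>M Mu u.base"

lemma space_P: "space P = (s.base \<inter> X) \<times> (u.base \<inter> X)"
  by (simp add: space_pair_measure space_M s.base u.base)

lemma sets_mu_iff: "E \<subseteq> X \<Longrightarrow> E \<in> sets (restrict_space \<mu> X) \<longleftrightarrow> E \<in> sets \<mu>"
  using X_sets by (subst sets_restrict_space_iff) auto

lemma pullback:
  assumes V: "V \<in> sets \<mu>" "V \<subseteq> X" and AB: "A \<in> fs" "B \<in> fu"
  shows "\<psi> -` V \<inter> ((A \<inter> X) \<times> (B \<inter> X)) \<in> sets (Ms A \<Otimes>\<^sub>M Mu B)"
    "emeasure (Ms A \<Otimes>\<^sub>M Mu B) (\<psi> -` V \<inter> ((A \<inter> X) \<times> (B \<inter> X))) = emeasure \<mu> V"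
proof -
  have sp: "space (Ms A \<Otimes>\<^sub>M Mu B) = (A \<inter> X) \<times> (B \<inter> X)"
    using AB by (simp add: space_pair_measure space_M)
  have V': "V \<in> sets (restrict_space \<mu> X)" using V by (simp add: sets_mu_iff)
  show "\<psi> -` V \<inter> ((A \<inter> X) \<times> (B \<inter> X)) \<in> sets (Ms A \<Otimes>\<^sub>M Mu B)"
    using measurable_sets[OF compat_AB(2)[OF AB] V'] by (simp add: sp)
  have "emeasure (Ms A \<Otimes>\<^sub>M Mu B) (\<psi> -` V \<inter> space (Ms A \<Otimes>\<^sub>M Mu B))
      = emeasure (distr (Ms A \<Otimes>\<^sub>M Mu B) (restrict_space \<mu> X) \<psi>) V"
    by (rule emeasure_distr[OF compat_AB(2)[OF AB] V', symmetric])
  also have "\<dots> = emeasure \<mu> V"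
    unfolding compat_AB(4)[OF AB] using X_sets V by (intro emeasure_restrict_space) auto
  finally show "emeasure (Ms A \<Otimes>\<^sub>M Mu B) (\<psi> -` V \<inter> ((A \<inter> X) \<times> (B \<inter> X))) = emeasure \<mu> V"
    by (simp add: sp)
qed

text \<open>Here measurability of the inverse of \<open>\<psi>\<close> enters, the second half of
  bi-measurability.\<close>

lemma push:
  assumes E: "E \<in> sets P"
  shows "{z \<in> X. (cx z, cy z) \<in> E} \<in> sets \<mu>"
proof -
  have "the_inv_into ((s.base \<inter> X) \<times> (u.base \<inter> X)) \<psi> -` E \<inter> space (restrict_space \<mu> X) \<in> sets (restrict_space \<mu> X)"
    by (rule measurable_sets[OF compat_AB(3)[OF s.base u.base] E])
  moreover have "space (restrict_space \<mu> X) = X"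
    using sets.sets_into_space[OF X_sets] by (simp add: space_restrict_space Int_absorb2)
  moreover have "the_inv_into ((s.base \<inter> X) \<times> (u.base \<inter> X)) \<psi> z = (cx z, cy z)" if "z \<in> X" for z
    using compat_AB(1)[OF s.base u.base] coords[OF that]
    by (intro the_inv_into_f_eq) (auto simp: bij_betw_def)
  ultimately have "{z \<in> X. (cx z, cy z) \<in> E} \<in> sets (restrict_space \<mu> X)"
    by (auto simp: vimage_def Int_def conj_commute cong: conj_cong elim!: back_subst[where P = "\<lambda>A. A \<in> _"])
  then show ?thesis by (subst (asm) sets_mu_iff) auto
qed

text \<open>The keys are defined on one fiber only, so that a strip is a Borel set of the surface is
  a fact about the product structure: a strip is the image under \<open>\<psi>\<close> of a
  measurable rectangle.\<close>

lemma cset_sets: assumes "I \<in> sets borel" shows "s.cset I \<in> sets \<mu>" "u.cset I \<in> sets \<mu>"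
proof -
  have "s.base \<inter> s.cset I \<in> sets (Ms s.base)"
    using s.base_cset_in_sets[OF sets_mu X_sets assms] by (intro sets_M s.base) (auto simp: s.cset_def)
  moreover have "u.base \<inter> X \<in> sets (Mu u.base)"
    using fiber_sets u.base by (intro sets_M) auto
  ultimately have "(s.base \<inter> s.cset I) \<times> (u.base \<inter> X) \<in> sets P" by simp
  from push[OF this] show "s.cset I \<in> sets \<mu>"
    using coords by (elim back_subst[where P = "\<lambda>A. A \<in> _"]) (auto simp: s.cset_def)
  have "u.base \<inter> u.cset I \<in> sets (Mu u.base)"
    using u.base_cset_in_sets[OF sets_mu _ assms] X_sets by (intro sets_M u.base) (auto simp: u.cset_def uX)
  moreover have "s.base \<inter> X \<in> sets (Ms s.base)"
    using fiber_sets s.base by (intro sets_M) auto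
  ultimately have "(s.base \<inter> X) \<times> (u.base \<inter> u.cset I) \<in> sets P" by simp
  from push[OF this] show "u.cset I \<in> sets \<mu>"
    using coords by (elim back_subst[where P = "\<lambda>A. A \<in> _"]) (auto simp: u.cset_def uX)
qed

text \<open>In the coordinates of any pair of fibers \<open>A\<close>, \<open>B\<close> a block is a
  measurable rectangle.\<close>

lemma product_formula:
  assumes IJ: "I \<in> sets borel" "J \<in> sets borel" and AB: "A \<in> fs" "B \<in> fu"
  shows "emeasure \<mu> (s.cset I \<inter> u.cset J) =
    emeasure (s.smeas A) (A \<inter> s.cset I) * emeasure (u.smeas B) (B \<inter> u.cset J)"
proof -
  interpret B: finite_measure "Mu B" by (rule finite_M(2)[OF AB(2)])
  let ?V = "s.cset I \<inter> u.cset J"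
  have V: "?V \<in> sets \<mu>" "?V \<subseteq> X" using cset_sets IJ by (auto simp: s.cset_def)
  have sub: "A \<inter> s.cset I \<subseteq> A \<inter> X" "B \<inter> u.cset J \<subseteq> B \<inter> X" by (auto simp: s.cset_def u.cset_def uX)
  have "\<psi> -` ?V \<inter> ((A \<inter> X) \<times> (B \<inter> X)) = (A \<inter> s.cset I) \<times> (B \<inter> u.cset J)"
    using psi by (auto simp: s.cset_def u.cset_def uX)
  then have "emeasure \<mu> ?V = emeasure (Ms A \<Otimes>\<^sub>M Mu B) ((A \<inter> s.cset I) \<times> (B \<inter> u.cset J))"
    using pullback(2)[OF V AB] by simp
  also have "\<dots> = emeasure (Ms A) (A \<inter> s.cset I) * emeasure (Mu B) (B \<inter> u.cset J)"
  proof (rule B.emeasure_pair_measure_Times)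
    show "A \<inter> s.cset I \<in> sets (Ms A)"
      by (rule sets_M(1)[OF AB(1) sub(1)]) (rule s.borel_sets_on_line[OF sets_mu AB(1) cset_sets(1)[OF IJ(1)]])
    show "B \<inter> u.cset J \<in> sets (Mu B)"
      by (rule sets_M(2)[OF AB(2) sub(2)]) (rule u.borel_sets_on_line[OF sets_mu AB(2) cset_sets(2)[OF IJ(2)]])
  qed
  finally show ?thesis using emeasure_M AB sub by simp
qed

lemma cset_UNIV: "s.cset UNIV = X" "u.cset UNIV = X"
  by (auto simp: s.cset_def u.cset_def uX)

lemma base_mass:
  "A \<in> fs \<Longrightarrow> emeasure (s.smeas A) (A \<inter> X) \<noteq> 0" "A \<in> fs \<Longrightarrow> emeasure (s.smeas A) (A \<inter> X) \<noteq> \<infinity>"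
  "B \<in> fu \<Longrightarrow> emeasure (u.smeas B) (B \<inter> X) \<noteq> 0" "B \<in> fu \<Longrightarrow> emeasure (u.smeas B) (B \<inter> X) \<noteq> \<infinity>"
proof -
  have *: "emeasure (s.smeas A) (A \<inter> X) * emeasure (u.smeas B) (B \<inter> X) \<noteq> 0" if "A \<in> fs" "B \<in> fu" for A B
    using product_formula[of UNIV UNIV, OF _ _ that] pos unfolding cset_UNIV cross_X by auto
  show "A \<in> fs \<Longrightarrow> emeasure (s.smeas A) (A \<inter> X) \<noteq> 0" "B \<in> fu \<Longrightarrow> emeasure (u.smeas B) (B \<inter> X) \<noteq> 0"
    using *[OF _ u.base] *[OF s.base] by simp_all
  show "A \<in> fs \<Longrightarrow> emeasure (s.smeas A) (A \<inter> X) \<noteq> \<infinity>" "B \<in> fu \<Longrightarrow> emeasure (u.smeas B) (B \<inter> X) \<noteq> \<infinity>"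
    using finite_measure.emeasure_finite[OF finite_M(1), of A "A \<inter> X"]
      finite_measure.emeasure_finite[OF finite_M(2), of B "B \<inter> X"] emeasure_M by simp_all
qed

text \<open>Compatibility makes the measure of \<open>A \<inter> s.cset I\<close> independent of the fiber \<open>A\<close>.\<close>

lemma holonomy_invariance:
  "I \<in> sets borel \<Longrightarrow> A \<in> fs \<Longrightarrow> A' \<in> fs \<Longrightarrow>
    emeasure (s.smeas A) (A \<inter> s.cset I) = emeasure (s.smeas A') (A' \<inter> s.cset I)"
  "I \<in> sets borel \<Longrightarrow> B \<in> fu \<Longrightarrow> B' \<in> fu \<Longrightarrow>
    emeasure (u.smeas B) (B \<inter> u.cset I) = emeasure (u.smeas B') (B' \<inter> u.cset I)"
proof -
  assume I: "I \<in> sets borel" and A: "A \<in> fs" "A' \<in> fs"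
  have "emeasure (s.smeas A) (A \<inter> s.cset I) * emeasure (u.smeas u.base) (u.base \<inter> X)
      = emeasure (s.smeas A') (A' \<inter> s.cset I) * emeasure (u.smeas u.base) (u.base \<inter> X)"
    using product_formula[OF I _ A(1) u.base, of UNIV] product_formula[OF I _ A(2) u.base, of UNIV]
    by (simp add: cset_UNIV)
  then show "emeasure (s.smeas A) (A \<inter> s.cset I) = emeasure (s.smeas A') (A' \<inter> s.cset I)"
    unfolding mult.commute[of _ "emeasure (u.smeas u.base) (u.base \<inter> X)"] ennreal_mult_cancel_left
    using base_mass(3,4)[OF u.base] by simp
next
  assume I: "I \<in> sets borel" and B: "B \<in> fu" "B' \<in> fu"
  have "emeasure (s.smeas s.base) (s.base \<inter> X) * emeasure (u.smeas B) (B \<inter> u.cset I)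
      = emeasure (s.smeas s.base) (s.base \<inter> X) * emeasure (u.smeas B') (B' \<inter> u.cset I)"
    using product_formula[OF _ I s.base B(1), of UNIV] product_formula[OF _ I s.base B(2), of UNIV]
    by (simp add: cset_UNIV)
  then show "emeasure (u.smeas B) (B \<inter> u.cset I) = emeasure (u.smeas B') (B' \<inter> u.cset I)"
    unfolding ennreal_mult_cancel_left using base_mass(1,2)[OF s.base] by simp
qed

section \<open>Choosing the corners by measure\<close>

lemma preserved:
  assumes "f \<in> measurable \<mu> \<mu>" "distr \<mu> \<mu> f = \<mu>" "A \<in> sets \<mu>"
  shows "{x \<in> space \<mu>. f x \<in> A} \<in> sets \<mu>" "measure \<mu> {x \<in> space \<mu>. f x \<in> A} = measure \<mu> A"
proof -
  have eq: "f -` A \<inter> space \<mu> = {x \<in> space \<mu>. f x \<in> A}" by auto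
  show "{x \<in> space \<mu>. f x \<in> A} \<in> sets \<mu>"
    using measurable_sets[OF assms(1,3)] unfolding eq .
  show "measure \<mu> {x \<in> space \<mu>. f x \<in> A} = measure \<mu> A"
    using measure_distr[OF assms(1,3)] assms(2) unfolding eq by simp
qed

lemma measure_pullback:
  assumes "E \<in> sets P"
  shows "measure \<mu> {z \<in> X. (cx z, cy z) \<in> E} = measure P E"
proof -
  let ?V = "{z \<in> X. (cx z, cy z) \<in> E}"
  have "E \<subseteq> (s.base \<inter> X) \<times> (u.base \<inter> X)" using sets.sets_into_space[OF assms] space_P by simp
  then have "\<psi> -` ?V \<inter> ((s.base \<inter> X) \<times> (u.base \<inter> X)) = E"
    using coords_psi psi(1) by fastforce
  then show ?thesis
    using pullback(2)[OF push[OF assms] _ s.base u.base] by (auto simp: measure_def)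
qed

lemma measure_pushed:
  assumes V: "V \<in> sets \<mu>" "V \<subseteq> X"
  shows "measure P (\<psi> -` V \<inter> space P) = measure \<mu> V"
  using pullback(2)[OF V s.base u.base] by (simp add: measure_def space_P)

text \<open>A union bound: the exceptional sets come from \<open>Z\<close> by means of \<open>f\<close>, \<open>g\<close> and Fubini's theorem for the
  product structure, and by \<open>arith\<close> they do not exhaust the returns to \<open>C\<close>.\<close>

lemma counting:
  assumes f: "f \<in> measurable \<mu> \<mu>" "distr \<mu> \<mu> f = \<mu>" and g: "g \<in> measurable \<mu> \<mu>" "distr \<mu> \<mu> g = \<mu>"
    and Z: "Z \<in> sets \<mu>" "measure \<mu> Z < \<epsilon>"
    and borel: "IL \<in> sets borel" "IM \<in> sets borel" "IR \<in> sets borel" "JB \<in> sets borel" "JM \<in> sets borel" "JT \<in> sets borel"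
    and \<kappa>: "\<kappa>1 > 0" "\<kappa>2 > 0"
    and mass: "emeasure (s.smeas s.base) (s.base \<inter> s.cset IL) = ennreal \<kappa>1"
      "emeasure (s.smeas s.base) (s.base \<inter> s.cset IR) = ennreal \<kappa>1"
      "emeasure (u.smeas u.base) (u.base \<inter> u.cset JB) = ennreal \<kappa>2"
      "emeasure (u.smeas u.base) (u.base \<inter> u.cset JT) = ennreal \<kappa>2"
    and C: "C = s.cset IM \<inter> u.cset JM" and c: "c \<le> measure \<mu> {x \<in> C. f x \<in> C}"
    and arith: "measure (Ms s.base) (space (Ms s.base)) * (2 * (2 * \<epsilon> + 2 * \<epsilon> / \<kappa>2 * measure (Mu u.base) (space (Mu u.base))) / \<kappa>1) + \<epsilon> < c"
  shows "\<exists>z z1 z2. z \<in> C \<and> f z \<in> C - Z \<and> z1 \<in> s.cset IL \<and> z2 \<in> s.cset IR \<and> s.own z1 = s.own z \<and> s.own z2 = s.own z \<and>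
    (\<forall>v\<in>{z1, z2}. v \<notin> Z \<and> f v \<notin> Z \<and> (f v \<in> X \<longrightarrow>
      (\<exists>w\<in>u.cset JT. s.other w = s.other (f v) \<and> g w \<notin> Z) \<and> (\<exists>w\<in>u.cset JB. s.other w = s.other (f v) \<and> g w \<notin> Z)))"
proof -
  let ?M1 = "Ms s.base" and ?M2 = "Mu u.base"
  interpret M1: finite_measure ?M1 by (rule finite_M(1)[OF s.base])
  interpret M2: finite_measure ?M2 by (rule finite_M(2)[OF u.base])
  let ?\<alpha> = "measure ?M1 (space ?M1)" and ?\<beta> = "measure ?M2 (space ?M2)"
  note fin = M1.finite_measure_axioms M2.finite_measure_axioms
  have sp: "space ?M1 = s.base \<inter> X" "space ?M2 = u.base \<inter> X" by (simp_all add: space_M s.base u.base)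
  have XS: "X \<subseteq> space \<mu>" using sets.sets_into_space[OF X_sets] .
  have cols: "s.base \<inter> s.cset I \<in> sets ?M1" "measure ?M1 (s.base \<inter> s.cset I) = measure (s.smeas s.base) (s.base \<inter> s.cset I)"
    if "I \<in> sets borel" for I
  proof -
    have sub: "s.base \<inter> s.cset I \<subseteq> s.base \<inter> X" by (auto simp: s.cset_def)
    show "s.base \<inter> s.cset I \<in> sets ?M1"
      by (rule sets_M(1)[OF s.base sub]) (rule s.base_cset_in_sets[OF sets_mu X_sets that])
    show "measure ?M1 (s.base \<inter> s.cset I) = measure (s.smeas s.base) (s.base \<inter> s.cset I)"
      using emeasure_M(1)[OF s.base sub] by (simp add: measure_def)
  qed
  have rows: "u.base \<inter> u.cset I \<in> sets ?M2" "measure ?M2 (u.base \<inter> u.cset I) = measure (u.smeas u.base) (u.base \<inter> u.cset I)"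
    if "I \<in> sets borel" for I
  proof -
    have sub: "u.base \<inter> u.cset I \<subseteq> u.base \<inter> X" by (auto simp: u.cset_def uX)
    show "u.base \<inter> u.cset I \<in> sets ?M2"
      by (rule sets_M(2)[OF u.base sub]) (rule u.base_cset_in_sets[OF sets_mu _ that], simp add: uX X_sets)
    show "measure ?M2 (u.base \<inter> u.cset I) = measure (u.smeas u.base) (u.base \<inter> u.cset I)"
      using emeasure_M(2)[OF u.base sub] by (simp add: measure_def)
  qed
  have \<kappa>_eq: "measure ?M1 (s.base \<inter> s.cset IL) = \<kappa>1" "measure ?M1 (s.base \<inter> s.cset IR) = \<kappa>1"
    "measure ?M2 (u.base \<inter> u.cset JB) = \<kappa>2" "measure ?M2 (u.base \<inter> u.cset JT) = \<kappa>2"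
    using cols rows borel mass \<kappa> by (simp_all add: measure_def)
  \<comment> \<open>Points that \<open>g\<close> sends into \<open>Z\<close>. As \<open>g\<close>
    preserves the measure, they are as rare as \<open>Z\<close> itself.\<close>
  define Zg where "Zg = X \<inter> {w \<in> space \<mu>. g w \<in> Z}"
  have Zg: "Zg \<in> sets \<mu>" "Zg \<subseteq> X" and mZg: "measure \<mu> Zg \<le> \<epsilon>"
  proof -
    show "Zg \<in> sets \<mu>" "Zg \<subseteq> X" unfolding Zg_def using X_sets preserved(1)[OF g Z(1)] by auto
    have "measure \<mu> Zg \<le> measure \<mu> {w \<in> space \<mu>. g w \<in> Z}"
      unfolding Zg_def by (rule finite_measure_mono) (use preserved(1)[OF g Z(1)] in auto)
    then show "measure \<mu> Zg \<le> \<epsilon>" using preserved(2)[OF g Z(1)] Z(2) by linarith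
  qed
  define Z' where "Z' = \<psi> -` Zg \<inter> space P"
  have Z': "Z' \<in> sets P" "measure P Z' \<le> \<epsilon>"
    unfolding Z'_def using pullback(1)[OF Zg s.base u.base] measure_pushed[OF Zg] mZg by (simp_all add: space_P)
  \<comment> \<open>Columns, marked on the base row, on which almost every point of the row strip
    \<open>J\<close> is sent into \<open>Z\<close> by \<open>g\<close>. Such a column offers no
    usable \<open>w\<close>.\<close>
  define Bad where "Bad J = {x \<in> space ?M1. emeasure ?M2 {y \<in> u.base \<inter> u.cset J. (x, y) \<notin> Z'} = 0}" for J
  have Bad: "Bad J \<in> sets ?M1" "measure ?M1 (Bad J) \<le> \<epsilon> / \<kappa>2" if "J = JT \<or> J = JB" for J
  proof -
    have "J \<in> sets borel" "measure ?M2 (u.base \<inter> u.cset J) = \<kappa>2" using that borel \<kappa>_eq by auto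
    then have "measure ?M1 (Bad J) * \<kappa>2 \<le> \<epsilon>"
      using pair_measure_null_sections(2)[OF fin Z'(1) rows(1), of J] Z'(2) unfolding Bad_def by simp
    then show "measure ?M1 (Bad J) \<le> \<epsilon> / \<kappa>2" using \<kappa> by (simp add: field_simps)
    show "Bad J \<in> sets ?M1"
      unfolding Bad_def by (rule pair_measure_null_sections(1)[OF fin Z'(1) rows(1)]) fact
  qed
  define BB where "BB = Bad JT \<union> Bad JB"
  have BB: "BB \<in> sets ?M1" "measure ?M1 BB \<le> 2 * \<epsilon> / \<kappa>2"
  proof -
    show "BB \<in> sets ?M1" using Bad(1) by (auto simp: BB_def)
    have "measure ?M1 BB \<le> measure ?M1 (Bad JT) + measure ?M1 (Bad JB)"
      unfolding BB_def by (rule measure_Un_le) (use Bad(1) in auto)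
    also have "\<dots> \<le> \<epsilon> / \<kappa>2 + \<epsilon> / \<kappa>2" by (intro add_mono Bad(2)) auto
    finally show "measure ?M1 BB \<le> 2 * \<epsilon> / \<kappa>2" by simp
  qed
  define VT where "VT = {z \<in> X. (cx z, cy z) \<in> BB \<times> space ?M2}"
  have VT: "VT \<in> sets \<mu>" "measure \<mu> VT \<le> 2 * \<epsilon> / \<kappa>2 * ?\<beta>"
  proof -
    have E: "BB \<times> space ?M2 \<in> sets P" using BB(1) by auto
    show "VT \<in> sets \<mu>" unfolding VT_def by (rule push[OF E])
    have "measure P (BB \<times> space ?M2) = measure ?M1 BB * ?\<beta>"
      using M2.emeasure_pair_measure_Times[OF BB(1), of "space ?M2"] by (simp add: measure_def enn2real_mult)
    then have "measure \<mu> VT = measure ?M1 BB * ?\<beta>" unfolding VT_def measure_pullback[OF E] .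
    also have "\<dots> \<le> 2 * \<epsilon> / \<kappa>2 * ?\<beta>" by (rule mult_right_mono[OF BB(2)]) simp
    finally show "measure \<mu> VT \<le> 2 * \<epsilon> / \<kappa>2 * ?\<beta>" .
  qed
  \<comment> \<open>Points unfit to be \<open>z1\<close> or \<open>z2\<close>: they or their images
    lie in \<open>Z\<close>, or their images lie on a bad column.\<close>
  define V where "V = X \<inter> (Z \<union> ({z \<in> space \<mu>. f z \<in> Z} \<union> {z \<in> space \<mu>. f z \<in> VT}))"
  let ?v = "2 * \<epsilon> + 2 * \<epsilon> / \<kappa>2 * ?\<beta>"
  have V: "V \<in> sets \<mu>" "V \<subseteq> X" and mV: "measure \<mu> V \<le> ?v"
  proof -
    note F = preserved[OF f Z(1)] preserved[OF f VT(1)]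
    have F3: "{z \<in> space \<mu>. f z \<in> Z} \<union> {z \<in> space \<mu>. f z \<in> VT} \<in> sets \<mu>" using F(1,3) by (rule sets.Un)
    have F4: "Z \<union> ({z \<in> space \<mu>. f z \<in> Z} \<union> {z \<in> space \<mu>. f z \<in> VT}) \<in> sets \<mu>" using Z(1) F3 by (rule sets.Un)
    show "V \<in> sets \<mu>" unfolding V_def using X_sets F4 by (rule sets.Int)
    show "V \<subseteq> X" by (auto simp: V_def)
    have "measure \<mu> V \<le> measure \<mu> (Z \<union> ({z \<in> space \<mu>. f z \<in> Z} \<union> {z \<in> space \<mu>. f z \<in> VT}))"
      unfolding V_def by (rule finite_measure_mono[OF _ F4]) auto
    also have "\<dots> \<le> measure \<mu> Z + (measure \<mu> Z + measure \<mu> VT)"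
      using measure_Un_le[OF Z(1) F3] measure_Un_le[OF F(1,3)] F(2,4) by linarith
    finally show "measure \<mu> V \<le> ?v" using Z(2) VT(2) by linarith
  qed
  define V' where "V' = \<psi> -` V \<inter> space P"
  have V': "V' \<in> sets P" "measure P V' \<le> ?v"
    unfolding V'_def using pullback(1)[OF V s.base u.base] measure_pushed[OF V] mV by (simp_all add: space_P)
  \<comment> \<open>Rows, marked on the base column, on which the column strip \<open>I\<close>
    consists almost entirely of unfit points.\<close>
  define Yb where "Yb I = {y \<in> space ?M2. emeasure ?M1 {x \<in> s.base \<inter> s.cset I. (x, y) \<notin> V'} = 0}" for I
  have Yb: "Yb I \<in> sets ?M2" "measure ?M2 (Yb I) \<le> ?v / \<kappa>1" if "I = IL \<or> I = IR" for I
  proof -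
    have "I \<in> sets borel" "measure ?M1 (s.base \<inter> s.cset I) = \<kappa>1" using that borel \<kappa>_eq by auto
    then have "measure ?M2 (Yb I) * \<kappa>1 \<le> ?v"
      using pair_measure_null_sections'(2)[OF fin V'(1) cols(1), of I] V'(2) unfolding Yb_def by simp
    then show "measure ?M2 (Yb I) \<le> ?v / \<kappa>1" using \<kappa> by (simp add: pos_le_divide_eq)
    show "Yb I \<in> sets ?M2"
      unfolding Yb_def by (rule pair_measure_null_sections'(1)[OF fin V'(1) cols(1)]) fact
  qed
  have YY: "Yb IL \<union> Yb IR \<in> sets ?M2" using Yb(1) by auto
  have mYY: "measure ?M2 (Yb IL \<union> Yb IR) \<le> 2 * ?v / \<kappa>1"
  proof -
    have "measure ?M2 (Yb IL \<union> Yb IR) \<le> measure ?M2 (Yb IL) + measure ?M2 (Yb IR)"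
      by (rule measure_Un_le) (use Yb(1) in auto)
    also have "\<dots> \<le> ?v / \<kappa>1 + ?v / \<kappa>1" by (intro add_mono Yb(2)) auto
    finally show ?thesis by simp
  qed
  have Cs: "C \<in> sets \<mu>" "C \<subseteq> X" using cset_sets borel by (auto simp: C s.cset_def)
  define W where "W = C \<inter> {x \<in> space \<mu>. f x \<in> C - Z}"
  have W: "W \<in> sets \<mu>" unfolding W_def using Cs(1) preserved(1)[OF f, of "C - Z"] Z(1) by auto
  have mW: "c - \<epsilon> < measure \<mu> W"
  proof -
    have "{x \<in> C. f x \<in> C} \<subseteq> W \<union> {x \<in> space \<mu>. f x \<in> Z}"
      using Cs(2) XS by (auto simp: W_def)
    then have "measure \<mu> {x \<in> C. f x \<in> C} \<le> measure \<mu> (W \<union> {x \<in> space \<mu>. f x \<in> Z})"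
      by (rule finite_measure_mono) (use W preserved(1)[OF f Z(1)] in auto)
    also have "\<dots> \<le> measure \<mu> W + measure \<mu> Z"
      using measure_Un_le[OF W preserved(1)[OF f Z(1)]] preserved(2)[OF f Z(1)] by simp
    finally show ?thesis using c Z(2) by linarith
  qed
  \<comment> \<open>The bad rows have total measure at most the first term of \<open>arith\<close>,
    the returns in \<open>W\<close> have more than \<open>c - \<epsilon>\<close>; so some return
    lies on a row with fit points in both strips.\<close>
  obtain z where z: "z \<in> W" "cy z \<notin> Yb IL \<union> Yb IR"
  proof (rule ccontr)
    assume "\<not> thesis"
    then have "cy z \<in> Yb IL \<union> Yb IR" if "z \<in> W" for z using that \<open>\<And>z. z \<in> W \<Longrightarrow> cy z \<notin> Yb IL \<union> Yb IR \<Longrightarrow> thesis\<close> by blast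
    then have "W \<subseteq> {z \<in> X. (cx z, cy z) \<in> space ?M1 \<times> (Yb IL \<union> Yb IR)}"
      using Cs(2) coords(1) unfolding W_def sp by blast
    moreover have E: "space ?M1 \<times> (Yb IL \<union> Yb IR) \<in> sets P" using YY by auto
    ultimately have "measure \<mu> W \<le> measure P (space ?M1 \<times> (Yb IL \<union> Yb IR))"
      using finite_measure_mono[OF _ push[OF E]] measure_pullback[OF E] by simp
    also have "\<dots> = ?\<alpha> * measure ?M2 (Yb IL \<union> Yb IR)"
      using M2.emeasure_pair_measure_Times[OF sets.top[of ?M1] YY] by (simp add: measure_def enn2real_mult)
    also have "\<dots> \<le> ?\<alpha> * (2 * ?v / \<kappa>1)" by (rule mult_left_mono[OF mYY]) simp
    finally show False using mW arith by linarith
  qed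
  have zX: "z \<in> X" using z(1) Cs(2) by (auto simp: W_def)
  have point: "\<exists>v. v \<in> s.cset I \<and> s.own v = s.own z \<and> v \<notin> V" if I: "I = IL \<or> I = IR" for I
  proof -
    have "cy z \<notin> Yb I" "cy z \<in> space ?M2" using z(2) I coords(2)[OF zX] by (auto simp: sp)
    then have "emeasure ?M1 {x \<in> s.base \<inter> s.cset I. (x, cy z) \<notin> V'} \<noteq> 0" by (simp add: Yb_def)
    then have "{x \<in> s.base \<inter> s.cset I. (x, cy z) \<notin> V'} \<noteq> {}" by (metis emeasure_empty)
    then obtain x where x: "x \<in> s.base" "x \<in> s.cset I" "(x, cy z) \<notin> V'" by blast
    then have xX: "x \<in> X" by (simp add: s.cset_def)
    have "(x, cy z) \<in> space P" using x xX coords(2)[OF zX] by (simp add: space_P)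
    then have "\<psi> (x, cy z) \<notin> V" using x(3) by (simp add: V'_def)
    moreover have "cy z \<in> X" using coords(2)[OF zX] by simp
    ultimately show ?thesis
      using psi[OF xX, of "cy z"] coords(4)[OF zX] x(2) by (intro exI[of _ "\<psi> (x, cy z)"]) (simp add: s.cset_def)
  qed
  obtain z1 where z1: "z1 \<in> s.cset IL" "s.own z1 = s.own z" "z1 \<notin> V"
    using point[of IL] by auto
  obtain z2 where z2: "z2 \<in> s.cset IR" "s.own z2 = s.own z" "z2 \<notin> V"
    using point[of IR] by auto
  have ex: "\<exists>w\<in>u.cset J. s.other w = s.other (f v) \<and> g w \<notin> Z"
    if v: "v \<in> X" "v \<notin> V" "f v \<in> X" and J: "J = JT \<or> J = JB" for v J
  proof -
    have "f v \<notin> VT" using v XS by (auto simp: V_def)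
    then have "cx (f v) \<notin> Bad J" using v(3) J coords(2)[OF v(3)] by (auto simp: VT_def BB_def sp)
    then have "emeasure ?M2 {y \<in> u.base \<inter> u.cset J. (cx (f v), y) \<notin> Z'} \<noteq> 0"
      using coords(1)[OF v(3)] by (simp add: Bad_def sp)
    then have "{y \<in> u.base \<inter> u.cset J. (cx (f v), y) \<notin> Z'} \<noteq> {}" by (metis emeasure_empty)
    then obtain y where y: "y \<in> u.base" "y \<in> u.cset J" "(cx (f v), y) \<notin> Z'" by blast
    then have yX: "y \<in> X" by (simp add: u.cset_def uX)
    have cX: "cx (f v) \<in> X" using coords(1)[OF v(3)] by simp
    note p = psi[OF cX yX]
    have "(cx (f v), y) \<in> space P" using y yX coords(1)[OF v(3)] by (simp add: space_P)
    then have "\<psi> (cx (f v), y) \<notin> Zg" using y(3) by (simp add: Z'_def)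
    then have "g (\<psi> (cx (f v), y)) \<notin> Z" using p(1) XS by (auto simp: Zg_def)
    moreover have "\<psi> (cx (f v), y) \<in> u.cset J" using p y(2) by (simp add: u.cset_def uX)
    ultimately show ?thesis using p(2) coords(3)[OF v(3)] by auto
  qed
  have good: "v \<notin> Z \<and> f v \<notin> Z" if "v \<in> X" "v \<notin> V" for v
    using that XS by (auto simp: V_def)
  have zs: "z1 \<in> X" "z2 \<in> X" using z1 z2 by (simp_all add: s.cset_def)
  have "z \<in> C" "f z \<in> C - Z" using z(1) by (auto simp: W_def)
  moreover have "\<forall>v\<in>{z1, z2}. v \<notin> Z \<and> f v \<notin> Z \<and> (f v \<in> X \<longrightarrow>
      (\<exists>w\<in>u.cset JT. s.other w = s.other (f v) \<and> g w \<notin> Z) \<and> (\<exists>w\<in>u.cset JB. s.other w = s.other (f v) \<and> g w \<notin> Z))"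
    using good ex zs z1(3) z2(3) by simp
  ultimately show ?thesis using z1(1,2) z2(1,2) by (intro exI[of _ z] exI[of _ z1] exI[of _ z2] conjI)
qed

lemma homeomorphism_preserves:
  assumes h: "homeomorphism S S f g" and inv: "distr \<mu> \<mu> f = \<mu>"
  shows "f \<in> measurable \<mu> \<mu>" "g \<in> measurable \<mu> \<mu>" "distr \<mu> \<mu> g = \<mu>"
proof -
  have "continuous_map (top_of_set S) (top_of_set S) f" "continuous_map (top_of_set S) (top_of_set S) g"
    using h by (auto simp: homeomorphism_def)
  then have "f \<in> measurable \<mu> (borel_of (top_of_set S))" "g \<in> measurable \<mu> (borel_of (top_of_set S))"
    by (auto intro: measurable_borel_of[OF sets_mu])
  then show m: "f \<in> measurable \<mu> \<mu>" "g \<in> measurable \<mu> \<mu>"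
    using sets_mu by (simp_all cong: measurable_cong_sets)
  have "distr \<mu> \<mu> g = distr (distr \<mu> \<mu> f) \<mu> g" by (simp add: inv)
  also have "\<dots> = distr \<mu> \<mu> (g \<circ> f)" by (rule distr_distr[OF m(2,1)])
  also have "\<dots> = distr \<mu> \<mu> (\<lambda>x. x)"
    by (rule distr_cong) (use h in \<open>auto simp: homeomorphism_def space_mu\<close>)
  also have "\<dots> = \<mu>" by (rule distr_id)
  finally show "distr \<mu> \<mu> g = \<mu>" .
qed

lemma homeomorphism_funpow:
  assumes h: "homeomorphism S S F G" shows "homeomorphism S S (F ^^ n) (G ^^ n)"
proof (induction n)
  case 0
  show ?case by (auto simp: homeomorphism_def)
next
  case (Suc n)
  have "homeomorphism S S (F \<circ> F ^^ n) (G ^^ n \<circ> G)"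
    using Suc h by (rule homeomorphism_compose)
  then show ?case by (simp add: funpow_swap1 o_def fun_eq_iff funpow_Suc_right del: funpow.simps(2))
qed

lemma distr_funpow:
  assumes "F \<in> measurable \<mu> \<mu>" "distr \<mu> \<mu> F = \<mu>"
  shows "distr \<mu> \<mu> (F ^^ n) = \<mu> \<and> F ^^ n \<in> measurable \<mu> \<mu>"
proof (induction n)
  case 0
  show ?case using distr_id[of \<mu>] by (simp add: id_def)
next
  case (Suc n)
  have "distr \<mu> \<mu> (F \<circ> F ^^ n) = distr (distr \<mu> \<mu> (F ^^ n)) \<mu> F"
    using Suc assms by (intro distr_distr[symmetric]) auto
  then show ?case using Suc assms measurable_comp[of "F ^^ n" \<mu> \<mu> F \<mu>] by (simp add: o_def)
qed

text \<open>Each pair of conditions puts an \<open>a\<close> and a \<open>b\<close> on opposite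
  sides of \<open>r\<close>. As \<open>b2\<close> is opposite to both \<open>a1\<close> and
  \<open>a2\<close>, these two are on the same side.\<close>

lemma same_side:
  fixes r a1 a2 b1 b2 :: real
  assumes "\<not> a1 \<in> closed_segment r b1" "\<not> b1 \<in> closed_segment r a1"
    "\<not> a2 \<in> closed_segment r b2" "\<not> b2 \<in> closed_segment r a2"
    "\<not> a1 \<in> closed_segment r b2" "\<not> b2 \<in> closed_segment r a1"
  shows "a1 \<in> closed_segment r a2 \<or> a2 \<in> closed_segment r a1"
  using assms by (auto simp: closed_segment_eq_real_ivl split: if_splits)

text \<open>Along each of the two columns through \<open>z1\<close> and \<open>z2\<close> the point with image in the row set \<open>JT\<close> need
  not lie in the same row; the one in the row nearer to \<open>z1, z2\<close> can be moved to the other column.\<close>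

lemma common_row:
  assumes f: "acts c f Tu"
    and move: "\<And>v w. v \<in> X \<Longrightarrow> f v \<in> X \<Longrightarrow> s.key (s.other (f v)) \<in> IM \<Longrightarrow> w \<in> s.own v \<Longrightarrow> f w \<in> s.own (f v)"
    and z: "z1 \<in> X" "z2 \<in> X" "f z1 \<in> X" "f z2 \<in> X" "s.own z1 = s.own z2"
      "s.key (s.other (f z1)) \<in> IM" "s.key (s.other (f z2)) \<in> IM"
      "u.key (s.own (f z1)) \<in> JM" "u.key (s.own (f z2)) \<in> JM"
    and sep: "(\<forall>a\<in>JT. \<forall>b\<in>JM. \<forall>c\<in>JB. c < b \<and> b < a) \<or> (\<forall>a\<in>JT. \<forall>b\<in>JM. \<forall>c\<in>JB. a < b \<and> b < c)"
    and v: "\<And>i. i \<in> {z1, z2} \<Longrightarrow> v i \<in> X \<and> s.other (v i) = s.other i \<and> f (v i) \<in> X \<and> s.other (f (v i)) = s.other (f i)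
        \<and> u.key (s.own (v i)) \<in> JM \<and> u.key (s.own (f (v i))) \<in> JT"
    and w: "\<And>i. i \<in> {z1, z2} \<Longrightarrow> w i \<in> X \<and> s.other (w i) = s.other i \<and> f (w i) \<in> X \<and> s.other (f (w i)) = s.other (f i)
        \<and> u.key (s.own (w i)) \<in> JM \<and> u.key (s.own (f (w i))) \<in> JB"
  shows "\<exists>Y\<in>fs. \<exists>T\<in>fs. u.key Y \<in> JM \<and> u.key T \<in> JT \<and>
    f (cross_point Y (s.other z1)) = cross_point T (s.other (f z1)) \<and>
    f (cross_point Y (s.other z2)) = cross_point T (s.other (f z2))"
proof -
  let ?\<rho> = "\<lambda>x. u.key (s.own x)"
  have between: "?\<rho> (f x) \<in> closed_segment (?\<rho> (f z)) (?\<rho> (f y))"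
    if "x \<in> X" "z \<in> X" "y \<in> X" "s.other x = B" "s.other z = B" "s.other y = B"
      "f z \<in> X" "f y \<in> X" "s.other (f z) = B'" "s.other (f y) = B'" "f x \<in> X"
      "?\<rho> x \<in> closed_segment (?\<rho> z) (?\<rho> y)" for x y z B B'
    using u.between_image(2)[OF f, of x z y B B'] that by (simp add: uX)
  \<comment> \<open>The point \<open>p\<close> is moved along its row to the column of
    \<open>i\<close>. \<open>move\<close> keeps the image on the row of \<open>f p\<close>; lying
    between \<open>i\<close> and \<open>q\<close> keeps it on the column of \<open>f i\<close>. So
    the image is again a crossing point.\<close>
  have transfer: "\<exists>v'. v' = cross_point (s.own p) (s.other i) \<and> f v' \<in> X \<and> s.own (f v') = s.own (f p) \<and> s.other (f v') = s.other (f i) \<and>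
      ?\<rho> (f v') \<in> closed_segment (?\<rho> (f i)) (?\<rho> (f q))"
    if p: "p \<in> X" "f p \<in> X" "s.key (s.other (f p)) \<in> IM" and i: "i \<in> X" "f i \<in> X" and q: "q \<in> X" "f q \<in> X"
      "s.other q = s.other i" "s.other (f q) = s.other (f i)"
      and cs: "?\<rho> p \<in> closed_segment (?\<rho> i) (?\<rho> q)" for p i q
  proof -
    let ?v = "cross_point (s.own p) (s.other i)"
    note v' = s.cross_in_X[OF s.XD(1)[OF p(1)] s.XD(3)[OF i(1)]]
    have own: "f ?v \<in> s.own (f p)" by (rule move[OF p v'(2)])
    have cs': "u.key (s.own ?v) \<in> closed_segment (?\<rho> i) (?\<rho> q)" using cs v'(4) by simp
    have other: "f ?v \<in> s.other (f i)"
      by (rule u.between_image(1)[OF f, of ?v i q "s.other i" "s.other (f i)"]) (use v' i q cs' in \<open>simp_all add: uX\<close>)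
    have fv: "f ?v \<in> X" using own other s.XD(1)[OF p(2)] s.XD(3)[OF i(2)] by (auto simp: s.X_def)
    moreover have "s.own (f ?v) = s.own (f p)" by (rule s.ownI[OF s.XD(1)[OF p(2)] own])
    moreover have "s.other (f ?v) = s.other (f i)" by (rule s.otherI[OF s.XD(3)[OF i(2)] other])
    moreover have "?\<rho> (f ?v) \<in> closed_segment (?\<rho> (f i)) (?\<rho> (f q))"
      by (rule between[of ?v i q "s.other i" "s.other (f i)"]) (use v' i q cs' fv in auto)
    ultimately show ?thesis by blast
  qed
  note V1 = v[of z1, simplified] and V2 = v[of z2, simplified] and W1 = w[of z1, simplified] and W2 = w[of z2, simplified]
  have no: "\<not> a \<in> closed_segment b c" if "a \<in> JT" "b \<in> JM" "c \<in> JB" for a b c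
    using sep that by (fastforce simp: closed_segment_eq_real_ivl split: if_splits)
  have no': "\<not> c \<in> closed_segment b a" if "a \<in> JT" "b \<in> JM" "c \<in> JB" for a b c
    using sep that by (fastforce simp: closed_segment_eq_real_ivl split: if_splits)
  \<comment> \<open>On one column \<open>v i\<close> and \<open>w i\<close> lie on opposite sides of
    \<open>i\<close>, since their images lie on opposite sides of \<open>f i\<close> and
    \<open>f\<close> preserves betweenness.\<close>
  have n: "\<not> ?\<rho> (v i) \<in> closed_segment (?\<rho> i) (?\<rho> (w i)) \<and> \<not> ?\<rho> (w i) \<in> closed_segment (?\<rho> i) (?\<rho> (v i))"
    if i: "i \<in> {z1, z2}" for i
  proof (intro conjI notI)
    have iX: "i \<in> X" "f i \<in> X" "?\<rho> (f i) \<in> JM" using i z by auto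
    note Vi = v[OF i] and Wi = w[OF i]
    {
      assume "?\<rho> (v i) \<in> closed_segment (?\<rho> i) (?\<rho> (w i))"
      then have "?\<rho> (f (v i)) \<in> closed_segment (?\<rho> (f i)) (?\<rho> (f (w i)))"
        by (intro between[of "v i" i "w i" "s.other i" "s.other (f i)"]) (use Vi Wi iX in simp_all)
      then show False using no[of "?\<rho> (f (v i))" "?\<rho> (f i)" "?\<rho> (f (w i))"] Vi Wi iX by simp
    next
      assume "?\<rho> (w i) \<in> closed_segment (?\<rho> i) (?\<rho> (v i))"
      then have "?\<rho> (f (w i)) \<in> closed_segment (?\<rho> (f i)) (?\<rho> (f (v i)))"
        by (intro between[of "w i" i "v i" "s.other i" "s.other (f i)"]) (use Vi Wi iX in simp_all)
      then show False using no'[of "?\<rho> (f (v i))" "?\<rho> (f i)" "?\<rho> (f (w i))"] Vi Wi iX by simp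
    }
  qed
  \<comment> \<open>The same for points of different columns, after transfer to one column; this
    shows that both columns meet \<open>JT\<close> on the same side of the row of \<open>z1\<close>
    and \<open>z2\<close>.\<close>
  have n3: "\<not> ?\<rho> (v z1) \<in> closed_segment (?\<rho> z2) (?\<rho> (w z2))"
  proof
    assume "?\<rho> (v z1) \<in> closed_segment (?\<rho> z2) (?\<rho> (w z2))"
    from transfer[OF _ _ _ z(2,4) _ _ _ _ this] obtain v' where
      "?\<rho> (f v') \<in> closed_segment (?\<rho> (f z2)) (?\<rho> (f (w z2)))" "s.own (f v') = s.own (f (v z1))"
      using V1 W2 z(6) by auto
    then show False using no[of "?\<rho> (f (v z1))" "?\<rho> (f z2)" "?\<rho> (f (w z2))"] V1 W2 z(9) by simp
  qed
  have n4: "\<not> ?\<rho> (w z2) \<in> closed_segment (?\<rho> z1) (?\<rho> (v z1))"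
  proof
    assume "?\<rho> (w z2) \<in> closed_segment (?\<rho> z1) (?\<rho> (v z1))"
    from transfer[OF _ _ _ z(1,3) _ _ _ _ this] obtain v' where
      "?\<rho> (f v') \<in> closed_segment (?\<rho> (f z1)) (?\<rho> (f (v z1)))" "s.own (f v') = s.own (f (w z2))"
      using V1 W2 z(7) by auto
    then show False using no'[of "?\<rho> (f (v z1))" "?\<rho> (f z1)" "?\<rho> (f (w z2))"] V1 W2 z(8) by simp
  qed
  \<comment> \<open>The nearer row, that of \<open>v i\<close>, lies between \<open>j\<close> and
    \<open>v j\<close> on the other column, as \<open>transfer\<close> requires.\<close>
  have final: "\<exists>Y\<in>fs. \<exists>T\<in>fs. u.key Y \<in> JM \<and> u.key T \<in> JT \<and>
      f (cross_point Y (s.other i)) = cross_point T (s.other (f i)) \<and>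
      f (cross_point Y (s.other j)) = cross_point T (s.other (f j))"
    if i: "i \<in> {z1, z2}" and j: "j \<in> {z1, z2}" and cs: "?\<rho> (v i) \<in> closed_segment (?\<rho> j) (?\<rho> (v j))" for i j
  proof -
    note Vi = v[OF i] and Vj = v[OF j]
    have p: "v i \<in> X" "f (v i) \<in> X" "s.key (s.other (f (v i))) \<in> IM" using Vi i z(6,7) by auto
    have jX: "j \<in> X" "f j \<in> X" using j z(1-4) by auto
    have q: "v j \<in> X" "f (v j) \<in> X" "s.other (v j) = s.other j" "s.other (f (v j)) = s.other (f j)"
      using Vj by simp_all
    obtain v' where v': "v' = cross_point (s.own (v i)) (s.other j)" "f v' \<in> X" "s.own (f v') = s.own (f (v i))"
      "s.other (f v') = s.other (f j)"
      using transfer[OF p jX q cs] by metis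
    have "f (cross_point (s.own (v i)) (s.other i)) = cross_point (s.own (f (v i))) (s.other (f i))"
      using s.XD(5)[OF p(1)] s.XD(5)[OF p(2)] Vi by simp
    moreover have "f (cross_point (s.own (v i)) (s.other j)) = cross_point (s.own (f (v i))) (s.other (f j))"
      using s.XD(5)[OF v'(2)] v' by simp
    ultimately show ?thesis
      using s.XD(1)[OF p(1)] s.XD(1)[OF p(2)] Vi by (intro bexI[of _ "s.own (v i)"] bexI[of _ "s.own (f (v i))"] conjI) simp_all
  qed
  have eq: "?\<rho> z2 = ?\<rho> z1" using z(5) by simp
  have "?\<rho> (v z1) \<in> closed_segment (?\<rho> z1) (?\<rho> (v z2)) \<or> ?\<rho> (v z2) \<in> closed_segment (?\<rho> z1) (?\<rho> (v z1))"
    using same_side[of "?\<rho> (v z1)" "?\<rho> z1" "?\<rho> (w z1)" "?\<rho> (v z2)" "?\<rho> (w z2)"] n[of z1] n[of z2] n3 n4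
    unfolding eq by simp
  then show ?thesis
    using final[of z1 z2] final[of z2 z1] unfolding eq by auto
qed

text \<open>From a return \<open>z\<close>, the points \<open>z1\<close> and \<open>z2\<close> are
  taken on its row to both sides of the block; contraction brings their images back into the block.
  On the columns of these images, points above and below the block are pulled back by the inverse,
  which contracts columns, to points near \<open>z1\<close> and \<open>z2\<close>.
  \<open>common_row\<close> then aligns the four points into two rows.\<close>

lemma crossing_corners:
  assumes hom: "homeomorphism S S F G" and inv: "distr \<mu> \<mu> F = \<mu>"
    and acts: "acts lam F Ts" "acts (inverse lam) F Tu" and lam: "lam > 1" and tame: "tame Ts" "tame Tu"
    and borel: "IL \<in> sets borel" "IM \<in> sets borel" "IR \<in> sets borel" "JB \<in> sets borel" "JM \<in> sets borel" "JT \<in> sets borel"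
    and sep: "\<forall>a\<in>IL. \<forall>b\<in>IM. \<forall>c\<in>IR. a < b \<and> b < c" "\<forall>a\<in>JT. \<forall>b\<in>JM. \<forall>c\<in>JB. c < b \<and> b < a"
    and \<kappa>: "\<kappa>1 > 0" "\<kappa>2 > 0"
    and mass: "\<And>I. I \<in> {IL, IM, IR} \<Longrightarrow> emeasure (s.smeas s.base) (s.base \<inter> s.cset I) = ennreal \<kappa>1"
      "\<And>J. J \<in> {JB, JM, JT} \<Longrightarrow> emeasure (u.smeas u.base) (u.base \<inter> u.cset J) = ennreal \<kappa>2"
  shows "\<exists>n>0. \<exists>X1\<in>fu. \<exists>X2\<in>fu. \<exists>X1'\<in>fu. \<exists>X2'\<in>fu. \<exists>Y1\<in>fs. \<exists>Y2\<in>fs. \<exists>T1\<in>fs. \<exists>T2\<in>fs.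
    s.key X1 \<in> IL \<and> s.key X2 \<in> IR \<and> s.key X1' \<in> IM \<and> s.key X2' \<in> IM \<and>
    u.key Y1 \<in> JM \<and> u.key Y2 \<in> JM \<and> u.key T1 \<in> JB \<and> u.key T2 \<in> JT \<and>
    (F ^^ n) (cross_point Y1 X1) = cross_point T1 X1' \<and> (F ^^ n) (cross_point Y1 X2) = cross_point T1 X2' \<and>
    (F ^^ n) (cross_point Y2 X1) = cross_point T2 X1' \<and> (F ^^ n) (cross_point Y2 X2) = cross_point T2 X2'"
proof -
  define C where "C = s.cset IM \<inter> u.cset JM"
  define D where "D = u.cset JM"
  have CD: "C \<in> sets \<mu>" "D \<in> sets \<mu>" "C \<subseteq> X" "D \<subseteq> X"
    using cset_sets borel by (auto simp: C_def D_def s.cset_def u.cset_def uX)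
  have XS: "X \<subseteq> S" using sets.sets_into_space[OF X_sets] space_mu by simp
  note Fm = homeomorphism_preserves(1)[OF hom inv]
  have "emeasure \<mu> C = ennreal \<kappa>1 * ennreal \<kappa>2"
    unfolding C_def using product_formula[OF borel(2,5) s.base u.base] mass by simp
  then have "measure \<mu> C > 0" using \<kappa> by (simp add: measure_def ennreal_mult[symmetric])
  then obtain c where c: "c > 0" "\<And>N. \<exists>n\<ge>N. n > 0 \<and> c \<le> measure \<mu> {x \<in> C. (F ^^ n) x \<in> C}"
    using quantitative_recurrence[OF Fm inv CD(1)] by blast
  define \<alpha> where "\<alpha> = measure (Ms s.base) (space (Ms s.base))"
  define \<beta> where "\<beta> = measure (Mu u.base) (space (Mu u.base))"
  \<comment> \<open>The coefficient of \<open>\<epsilon>\<close> in the hypothesis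
    \<open>arith\<close> of \<open>counting\<close>, so that its left side becomes
    \<open>\<epsilon> * M = c / 2\<close>.\<close>
  define M where "M = \<alpha> * (2 * (2 + 2 / \<kappa>2 * \<beta>) / \<kappa>1) + 1"
  have M: "M > 0"
  proof -
    have "\<alpha> \<ge> 0" "\<beta> \<ge> 0" by (simp_all add: \<alpha>_def \<beta>_def)
    then have "\<alpha> * (2 * (2 + 2 / \<kappa>2 * \<beta>) / \<kappa>1) \<ge> 0"
      using \<kappa> by (intro mult_nonneg_nonneg divide_nonneg_pos add_nonneg_nonneg) auto
    then show ?thesis by (simp add: M_def)
  qed
  define \<epsilon> where "\<epsilon> = c / (2 * M)"
  have \<epsilon>: "\<epsilon> > 0" using c M by (simp add: \<epsilon>_def)
  have "\<alpha> * (2 * (2 * \<epsilon> + 2 * \<epsilon> / \<kappa>2 * \<beta>) / \<kappa>1) + \<epsilon> = \<epsilon> * M"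
    by (simp add: M_def algebra_simps add_divide_distrib)
  also have "\<dots> = c / 2" using M by (simp add: \<epsilon>_def)
  also have "\<dots> < c" using c by simp
  finally have arith: "\<alpha> * (2 * (2 * \<epsilon> + 2 * \<epsilon> / \<kappa>2 * \<beta>) / \<kappa>1) + \<epsilon> < c" .
  \<comment> \<open>Two sets are approximated, each with half of \<open>\<epsilon>\<close>: the
    block \<open>C\<close> for the images of \<open>z1\<close> and \<open>z2\<close>, and the whole
    row strip \<open>D\<close> for points near \<open>z1\<close> and \<open>z2\<close>, whose
    columns lie outside the block.\<close>
  have \<epsilon>2: "\<epsilon> / 2 > 0" using \<epsilon> by simp
  obtain Z1 \<delta>1 where Z1: "Z1 \<in> sets \<mu>" "\<delta>1 > 0" "measure \<mu> Z1 < \<epsilon> / 2"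
    "\<forall>p\<in>C - Z1. \<forall>q\<in>S. dist p q < \<delta>1 \<longrightarrow> q \<in> C \<union> Z1"
    using uniform_approximation[OF finite_measure_axioms sets_mu CD(1) \<epsilon>2] by blast
  obtain Z2 \<delta>2 where Z2: "Z2 \<in> sets \<mu>" "\<delta>2 > 0" "measure \<mu> Z2 < \<epsilon> / 2"
    "\<forall>p\<in>D - Z2. \<forall>q\<in>S. dist p q < \<delta>2 \<longrightarrow> q \<in> D \<union> Z2"
    using uniform_approximation[OF finite_measure_axioms sets_mu CD(2) \<epsilon>2] by blast
  define Z where "Z = Z1 \<union> Z2"
  define \<delta> where "\<delta> = min \<delta>1 \<delta>2"
  have Z: "Z \<in> sets \<mu>" "measure \<mu> Z < \<epsilon>"
  proof -
    show "Z \<in> sets \<mu>" using Z1 Z2 by (simp add: Z_def)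
    show "measure \<mu> Z < \<epsilon>"
      using measure_Un_le[OF Z1(1) Z2(1)] Z1(3) Z2(3) unfolding Z_def by linarith
  qed
  have \<delta>: "\<delta> > 0" using Z1 Z2 by (simp add: \<delta>_def)
  have near_C: "q \<in> C" if "p \<in> C - Z" "q \<in> S" "dist p q < \<delta>" "q \<notin> Z" for p q
    using Z1(4) that by (auto simp: Z_def \<delta>_def)
  have near_D: "q \<in> D" if "p \<in> D - Z" "q \<in> S" "dist p q < \<delta>" "q \<notin> Z" for p q
    using Z2(4) that by (auto simp: Z_def \<delta>_def)
  obtain ds where ds: "ds > 0" "\<forall>(L, N)\<in>Ts. \<forall>p\<in>topspace L. \<forall>q\<in>topspace L.
      emeasure N (arc_between L p q) < ennreal ds \<longrightarrow> dist p q < \<delta>"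
    using tame_arc_between[OF tame(1) \<delta> s.turb] by blast
  obtain du where du: "du > 0" "\<forall>(L, N)\<in>Tu. \<forall>p\<in>topspace L. \<forall>q\<in>topspace L.
      emeasure N (arc_between L p q) < ennreal du \<longrightarrow> dist p q < \<delta>"
    using tame_arc_between[OF tame(2) \<delta> u.turb] by blast
  \<comment> \<open>Once \<open>lam ^ n\<close> exceeds these ratios, a contracted fiber is lighter
    than the guarding strips (\<open>\<kappa>1\<close>, \<open>\<kappa>2\<close>) and light enough
    for tameness (\<open>ds\<close>, \<open>du\<close>).\<close>
  define R where "R = max (max (s.K / \<kappa>1) (s.K / ds)) (max (u.K / \<kappa>2) (u.K / du))"
  obtain N where N: "R < lam ^ N" using real_arch_pow[OF lam] by blast
  obtain n where n: "n \<ge> N" "n > 0" "c \<le> measure \<mu> {x \<in> C. (F ^^ n) x \<in> C}" using c(2) by blast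
  define f where "f = F ^^ n"
  define g where "g = G ^^ n"
  define b where "b = lam ^ n"
  have "R < b" using N power_increasing[OF n(1), of lam] lam unfolding b_def by linarith
  then have b: "s.K < b * \<kappa>1" "s.K < b * ds" "u.K < b * \<kappa>2" "u.K < b * du" "b > 0"
    using \<kappa> ds(1) du(1) lam by (simp_all add: R_def pos_divide_less_eq b_def)
  have homf: "homeomorphism S S f g" unfolding f_def g_def by (rule homeomorphism_funpow[OF hom])
  have gf: "g (f x) = x" "f (g x) = x" "f x \<in> S" "g x \<in> S" if "x \<in> S" for x
    using homf that by (auto simp: homeomorphism_def)
  have invf: "distr \<mu> \<mu> f = \<mu>" unfolding f_def using distr_funpow[OF Fm inv] by blast
  note pres = homeomorphism_preserves[OF homf invf]
  have af: "acts b f Ts" unfolding b_def f_def by (rule acts_funpow[OF acts(1)]) (use lam in simp)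
  have af': "acts (inverse lam ^ n) f Tu" unfolding f_def by (rule acts_funpow[OF acts(2)]) (use lam in simp)
  \<comment> \<open>The inverse contracts unstable fibers by the same factor \<open>b\<close>, so
    the estimates for contracted fibers apply to \<open>g\<close> with the two directions
    exchanged.\<close>
  have "acts (1 / inverse lam ^ n) g Tu"
    by (rule acts_inverse[OF af' _ gf(1) u.turb]) (use lam in simp)
  moreover have "1 / inverse lam ^ n = b" unfolding b_def power_inverse by (simp add: divide_inverse)
  ultimately have ag: "acts b g Tu" by simp
  have "c \<le> measure \<mu> {x \<in> C. f x \<in> C}" using n(3) by (simp add: f_def)
  from counting[OF pres(1) invf pres(2,3) Z borel \<kappa> mass(1)[of IL] mass(1)[of IR] mass(2)[of JB] mass(2)[of JT]
      C_def this arith[unfolded \<alpha>_def \<beta>_def]]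
  obtain z z1 z2 where z: "z \<in> C" "f z \<in> C - Z" "z1 \<in> s.cset IL" "z2 \<in> s.cset IR" "s.own z1 = s.own z" "s.own z2 = s.own z"
    and zz: "\<forall>v\<in>{z1, z2}. v \<notin> Z \<and> f v \<notin> Z \<and> (f v \<in> X \<longrightarrow>
      (\<exists>w\<in>u.cset JT. s.other w = s.other (f v) \<and> g w \<notin> Z) \<and> (\<exists>w\<in>u.cset JB. s.other w = s.other (f v) \<and> g w \<notin> Z))"
    by auto
  have zX: "z \<in> X" "f z \<in> X" using z(1,2) CD by auto
  have z12: "i \<in> X" "s.own i = s.own z" "i \<notin> Z" "f i \<notin> Z" "i \<in> D" if "i \<in> {z1, z2}" for i
  proof -
    show iX: "i \<in> X" and io: "s.own i = s.own z" and "i \<notin> Z" "f i \<notin> Z"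
      using that z zz by (auto simp: s.cset_def)
    show "i \<in> D" using z(1) iX io by (auto simp: C_def D_def u.cset_def uX)
  qed
  \<comment> \<open>The contracted row brings \<open>f i\<close> near \<open>f z\<close>, a point of
    \<open>C - Z\<close>; as \<open>f i\<close> avoids \<open>Z\<close>, it belongs to
    \<open>C\<close>, in particular to the crossing set.\<close>
  have fi: "f i \<in> C" if i: "i \<in> {z1, z2}" for i
  proof (rule near_C[OF z(2) _ _ z12(4)[OF i]])
    show "f i \<in> S" using z12(1)[OF i] XS gf(3) by blast
    have "i \<in> s.own z" using s.XD(2)[OF z12(1)[OF i]] z12(2)[OF i] by simp
    then show "dist (f z) (f i) < \<delta>"
      by (rule s.images_close[OF af b(2,5) s.XD(1,2)[OF zX(1)] _ ds(2)])
  qed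
  have move: "f w \<in> s.own (f v)" if v: "v \<in> X" "f v \<in> X" "s.key (s.other (f v)) \<in> IM" and w: "w \<in> s.own v" for v w
  proof (rule s.image_in_own[OF af b(1,5) v(1,2) w])
    let ?A = "s.own (f v)"
    have A: "?A \<in> fs" by (rule s.XD(1)[OF v(2)])
    show "?A \<inter> s.cset IL \<subseteq> ?A \<inter> s.X" "?A \<inter> s.cset IR \<subseteq> ?A \<inter> s.X" by (auto simp: s.cset_def)
    show "s.key (s.other x) < s.key (s.other (f v))" if "x \<in> ?A \<inter> s.cset IL" for x
    proof -
      \<comment> \<open>\<open>sep\<close> compares three sets at once, so comparing two of them
        takes a member of the third.\<close>
      obtain y where "y \<in> IR" using z(4) by (auto simp: s.cset_def)
      then show ?thesis using that sep(1) v(3) by (auto simp: s.cset_def)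
    qed
    show "s.key (s.other (f v)) < s.key (s.other x)" if "x \<in> ?A \<inter> s.cset IR" for x
    proof -
      obtain y where "y \<in> IL" using z(3) by (auto simp: s.cset_def)
      then show ?thesis using that sep(1) v(3) by (auto simp: s.cset_def)
    qed
    show "ennreal \<kappa>1 \<le> emeasure (s.smeas ?A) (?A \<inter> s.cset IL)" "ennreal \<kappa>1 \<le> emeasure (s.smeas ?A) (?A \<inter> s.cset IR)"
      using holonomy_invariance(1)[OF borel(1) A s.base] holonomy_invariance(1)[OF borel(3) A s.base] mass(1) by simp_all
  qed
  have neJ: "JB \<noteq> {}" "JT \<noteq> {}"
    using mass(2)[of JB] mass(2)[of JT] \<kappa>(2) by (auto simp: u.cset_def)
  have ex: "\<exists>p. p \<in> X \<and> s.other p = s.other i \<and> f p \<in> X \<and> s.other (f p) = s.other (f i) \<and>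
      u.key (s.own p) \<in> JM \<and> u.key (s.own (f p)) \<in> J"
    if i: "i \<in> {z1, z2}" and J: "J = JT \<or> J = JB" for i J
  proof -
    have iX: "i \<in> X" "f i \<in> X" using z12(1)[OF i] fi[OF i] CD by auto
    have iS: "i \<in> S" using iX XS by blast
    obtain w where w: "w \<in> u.cset J" "s.other w = s.other (f i)" "g w \<notin> Z" using zz i iX(2) J by blast
    have wX: "w \<in> X" and wk: "u.key (s.own w) \<in> J" using w(1) by (simp_all add: u.cset_def uX)
    have wS: "w \<in> S" using wX XS by blast
    have wo: "w \<in> u.own (f i)" using s.XD(4)[OF wX] w(2) by simp
    have "dist (g (f i)) (g w) < \<delta>"
      by (rule u.images_close[OF ag b(4,5) _ _ wo du(2)]) (use iX u.XD[of "f i"] in \<open>simp_all add: uX\<close>)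
    then have d: "dist i (g w) < \<delta>" using gf(1)[OF iS] by simp
    have iD: "i \<in> D - Z" using z12[OF i] by blast
    \<comment> \<open>Although \<open>w\<close> lies in the strip above or below the block,
      \<open>g w\<close> is near \<open>i\<close> and so returns to the strip
      \<open>JM\<close>.\<close>
    have gD: "g w \<in> D" by (rule near_D[OF iD gf(4)[OF wS] d w(3)])
    have gX: "g w \<in> X" "u.key (s.own (g w)) \<in> JM" using gD by (simp_all add: D_def u.cset_def uX)
    have ik: "u.key (s.own i) \<in> JM" using iD by (simp add: D_def u.cset_def)
    have "g w \<in> u.own (g (f i))"
    proof (rule u.image_in_own[OF ag b(3,5) _ _ wo])
      show "f i \<in> u.X" "g (f i) \<in> u.X" using iX gf(1)[OF iS] by (simp_all add: uX)
      let ?A = "u.own (g (f i))"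
      have A: "?A \<in> fu" using s.XD(3)[OF iX(1)] gf(1)[OF iS] by simp
      show "?A \<inter> u.cset JB \<subseteq> ?A \<inter> u.X" "?A \<inter> u.cset JT \<subseteq> ?A \<inter> u.X" by (auto simp: u.cset_def)
      show "u.key (u.other x) < u.key (u.other (g (f i)))" if "x \<in> ?A \<inter> u.cset JB" for x
        using that sep(2) ik neJ gf(1)[OF iS] by (auto simp: u.cset_def)
      show "u.key (u.other (g (f i))) < u.key (u.other x)" if "x \<in> ?A \<inter> u.cset JT" for x
        using that sep(2) ik neJ gf(1)[OF iS] by (auto simp: u.cset_def)
      show "ennreal \<kappa>2 \<le> emeasure (u.smeas ?A) (?A \<inter> u.cset JB)" "ennreal \<kappa>2 \<le> emeasure (u.smeas ?A) (?A \<inter> u.cset JT)"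
        using holonomy_invariance(2)[OF borel(4) A u.base] holonomy_invariance(2)[OF borel(6) A u.base] mass(2) by simp_all
    qed
    then have "g w \<in> s.other i" using gf(1)[OF iS] by simp
    then have "s.other (g w) = s.other i" by (rule s.otherI[OF s.XD(3)[OF iX(1)]])
    then show ?thesis using gX wX w(2) wk gf(2)[OF wS] by (intro exI[of _ "g w"]) simp
  qed
  obtain v where v: "\<And>i. i \<in> {z1, z2} \<Longrightarrow> v i \<in> X \<and> s.other (v i) = s.other i \<and> f (v i) \<in> X \<and> s.other (f (v i)) = s.other (f i)
        \<and> u.key (s.own (v i)) \<in> JM \<and> u.key (s.own (f (v i))) \<in> JT"
    using ex[of _ JT] by metis
  obtain w where w: "\<And>i. i \<in> {z1, z2} \<Longrightarrow> w i \<in> X \<and> s.other (w i) = s.other i \<and> f (w i) \<in> X \<and> s.other (f (w i)) = s.other (f i)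
        \<and> u.key (s.own (w i)) \<in> JM \<and> u.key (s.own (f (w i))) \<in> JB"
    using ex[of _ JB] by metis
  have zs: "z1 \<in> X" "z2 \<in> X" "f z1 \<in> X" "f z2 \<in> X" "s.own z1 = s.own z2"
    "s.key (s.other (f z1)) \<in> IM" "s.key (s.other (f z2)) \<in> IM"
    "u.key (s.own (f z1)) \<in> JM" "u.key (s.own (f z2)) \<in> JM"
    using z12(1,2)[of z1] z12(1,2)[of z2] fi[of z1] fi[of z2] by (simp_all add: C_def s.cset_def u.cset_def)
  have sep': "\<forall>a\<in>JB. \<forall>b\<in>JM. \<forall>c\<in>JT. a < b \<and> b < c" using sep(2) by blast
  obtain Y2 T2 where YT2: "Y2 \<in> fs" "T2 \<in> fs" "u.key Y2 \<in> JM" "u.key T2 \<in> JT"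
    "f (cross_point Y2 (s.other z1)) = cross_point T2 (s.other (f z1))" "f (cross_point Y2 (s.other z2)) = cross_point T2 (s.other (f z2))"
    using common_row[OF af' move zs disjI1[OF sep(2)] v w] by blast
  obtain Y1 T1 where YT1: "Y1 \<in> fs" "T1 \<in> fs" "u.key Y1 \<in> JM" "u.key T1 \<in> JB"
    "f (cross_point Y1 (s.other z1)) = cross_point T1 (s.other (f z1))" "f (cross_point Y1 (s.other z2)) = cross_point T1 (s.other (f z2))"
    using common_row[OF af' move zs disjI2[OF sep'] w v] by blast
  note mem = s.XD(3)[OF zs(1)] s.XD(3)[OF zs(2)] s.XD(3)[OF zs(3)] s.XD(3)[OF zs(4)]
  have "s.key (s.other z1) \<in> IL" "s.key (s.other z2) \<in> IR" using z(3,4) by (simp_all add: s.cset_def)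
  then have "s.key (s.other z1) \<in> IL \<and> s.key (s.other z2) \<in> IR \<and> s.key (s.other (f z1)) \<in> IM \<and> s.key (s.other (f z2)) \<in> IM \<and>
    u.key Y1 \<in> JM \<and> u.key Y2 \<in> JM \<and> u.key T1 \<in> JB \<and> u.key T2 \<in> JT \<and>
    (F ^^ n) (cross_point Y1 (s.other z1)) = cross_point T1 (s.other (f z1)) \<and>
    (F ^^ n) (cross_point Y1 (s.other z2)) = cross_point T1 (s.other (f z2)) \<and>
    (F ^^ n) (cross_point Y2 (s.other z1)) = cross_point T2 (s.other (f z1)) \<and>
    (F ^^ n) (cross_point Y2 (s.other z2)) = cross_point T2 (s.other (f z2))"
    unfolding f_def[symmetric] by (intro conjI zs YT1 YT2)
  then show ?thesis
    by - (rule exI[of _ n], rule conjI[OF n(2)], rule bexI[OF _ mem(1)], rule bexI[OF _ mem(2)],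
        rule bexI[OF _ mem(3)], rule bexI[OF _ mem(4)], rule bexI[OF _ YT1(1)], rule bexI[OF _ YT2(1)],
        rule bexI[OF _ YT1(2)], rule bexI[OF _ YT2(2)])
qed

end

section \<open>Periodic points\<close>

lemma cross_point_commute: "cross_point A B = cross_point B A"
  by (simp add: cross_point_def Int_commute)

text \<open>A streamline is connected as an image of the real line, and \<open>S\<close> lies
  between it and its closure. The set of streamlines is nonempty because it covers measure
  one.\<close>

lemma measured_turbulation_connected:
  assumes S: "compact S" and T: "measured_turbulation S \<mu> T" and dense: "dense_streamlines S T"
  shows "connected S"
proof -
  have "emeasure \<mu> (\<Union>(L, N)\<in>T. topspace L) = 1" using T by (simp add: measured_turbulation_def)
  then have "T \<noteq> {}" by auto
  then obtain L N where LN: "(L, N) \<in> T" by auto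
  note D = measured_turbulationD[OF T LN]
  obtain h where h: "line_param L h" using immersed_line_param[OF D(1)] by blast
  have "connected (range h)"
    by (intro connected_continuous_image immersed_line_continuous[OF D(1) h]) simp
  then have "connected (topspace L)" using line_paramD(3)[OF h] by simp
  moreover have "S \<subseteq> closure (topspace L)" using dense LN unfolding dense_streamlines_def by blast
  ultimately show ?thesis using connected_intermediate_closure D(4) by blast
qed

section \<open>From the tartan to a grid of arcs in the plane\<close>

context fiber_family
begin

definition dom :: "'a set \<Rightarrow> real set" where "dom A = inv (par A) ` A"

lemma par_dom: assumes "A \<in> fs" shows "par A ` dom A = A"
proof -
  have "par A (inv (par A) x) = x" if "x \<in> A" for x
    using parD(4)[OF assms] line_smeas(3)[OF assms] that by blast
  then show ?thesis by (force simp: dom_def)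
qed

lemma convex_dom: assumes "A \<in> fs" shows "convex (dom A)"
  unfolding convex_contains_segment
proof (intro ballI)
  fix a b assume "a \<in> dom A" "b \<in> dom A"
  then obtain p q where pq: "p \<in> A" "q \<in> A" "a = inv (par A) p" "b = inv (par A) q" by (auto simp: dom_def)
  have t: "p \<in> topspace (line A)" "q \<in> topspace (line A)" using pq line_smeas(3)[OF assms] by blast+
  have "par A ` closed_segment a b \<subseteq> A"
    using stream_arcD(3)[OF line_smeas(2)[OF assms] pq(1,2)] arc_between_eq[OF par[OF assms] t] pq by simp
  show "closed_segment a b \<subseteq> dom A"
  proof
    fix x assume "x \<in> closed_segment a b"
    then have "par A x \<in> A" using \<open>par A ` closed_segment a b \<subseteq> A\<close> by blast
    then have "inv (par A) (par A x) \<in> dom A" unfolding dom_def by (rule imageI)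
    then show "x \<in> dom A" using parD(5)[OF assms] by simp
  qed
qed

lemma par_continuous: "A \<in> fs \<Longrightarrow> continuous_on UNIV (par A)"
  using immersed_line_continuous[OF measured_turbulationD(1)[OF turb line_smeas(1)] par] .

lemma cross_in_dom: "A \<in> fs \<Longrightarrow> B \<in> gs \<Longrightarrow> inv (par A) (cross_point A B) \<in> dom A"
  using cross_in_X(2) by (auto simp: dom_def)

lemma par_cross: "A \<in> fs \<Longrightarrow> B \<in> gs \<Longrightarrow> par A (inv (par A) (cross_point A B)) = cross_point A B"
  using parD(4) cross_in_X(2) line_smeas(3) by blast

lemma arc_between_cross:
  assumes "A \<in> fs" "B \<in> gs" "B' \<in> gs"
  shows "arc_between (line A) (cross_point A B) (cross_point A B') =
      par A ` closed_segment (inv (par A) (cross_point A B)) (inv (par A) (cross_point A B'))"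
    and "arc_between (line A) (cross_point A B) (cross_point A B') \<subseteq> A"
proof -
  have t: "cross_point A B \<in> A" "cross_point A B' \<in> A" using cross_in_X(2) assms by blast+
  then show "arc_between (line A) (cross_point A B) (cross_point A B') =
      par A ` closed_segment (inv (par A) (cross_point A B)) (inv (par A) (cross_point A B'))"
    using arc_between_eq[OF par[OF assms(1)]] line_smeas(3)[OF assms(1)] by blast
  show "arc_between (line A) (cross_point A B) (cross_point A B') \<subseteq> A"
    by (rule stream_arcD(3)[OF line_smeas(2)[OF assms(1)] t])
qed

lemma image_arc_cross:
  assumes f: "acts c f T" and mem: "A \<in> fs" "B \<in> gs" "B' \<in> gs" "A' \<in> fs" "C \<in> gs" "C' \<in> gs"
    and eq: "f (cross_point A B) = cross_point A' C" "f (cross_point A B') = cross_point A' C'"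
  shows "f ` arc_between (line A) (cross_point A B) (cross_point A B') =
    arc_between (line A') (cross_point A' C) (cross_point A' C')"
  unfolding eq[symmetric]
  by (rule image_arc[OF f]) (use mem cross_in_X eq in simp_all)

end

context tartan_pair
begin

text \<open>Unstable fibers become columns and stable ones rows. Fibers may be open, half-open or
  closed arcs, which is why a grid asks only for convex parameter domains.\<close>

lemma grid_in_chart:
  assumes \<phi>: "homeomorphism (UNIV :: complex set) U \<phi> \<theta>" and sub: "\<Union>fs \<union> \<Union>fu \<subseteq> U"
  shows "grid fu fs s.key u.key (\<lambda>B. \<theta> \<circ> u.par B) (\<lambda>A. \<theta> \<circ> s.par A) u.dom s.dom
    (\<lambda>B A. inv (u.par B) (cross_point B A)) (\<lambda>A B. inv (s.par A) (cross_point A B)) (\<lambda>B A. \<theta> (cross_point A B))"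
proof -
  have \<theta>c: "continuous_on U \<theta>" using \<phi> by (simp add: homeomorphism_def)
  have \<theta>i: "inj_on \<theta> U" by (rule inj_on_inverseI[of _ \<phi>]) (rule homeomorphism_apply2[OF \<phi>])
  have su: "A \<in> fs \<Longrightarrow> A \<subseteq> U" "B \<in> fu \<Longrightarrow> B \<subseteq> U" for A B using sub by blast+
  have ims: "(\<theta> \<circ> s.par A) ` s.dom A = \<theta> ` A" if "A \<in> fs" for A
    unfolding image_comp[symmetric] s.par_dom[OF that] ..
  have imu: "(\<theta> \<circ> u.par B) ` u.dom B = \<theta> ` B" if "B \<in> fu" for B
    unfolding image_comp[symmetric] u.par_dom[OF that] ..
  show ?thesis
  proof
    show "convex (u.dom B)" if "B \<in> fu" for B by (rule u.convex_dom[OF that])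
    show "convex (s.dom A)" if "A \<in> fs" for A by (rule s.convex_dom[OF that])
    show "continuous_on (u.dom B) (\<theta> \<circ> u.par B)" if "B \<in> fu" for B
      using u.par_dom[OF that] su(2)[OF that]
      by (intro continuous_on_compose continuous_on_subset[OF u.par_continuous[OF that]] continuous_on_subset[OF \<theta>c]) auto
    show "continuous_on (s.dom A) (\<theta> \<circ> s.par A)" if "A \<in> fs" for A
      using s.par_dom[OF that] su(1)[OF that]
      by (intro continuous_on_compose continuous_on_subset[OF s.par_continuous[OF that]] continuous_on_subset[OF \<theta>c]) auto
    show "inj_on (\<theta> \<circ> u.par B) (u.dom B)" if "B \<in> fu" for B
      using u.par_dom[OF that] su(2)[OF that]
      by (intro comp_inj_on inj_on_subset[OF u.parD(2)[OF that]] inj_on_subset[OF \<theta>i]) auto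
    show "inj_on (\<theta> \<circ> s.par A) (s.dom A)" if "A \<in> fs" for A
      using s.par_dom[OF that] su(1)[OF that]
      by (intro comp_inj_on inj_on_subset[OF s.parD(2)[OF that]] inj_on_subset[OF \<theta>i]) auto
    show "inv (u.par B) (cross_point B A) \<in> u.dom B" if "B \<in> fu" "A \<in> fs" for B A
      by (rule u.cross_in_dom[OF that])
    show "inv (s.par A) (cross_point A B) \<in> s.dom A" if "B \<in> fu" "A \<in> fs" for B A
      by (rule s.cross_in_dom[OF that(2,1)])
    show "(\<theta> \<circ> u.par B) (inv (u.par B) (cross_point B A)) = \<theta> (cross_point A B)" if "B \<in> fu" "A \<in> fs" for B A
      using u.par_cross[OF that] cross_point_commute[of A B] by simp
    show "(\<theta> \<circ> s.par A) (inv (s.par A) (cross_point A B)) = \<theta> (cross_point A B)" if "B \<in> fu" "A \<in> fs" for B A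
      using s.par_cross[OF that(2,1)] by simp
    show "inv (u.par B) (cross_point B A) < inv (u.par B) (cross_point B A') \<longleftrightarrow> u.key A < u.key A'"
      if "B \<in> fu" "A \<in> fs" "A' \<in> fs" for B A A'
      by (rule u.cross_order[OF that])
    show "inv (s.par A) (cross_point A B) < inv (s.par A) (cross_point A B') \<longleftrightarrow> s.key B < s.key B'"
      if "A \<in> fs" "B \<in> fu" "B' \<in> fu" for A B B'
      by (rule s.cross_order[OF that])
    show "(\<theta> \<circ> u.par B) ` u.dom B \<inter> (\<theta> \<circ> s.par A) ` s.dom A = {\<theta> (cross_point A B)}" if "B \<in> fu" "A \<in> fs" for B A
    proof -
      have "\<theta> ` B \<inter> \<theta> ` A = \<theta> ` (A \<inter> B)"
        using inj_on_image_Int[OF \<theta>i su(1)[OF that(2)] su(2)[OF that(1)]] by (simp add: Int_commute)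
      then show ?thesis unfolding ims[OF that(2)] imu[OF that(1)] s.cross[OF that(2,1)] by simp
    qed
    show "(\<theta> \<circ> u.par B) ` u.dom B \<inter> (\<theta> \<circ> u.par B') ` u.dom B' = {}" if "B \<in> fu" "B' \<in> fu" "B \<noteq> B'" for B B'
    proof -
      have "B \<inter> B' = {}" using u.fs_disj that by (simp add: pairwise_def disjnt_def)
      then show ?thesis
        using inj_on_image_Int[OF \<theta>i su(2)[OF that(1)] su(2)[OF that(2)]] unfolding imu[OF that(1)] imu[OF that(2)] by simp
    qed
    show "(\<theta> \<circ> s.par A) ` s.dom A \<inter> (\<theta> \<circ> s.par A') ` s.dom A' = {}" if "A \<in> fs" "A' \<in> fs" "A \<noteq> A'" for A A'
    proof -
      have "A \<inter> A' = {}" using s.fs_disj that by (simp add: pairwise_def disjnt_def)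
      then show ?thesis
        using inj_on_image_Int[OF \<theta>i su(1)[OF that(1)] su(1)[OF that(2)]] unfolding ims[OF that(1)] ims[OF that(2)] by simp
    qed
  qed
qed

lemma fixed_point_of_corners:
  assumes S: "compact S" "connected S" and hom: "homeomorphism S S f g" and inv: "distr \<mu> \<mu> f = \<mu>"
    and acts: "acts c f Ts" "acts d f Tu"
    and U: "openin (top_of_set S) U" "measure \<mu> U < 1 / 2" and \<phi>: "homeomorphism (UNIV :: complex set) U \<phi> \<theta>"
    and sub: "\<Union>fs \<union> \<Union>fu \<subseteq> U"
    and mem: "i \<in> fu" "j \<in> fu" "X1 \<in> fu" "X2 \<in> fu" "X1' \<in> fu" "X2' \<in> fu"
      "k \<in> fs" "l \<in> fs" "Y1 \<in> fs" "Y2 \<in> fs" "T1 \<in> fs" "T2 \<in> fs"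
    and good: "grid.good fu fs s.key u.key (\<lambda>B. \<theta> \<circ> u.par B) (\<lambda>A. \<theta> \<circ> s.par A)
      (\<lambda>B A. inv (u.par B) (cross_point B A)) (\<lambda>A B. inv (s.par A) (cross_point A B)) (\<lambda>B A. \<theta> (cross_point A B)) i j k l"
    and lt: "s.key i < s.key X1" "s.key X1 < s.key X1'" "s.key X1' < s.key X2" "s.key X1 < s.key X2'" "s.key X2' < s.key X2" "s.key X2 < s.key j"
    and lt': "u.key k < u.key T1" "u.key T1 < u.key Y1" "u.key Y1 < u.key T2" "u.key T1 < u.key Y2" "u.key Y2 < u.key T2" "u.key T2 < u.key l"
    and corners: "f (cross_point Y1 X1) = cross_point T1 X1'" "f (cross_point Y1 X2) = cross_point T1 X2'"
      "f (cross_point Y2 X1) = cross_point T2 X1'" "f (cross_point Y2 X2) = cross_point T2 X2'"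
  shows "\<exists>x\<in>U. f x = x"
proof -
  interpret gr: grid fu fs s.key u.key "\<lambda>B. \<theta> \<circ> u.par B" "\<lambda>A. \<theta> \<circ> s.par A" u.dom s.dom
    "\<lambda>B A. inv (u.par B) (cross_point B A)" "\<lambda>A B. inv (s.par A) (cross_point A B)" "\<lambda>B A. \<theta> (cross_point A B)"
    by (rule grid_in_chart[OF \<phi> sub])
  have US: "U \<subseteq> S" using openin_subset[OF U(1)] by simp
  have \<theta>\<phi>: "\<theta> (\<phi> z) = z" and \<phi>U: "\<phi> z \<in> U" for z using \<phi> by (auto simp: homeomorphism_def)
  have \<phi>\<theta>: "\<phi> (\<theta> x) = x" if "x \<in> U" for x using \<phi> that by (auto simp: homeomorphism_def)
  have \<phi>\<theta>_im: "\<phi> ` \<theta> ` A = A" if "A \<subseteq> U" for A using \<phi>\<theta> that by force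
  have fi: "inj_on f S" by (rule inj_on_inverseI[of _ g]) (rule homeomorphism_apply1[OF hom])
  have fu_vs: "gr.vs B A A' = \<theta> ` arc_between (u.line B) (cross_point B A) (cross_point B A')"
    if "B \<in> fu" "A \<in> fs" "A' \<in> fs" for A A' B
    unfolding gr.vs_eq u.arc_between_cross(1)[OF that] by (simp add: image_comp)
  have fs_vs: "gr.T.vs A B B' = \<theta> ` arc_between (s.line A) (cross_point A B) (cross_point A B')"
    if "A \<in> fs" "B \<in> fu" "B' \<in> fu" for A B B'
    unfolding gr.T.vs_eq s.arc_between_cross(1)[OF that] by (simp add: image_comp)
  have im_u: "f ` \<phi> ` gr.vs B A A' = \<phi> ` gr.vs B' C C'"
    if "B \<in> fu" "A \<in> fs" "A' \<in> fs" "B' \<in> fu" "C \<in> fs" "C' \<in> fs"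
      "f (cross_point A B) = cross_point C B'" "f (cross_point A' B) = cross_point C' B'" for A A' B B' C C'
  proof -
    have sU: "arc_between (u.line B) (cross_point B A) (cross_point B A') \<subseteq> U"
      "arc_between (u.line B') (cross_point B' C) (cross_point B' C') \<subseteq> U"
      using u.arc_between_cross(2) that sub by blast+
    show ?thesis
      unfolding fu_vs[OF that(1-3)] fu_vs[OF that(4-6)] \<phi>\<theta>_im[OF sU(1)] \<phi>\<theta>_im[OF sU(2)]
      by (rule u.image_arc_cross[OF acts(2) that(1-6)]) (use that(7,8) cross_point_commute in metis)+
  qed
  have im_s: "f ` \<phi> ` gr.T.vs A B B' = \<phi> ` gr.T.vs A' C C'"
    if "A \<in> fs" "B \<in> fu" "B' \<in> fu" "A' \<in> fs" "C \<in> fu" "C' \<in> fu"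
      "f (cross_point A B) = cross_point A' C" "f (cross_point A B') = cross_point A' C'" for A A' B B' C C'
  proof -
    have sU: "arc_between (s.line A) (cross_point A B) (cross_point A B') \<subseteq> U"
      "arc_between (s.line A') (cross_point A' C) (cross_point A' C') \<subseteq> U"
      using s.arc_between_cross(2) that sub by blast+
    show ?thesis
      unfolding fs_vs[OF that(1-3)] fs_vs[OF that(4-6)] \<phi>\<theta>_im[OF sU(1)] \<phi>\<theta>_im[OF sU(2)]
      by (rule s.image_arc_cross[OF acts(1) that])
  qed
  note sides = im_s[OF mem(9,3,4,11,5,6) corners(1,2)] im_s[OF mem(10,3,4,12,5,6) corners(3,4)]
    im_u[OF mem(3,9,10,5,11,12) corners(1,3)] im_u[OF mem(4,9,10,6,11,12) corners(2,4)]
  let ?J = "gr.frame X1 X2 Y1 Y2" and ?J' = "gr.frame X1' X2' T1 T2"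
  have fJ: "f ` \<phi> ` ?J = \<phi> ` ?J'"
    unfolding gr.frame_def image_Un sides ..
  have cross_S: "cross_point A B \<in> S" if "A \<in> fs" "B \<in> fu" for A B
    using s.cross_in_X(2)[OF that] that(1) sub US by blast
  \<comment> \<open>The order hypotheses place both columns between \<open>X1\<close> and
    \<open>X2\<close> without separating them; injectivity of \<open>f\<close> does.\<close>
  have "X1' \<noteq> X2'"
  proof
    assume "X1' = X2'"
    then have "cross_point Y1 X1 = cross_point Y1 X2"
      using inj_onD[OF fi] corners(1,2) cross_S mem by metis
    then have "X1 = X2" using s.cross_in_X(5) mem by metis
    then show False using lt by simp
  qed
  then have kne: "s.key X1' \<noteq> s.key X2'" using s.key_inj mem by blast
  have "Y1 \<noteq> Y2"
  proof
    assume "Y1 = Y2"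
    then have "cross_point T1 X1' = cross_point T2 X1'" using corners by metis
    then have "T1 = T2" using s.cross_in_X(4) mem by metis
    then show False using lt' by simp
  qed
  then have kne': "u.key Y1 \<noteq> u.key Y2" using u.key_inj mem by blast
  have ne: "s.key X1 \<noteq> s.key X2" "u.key T1 \<noteq> u.key T2" using lt lt' by auto
  note R = gr.frame_region[OF mem(3,4,9,10) ne(1) kne'] and R' = gr.frame_region[OF mem(5,6,11,12) kne ne(2)]
  note E = gr.frame_eqs[OF mem(3,4,9,10) ne(1) kne'] and E' = gr.frame_eqs[OF mem(5,6,11,12) kne ne(2)]
  have "gr.vs X1' T1 T2 \<noteq> {}" by (rule path_image_nonempty)
  then have "?J' \<noteq> {}" by (simp add: gr.frame_def)
  \<comment> \<open>Only the frame is known to return to the chart from its sides; for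
    \<open>?f\<close> to be continuous on the closed inside, the image of that whole region must
    stay in \<open>U\<close>.\<close>
  have fQ: "f ` \<phi> ` (?J \<union> inside ?J) \<subseteq> U"
    by (rule image_of_inside[OF S sets_mu prob hom inv U \<phi> R(1) E(1) R(2,3) R'(1) E'(1,2) _ fJ]) fact
  let ?f = "\<theta> \<circ> f \<circ> \<phi>"
  have cont: "continuous_on (?J \<union> inside ?J) ?f"
  proof (intro continuous_on_compose)
    show "continuous_on (?J \<union> inside ?J) \<phi>"
      by (rule continuous_on_subset[OF homeomorphism_cont1[OF \<phi>]]) simp
    show "continuous_on (\<phi> ` (?J \<union> inside ?J)) f"
      by (rule continuous_on_subset[OF homeomorphism_cont1[OF hom]]) (use \<phi>U US in auto)
    show "continuous_on (f ` \<phi> ` (?J \<union> inside ?J)) \<theta>"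
      by (rule continuous_on_subset[OF homeomorphism_cont2[OF \<phi>] fQ])
  qed
  have inj: "inj_on ?f ?J"
  proof (rule inj_onI)
    fix x y assume xy: "x \<in> ?J" "y \<in> ?J" "?f x = ?f y"
    have "f (\<phi> x) \<in> U" "f (\<phi> y) \<in> U" using fQ xy by auto
    then have "f (\<phi> x) = f (\<phi> y)" using xy(3) \<phi>\<theta> by (metis comp_apply)
    then have "\<phi> x = \<phi> y" using fi \<phi>U US by (meson inj_onD subsetD)
    then show "x = y" using \<theta>\<phi> by metis
  qed
  have pts: "?f (\<theta> (cross_point A B)) = \<theta> (cross_point C D)" if "A \<in> fs" "B \<in> fu" "f (cross_point A B) = cross_point C D" for A B C D
  proof -
    have "cross_point A B \<in> U" using s.cross_in_X(2)[OF that(1,2)] that(1) sub by blast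
    then show ?thesis using that(3) \<phi>\<theta> by simp
  qed
  have \<theta>_im: "\<theta> ` \<phi> ` A = A" for A by (simp add: image_image \<theta>\<phi>)
  have side_im: "?f ` A = B" if "f ` \<phi> ` A = \<phi> ` B" for A B
  proof -
    have "?f ` A = \<theta> ` f ` \<phi> ` A" by (simp add: image_comp comp_assoc)
    then show ?thesis using that \<theta>_im by simp
  qed
  have "\<exists>z\<in>?J \<union> inside ?J. ?f z = z"
    by (rule gr.crossing_fixed_point[OF mem good lt lt' kne' cont inj
        pts[OF mem(9,3) corners(1)] pts[OF mem(9,4) corners(2)] pts[OF mem(10,3) corners(3)] pts[OF mem(10,4) corners(4)]
        side_im[OF sides(1)] side_im[OF sides(2)] side_im[OF sides(3)] side_im[OF sides(4)]])
  then obtain z where z: "z \<in> ?J \<union> inside ?J" "?f z = z" by (rule bexE)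
  have fz: "f (\<phi> z) \<in> U" by (rule subsetD[OF fQ imageI[OF imageI[OF z(1)]]])
  have "f (\<phi> z) = \<phi> (?f z)" using \<phi>\<theta>[OF fz] by simp
  also have "\<dots> = \<phi> z" by (simp only: z(2))
  finally show ?thesis using \<phi>U[of z] by (rule bexI)
qed

lemma intervals_ordered:
  fixes t :: "nat \<Rightarrow> real"
  assumes t: "\<And>k. k < n \<Longrightarrow> t k < t (Suc k)" and ab: "a < b" "b < n"
    and x: "x \<in> {t a<..<t (Suc a)}" "y \<in> {t b<..<t (Suc b)}"
  shows "x < y"
proof -
  have "t (Suc a) \<le> t c" if "Suc a \<le> c" "c \<le> n" for c
    using that
  proof (induction c rule: dec_induct)
    case (step m)
    then show ?case using t[of m] by simp
  qed simp
  from this[of b] have "t (Suc a) \<le> t b" using ab by simp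
  then show ?thesis using x by simp
qed

lemma periodic_point_in_disc:
  assumes S: "compact S" "connected S" and hom: "homeomorphism S S F G" and inv: "distr \<mu> \<mu> F = \<mu>"
    and acts: "acts lam F Ts" "acts (inverse lam) F Tu" and lam: "lam > 1" and tame: "tame Ts" "tame Tu"
    and U: "openin (top_of_set S) U" "measure \<mu> U < 1 / 2" and \<phi>: "homeomorphism (UNIV :: complex set) U \<phi> \<theta>"
    and sub: "\<Union>fs \<union> \<Union>fu \<subseteq> U"
  shows "\<exists>x\<in>U. \<exists>n>0. (F ^^ n) x = x"
proof -
  interpret gr: grid fu fs s.key u.key "\<lambda>B. \<theta> \<circ> u.par B" "\<lambda>A. \<theta> \<circ> s.par A" u.dom s.dom
    "\<lambda>B A. inv (u.par B) (cross_point B A)" "\<lambda>A B. inv (s.par A) (cross_point A B)" "\<lambda>B A. \<theta> (cross_point A B)"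
    by (rule grid_in_chart[OF \<phi> sub])
  have "0 < emeasure (s.smeas s.base) (s.base \<inter> X)" "0 < emeasure (u.smeas u.base) (u.base \<inter> u.X)"
    using base_mass(1)[OF s.base] base_mass(3)[OF u.base] by (simp_all add: zero_less_iff_neq_zero uX)
  \<comment> \<open>Nine column strips: columns from strips 0, 4 and 8 bound two adjacent frames,
    each with three strips in between for \<open>IL\<close>, \<open>IM\<close>, \<open>IR\<close>.
    Five row strips: 0 and 4 hold the outer rows, 1 to 3 are \<open>JB\<close>, \<open>JM\<close>,
    \<open>JT\<close>.\<close>
  then obtain t \<kappa>1 r \<kappa>2 where \<kappa>: "\<kappa>1 > 0" "\<kappa>2 > 0"
    and t: "\<And>k. k < 9 \<Longrightarrow> t k < t (Suc k)" "\<And>k. k < 9 \<Longrightarrow>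
      emeasure (s.smeas s.base) (s.base \<inter> s.cset {t k<..<t (Suc k)}) = ennreal \<kappa>1"
    and r: "\<And>k. k < 5 \<Longrightarrow> r k < r (Suc k)" "\<And>k. k < 5 \<Longrightarrow>
      emeasure (u.smeas u.base) (u.base \<inter> u.cset {r k<..<r (Suc k)}) = ennreal \<kappa>2"
    using s.equal_mass_csets[OF sets_mu X_sets, of 9] u.equal_mass_csets[OF sets_mu X_sets[folded uX], of 5] by metis
  define I where "I k = {t k<..<t (Suc k)}" for k
  define J where "J k = {r k<..<r (Suc k)}" for k
  have I_less: "x < y" if "x \<in> I a" "y \<in> I b" "a < b" "b < 9" for x y a b
    using intervals_ordered[of 9 t a b x y] t(1) that unfolding I_def by blast
  have J_less: "x < y" if "x \<in> J a" "y \<in> J b" "a < b" "b < 5" for x y a b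
    using intervals_ordered[of 5 r a b x y] r(1) that unfolding J_def by blast
  have col: "\<exists>B\<in>fu. s.key B \<in> I k" if "k < 9" for k
  proof -
    have "s.base \<inter> s.cset (I k) \<noteq> {}" using t(2)[OF that] \<kappa>(1) unfolding I_def by (intro notI) simp
    then obtain z where "z \<in> s.cset (I k)" by blast
    then show ?thesis using s.XD(3)[of z] by (auto simp: s.cset_def)
  qed
  have row: "\<exists>A\<in>fs. u.key A \<in> J k" if "k < 5" for k
  proof -
    have "u.base \<inter> u.cset (J k) \<noteq> {}" using r(2)[OF that] \<kappa>(2) unfolding J_def by (intro notI) simp
    then obtain z where "z \<in> u.cset (J k)" by blast
    then show ?thesis using u.XD(3)[of z] by (auto simp: u.cset_def)
  qed
  obtain k l m where klm: "k \<in> fs" "l \<in> fs" "m \<in> fs" "u.key k \<in> J 0" "u.key l \<in> J 4" "u.key m \<in> J 2"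
    using row[of 0] row[of 4] row[of 2] by auto
  obtain e0 where e0: "e0 \<in> fu" "s.key e0 \<in> I 0" using col[of 0] by auto
  obtain e2 where e2: "e2 \<in> fu" "s.key e2 \<in> I 4" using col[of 4] by auto
  obtain e4 where e4: "e4 \<in> fu" "s.key e4 \<in> I 8" using col[of 8] by auto
  obtain a where a: "a \<in> fu" "s.key a \<in> I 2" using col[of 2] by auto
  obtain b where b: "b \<in> fu" "s.key b \<in> I 6" using col[of 6] by auto
  have lt: "s.key e0 < s.key a" "s.key a < s.key e2" "s.key e2 < s.key b" "s.key b < s.key e4"
    by (rule I_less[OF e0(2) a(2)] I_less[OF a(2) e2(2)] I_less[OF e2(2) b(2)] I_less[OF b(2) e4(2)]; simp)+
  have lt': "u.key k < u.key m" "u.key m < u.key l"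
    by (rule J_less[OF klm(4,6)] J_less[OF klm(6,5)]; simp)+
  have "gr.good e0 e2 k l \<or> gr.good e4 e2 k l"
    by (rule gr.good_half[OF e0(1) e4(1) e2(1) klm(1,2) a(1) b(1) klm(3)])
      (use lt lt' in \<open>auto simp: open_segment_eq_real_ivl\<close>)
  then have "gr.good e0 e2 k l \<or> gr.good e2 e4 k l"
    using gr.good_commute[OF e2(1) e4(1) klm(1,2)] by simp
  \<comment> \<open>\<open>p\<close> is the index of the strip of the left column, \<open>0\<close>
    or \<open>4\<close>; from here both cases are treated alike.\<close>
  then obtain i j p where ij: "i \<in> fu" "j \<in> fu" "s.key i \<in> I p" "s.key j \<in> I (p + 4)" "p + 4 < 9" "gr.good i j k l"
  proof
    assume "gr.good e0 e2 k l"
    then show thesis using that[of e0 e2 0] e0 e2 by simp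
  next
    assume "gr.good e2 e4 k l"
    then show thesis using that[of e2 e4 4] e2 e4 by simp
  qed
  have borel: "I q \<in> sets borel" "J q \<in> sets borel" for q by (simp_all add: I_def J_def)
  have sepI: "\<forall>a\<in>I (p + 1). \<forall>b\<in>I (p + 2). \<forall>c\<in>I (p + 3). a < b \<and> b < c"
    using I_less[of _ "p + 1" _ "p + 2"] I_less[of _ "p + 2" _ "p + 3"] ij(5) by simp
  have sepJ: "\<forall>a\<in>J 3. \<forall>b\<in>J 2. \<forall>c\<in>J 1. c < b \<and> b < a"
    using J_less[of _ 1 _ 2] J_less[of _ 2 _ 3] by simp
  have mI: "emeasure (s.smeas s.base) (s.base \<inter> s.cset K) = ennreal \<kappa>1" if K: "K \<in> {I (p + 1), I (p + 2), I (p + 3)}" for K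
  proof -
    have "p + 1 < 9" "p + 2 < 9" "p + 3 < 9" using ij(5) by simp_all
    then show ?thesis using K t(2)[of "p + 1"] t(2)[of "p + 2"] t(2)[of "p + 3"] unfolding I_def by blast
  qed
  have mJ: "emeasure (u.smeas u.base) (u.base \<inter> u.cset K) = ennreal \<kappa>2" if K: "K \<in> {J 1, J 2, J 3}" for K
  proof -
    have "(1::nat) < 5" "(2::nat) < 5" "(3::nat) < 5" by simp_all
    then show ?thesis using K r(2)[of 1] r(2)[of 2] r(2)[of 3] unfolding J_def by blast
  qed
  obtain n X1 X2 X1' X2' Y1 Y2 T1 T2 where n: "n > 0"
    and mem: "X1 \<in> fu" "X2 \<in> fu" "X1' \<in> fu" "X2' \<in> fu" "Y1 \<in> fs" "Y2 \<in> fs" "T1 \<in> fs" "T2 \<in> fs"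
    and keys: "s.key X1 \<in> I (p + 1)" "s.key X2 \<in> I (p + 3)" "s.key X1' \<in> I (p + 2)" "s.key X2' \<in> I (p + 2)"
      "u.key Y1 \<in> J 2" "u.key Y2 \<in> J 2" "u.key T1 \<in> J 1" "u.key T2 \<in> J 3"
    and corners: "(F ^^ n) (cross_point Y1 X1) = cross_point T1 X1'" "(F ^^ n) (cross_point Y1 X2) = cross_point T1 X2'"
      "(F ^^ n) (cross_point Y2 X1) = cross_point T2 X1'" "(F ^^ n) (cross_point Y2 X2) = cross_point T2 X2'"
    using crossing_corners[OF hom inv acts lam tame borel(1)[of "p + 1"] borel(1)[of "p + 2"] borel(1)[of "p + 3"]
        borel(2)[of 1] borel(2)[of 2] borel(2)[of 3] sepI sepJ \<kappa> mI mJ] by blast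
  note Fm = homeomorphism_preserves(1)[OF hom inv]
  have "\<exists>x\<in>U. (F ^^ n) x = x"
  proof (rule fixed_point_of_corners[OF S homeomorphism_funpow[OF hom] _ acts_funpow[OF acts(1)] acts_funpow[OF acts(2)]
        U \<phi> sub ij(1,2) mem(1-4) klm(1,2) mem(5-8) ij(6) _ _ _ _ _ _ _ _ _ _ _ _ corners])
    show "distr \<mu> \<mu> (F ^^ n) = \<mu>" using distr_funpow[OF Fm inv] by blast
    show "lam \<ge> 0" "inverse lam \<ge> 0" using lam by simp_all
    show "s.key i < s.key X1" by (rule I_less[OF ij(3) keys(1)]) (use ij(5) in simp_all)
    show "s.key X1 < s.key X1'" by (rule I_less[OF keys(1,3)]) (use ij(5) in simp_all)
    show "s.key X1' < s.key X2" by (rule I_less[OF keys(3,2)]) (use ij(5) in simp_all)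
    show "s.key X1 < s.key X2'" by (rule I_less[OF keys(1,4)]) (use ij(5) in simp_all)
    show "s.key X2' < s.key X2" by (rule I_less[OF keys(4,2)]) (use ij(5) in simp_all)
    show "s.key X2 < s.key j" by (rule I_less[OF keys(2) ij(4)]) (use ij(5) in simp_all)
    show "u.key k < u.key T1" by (rule J_less[OF klm(4) keys(7)]) simp_all
    show "u.key T1 < u.key Y1" by (rule J_less[OF keys(7,5)]) simp_all
    show "u.key Y1 < u.key T2" by (rule J_less[OF keys(5,8)]) simp_all
    show "u.key T1 < u.key Y2" by (rule J_less[OF keys(7,6)]) simp_all
    show "u.key Y2 < u.key T2" by (rule J_less[OF keys(6,8)]) simp_all
    show "u.key T2 < u.key l" by (rule J_less[OF keys(8) klm(5)]) simp_all
  qed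
  then show ?thesis using n by blast
qed

end

theorem theorem6p2:
  fixes S :: "'a::metric_space set" and \<mu> :: "'a measure" and F :: "'a \<Rightarrow> 'a"
  assumes "compact_surface S"
    and "ou_measure (top_of_set S) (surface_boundary S) \<mu>"
    and "emeasure \<mu> S = 1"
    and "measurable_pA S \<mu> F"
  shows "S \<subseteq> closure {x \<in> S. \<exists>n>0. (F ^^ n) x = x}"
proof
  fix p assume p: "p \<in> S"
  have sets_mu: "sets \<mu> = sets (borel_of (top_of_set S))"
    using assms(2) by (simp add: ou_measure_def)
  have space_mu: "space \<mu> = S"
    using sets_eq_imp_space_eq[OF sets_mu] by (simp add: space_borel_of)
  have prob: "prob_space \<mu>"
    by (rule prob_spaceI) (simp add: space_mu assms(3))
  obtain G where G: "homeomorphism S S F G" using assms(4) by (auto simp: measurable_pA_def)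
  have inv: "distr \<mu> \<mu> F = \<mu>" using assms(4) by (simp add: measurable_pA_def)
  obtain Ts Tu c where pA: "pA_turbulations S \<mu> Ts Tu" and c: "c > 1"
    and im: "image_turbulation F Ts = scale_turbulation c Ts" "image_turbulation F Tu = scale_turbulation (inverse c) Tu"
    using assms(4) unfolding measurable_pA_def by blast
  have T: "measured_turbulation S \<mu> Ts" "measured_turbulation S \<mu> Tu" "tame Ts" "tame Tu"
    and full: "full_pair S \<mu> Ts Tu" and dense: "dense_streamlines S Ts"
    using pA by (simp_all add: pA_turbulations_def)
  have S: "compact S" using assms(1) by (simp add: compact_surface_def)
  have conn: "connected S" by (rule measured_turbulation_connected[OF S T(1) dense])
  have inj: "inj_on F S" by (rule inj_on_inverseI[of _ G]) (rule homeomorphism_apply1[OF G])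
  have acts: "acts c F Ts" "acts (inverse c) F Tu"
    by (rule acts_of_image_turbulation[OF im(1) inj T(1)], rule acts_of_image_turbulation[OF im(2) inj T(2)])
  show "p \<in> closure {x \<in> S. \<exists>n>0. (F ^^ n) x = x}"
    unfolding closure_approachable
  proof (intro allI impI)
    fix \<epsilon> :: real assume "\<epsilon> > 0"
    obtain U \<phi> \<theta> where U: "openin (top_of_set S) U" "U \<subseteq> ball p \<epsilon>" "measure \<mu> U < 1 / 2"
      and \<phi>: "homeomorphism (UNIV :: complex set) U \<phi> \<theta>"
      using small_disc[OF assms(1,2) prob_space.finite_measure[OF prob] p \<open>\<epsilon> > 0\<close>, of "1 / 2"] by auto
    have "U \<noteq> {}" using \<phi> by (auto simp: homeomorphism_def)
    have "\<exists>fs fu. pos_compatible_tartan S \<mu> Ts Tu (fs, fu) \<and> \<Union>fs \<union> \<Union>fu \<subseteq> U"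
      by (rule full[unfolded full_pair_def, THEN conjunct2, rule_format, OF conjI[OF U(1) \<open>U \<noteq> {}\<close>]])
    then obtain fs fu where R: "pos_compatible_tartan S \<mu> Ts Tu (fs, fu)" "\<Union>fs \<union> \<Union>fu \<subseteq> U"
      by (elim exE conjE)
    have tartan: "tartan S \<mu> Ts Tu (fs, fu)" and pos: "emeasure \<mu> (tartan_cross (fs, fu)) > 0"
      and compat: "compatible \<mu> Ts Tu (fs, fu)"
      using R(1) by (simp_all add: pos_compatible_tartan_def)
    note td = tartan[unfolded tartan_def prod.case]
    have fib: "fibers \<mu> Ts fs" "fibers \<mu> Tu fu"
      and ord: "cross_in_same_order Ts fs fu" "cross_in_same_order Tu fu fs"
      and bdd: "bounded_arcs Ts fs" "bounded_arcs Tu fu"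
      by (insert td, elim conjE, assumption)+
    have meet: "\<exists>x. A \<inter> B = {x}" if "A \<in> fs" "B \<in> fu" for A B
      using bspec[OF bspec[OF td[THEN conjunct2, THEN conjunct2, THEN conjunct1] that(1)] that(2)]
      by (elim exE conjE, intro exI)
    have "tartan_cross (fs, fu) \<noteq> {}" using pos by auto
    then have ne: "fs \<noteq> {}" "fu \<noteq> {}" by (auto simp: tartan_cross_def)
    have disj: "pairwise disjnt fs" "pairwise disjnt fu" using fib by (simp_all add: fibers_def)
    interpret tartan_pair S \<mu> Ts Tu fs fu
    proof (intro tartan_pair.intro fiber_family.intro tartan_pair_axioms.intro)
      show "\<exists>x. A \<inter> B = {x}" if "A \<in> fu" "B \<in> fs" for A B
        using meet[OF that(2,1)] by (simp add: Int_commute)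
    qed (fact T fib ord bdd disj meet ne compat sets_mu prob pos)+
    obtain x n where x: "x \<in> U" "n > 0" "(F ^^ n) x = x"
      using periodic_point_in_disc[OF S conn G inv acts c T(3,4) U(1,3) \<phi> R(2)] by blast
    have "x \<in> S" using x(1) openin_subset[OF U(1)] by auto
    moreover have "dist x p < \<epsilon>" using x(1) U(2) by (auto simp: dist_commute)
    ultimately show "\<exists>y\<in>{x \<in> S. \<exists>n>0. (F ^^ n) x = x}. dist y p < \<epsilon>"
      using x(2,3) by blast
  qed
qed

end
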